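(* Fix $q\ge3$ and $\zeta\in(0,1/2)$. There exists $\Delta_0=\Delta_0(q,\zeta)$ such that for every $\Delta\ge\Delta_0$ the following holds. Let $G$ be a uniformly random $\Delta$-regular graph on $n$ vertices, and suppose that $0<B<1$ and $$1-B\;\le\;\Big(\frac12-\zeta\Big)\frac{\log\Delta}{\Delta}.$$ Then, with probability $1-o_n(1)$ as $n\to\infty$ (with $\Delta$ fixed), the embedded $q$-state Potts measure $\mu_{G,B}$ is $\delta$-ULC with $\delta=1-\lambda^\star(1-B)B^{1-\Delta}$, where $\lambda^\star=-\lambda_{\min}(\mathbf A_G)$, one has $\delta\ge1/2$, and for every $\varepsilon\in(0,1/2)$ $$T_{\mathrm{mix}}(\varepsilon;P_{\mathrm{GD}})=O_q\Big(\sqrt\Delta\,n^2\log\frac1\varepsilon\Big),$$ where the implicit constant depends only on $q$.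
   Context: $\mathbf A_G$ is the adjacency matrix of $G=(V,E)$, $|V|=n$ (with $n\Delta$ even). The $q$-state Potts measure on $G$ is $\mu_{G,B}(\sigma)\propto B^{m_G(\sigma)}$, $\sigma\in[q]^V$, $[q]=\{1,\dots,q\}$, with $m_G(\sigma)=|\{vw\in E:\sigma_v=\sigma_w\}|$. Embedding: $\varphi:[q]^V\to\mathbb N^{V\times[q-1]}$, $\varphi(\sigma)_{v,k}=\mathbf 1_{\{\sigma_v=k\}}$ for $k\in[q-1]$; the embedded measure (same notation) is the pushforward under the injective map $\varphi$; its support is downward closed. $\delta$-ULC: for a finite index set $J$, a set $S\subseteq\mathbb N^J$ is downward closed if $\mathbf n\in S$ and $\mathbf 0\le\mathbf m\le\mathbf n$ imply $\mathbf m\in S$. A probability measure $\mu$ on $\mathbb N^J$ with downward closed support is $\delta$-ULC ($\delta>0$) if, with $\mathbf n!=\prod_{i\in J}n_i!$, $a(\mathbf n)=\mathbf n!\,\mu(\mathbf n)$, $\mathbf e_i$ the standard basis vectors, and $\mathcal I_{\mathbf n}=\{i\in J:\mathbf n+\mathbf e_i\in\mathrm{supp}(\mu)\}$, for every $\mathbf n\in\mathrm{supp}(\mu)$ the matrix $\big(1-\frac{a(\mathbf n)a(\mathbf n+\mathbf e_i+\mathbf e_j)}{a(\mathbf n+\mathbf e_i)a(\mathbf n+\mathbf e_j)}\big)_{i,j\in\mathcal I_{\mathbf n}}+(1-\delta)\,\mathrm{diag}\big(\frac{a(\mathbf n)}{a(\mathbf n+\mathbf e_i)}\big)_{i\in\mathcal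 I_{\mathbf n}}$ is positive semidefinite. Glauber dynamics: $P_{\mathrm{GD}}$ is the Markov chain on $[q]^V$ that picks $v\in V$ uniformly and recolors $v$ with color $c\in[q]$ with probability $B^{d_c^\sigma(v)}/\sum_{a=1}^qB^{d_a^\sigma(v)}$, where $d_c^\sigma(v)$ is the number of neighbours of $v$ with color $c$ under the current configuration $\sigma$. Mixing time: $T_{\mathrm{mix}}(\varepsilon;P)=\max_x\min\{t\in\mathbb N:\mathrm{TV}(P^t(x,\cdot),\mu)\le\varepsilon\}$, where $\mu$ is the stationary distribution and $\mathrm{TV}$ is total variation distance. *)

theory Defs
  imports "HOL-Probability.Probability" "Jordan_Normal_Form.Char_Poly"
begin

(* The law on a finite set S that is proportional to the weight w. *)
definition weight_pmf :: "'a set \<Rightarrow> ('a \<Rightarrow> real) \<Rightarrow> 'a pmf" where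
  "weight_pmf S w = embed_pmf (\<lambda>x. if x \<in> S then w x / (\<Sum>y\<in>S. w y) else 0)"

lemma pmf_weight_pmf:
  assumes "finite S" and "S \<noteq> {}" and "\<And>x. x \<in> S \<Longrightarrow> 0 < w x"
  shows "pmf (weight_pmf S w) x = (if x \<in> S then w x / (\<Sum>y\<in>S. w y) else 0)"
proof -
  let ?f = "\<lambda>x. if x \<in> S then w x / (\<Sum>y\<in>S. w y) else 0"
  have pos: "0 < (\<Sum>y\<in>S. w y)"
    using assms by (intro sum_pos) auto
  have nn: "0 \<le> ?f x" for x
    using assms(3)[of x] pos by (auto simp: less_imp_le)
  have "(\<integral>\<^sup>+x. ennreal (?f x) \<partial>count_space UNIV) = (\<Sum>x\<in>S. ennreal (?f x))"
    using assms(1) by (intro nn_integral_count_space'[of S]) auto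
  also have "\<dots> = ennreal (\<Sum>x\<in>S. ?f x)"
    by (rule sum_ennreal) (rule nn)
  also have "(\<Sum>x\<in>S. ?f x) = 1"
    using pos by (simp flip: sum_divide_distrib)
  finally have one: "(\<integral>\<^sup>+x. ennreal (?f x) \<partial>count_space UNIV) = 1" by simp
  show ?thesis
    unfolding weight_pmf_def by (rule pmf_embed_pmf[OF nn one])
qed


(* A graph is a vertex set V together with a set E of two-element subsets of V.
   The sample space of the random regular graph consists of the edge sets on
   the vertex set {0, ..., n-1}. *)

definition regular_graphs :: "nat \<Rightarrow> nat \<Rightarrow> nat set set set" where
  "regular_graphs \<Delta> n =
     {E. E \<subseteq> {e. e \<subseteq> {..<n} \<and> card e = 2} \<and> (\<forall>v<n. card {e \<in> E. v \<in> e} = \<Delta>)}"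

(* For given \<Delta> and n with n * \<Delta> even, the set below is empty (and pmf_of_set is then
   unspecified) only if n \<le> \<Delta>; this concerns finitely many n. *)
definition random_regular_graph :: "nat \<Rightarrow> nat \<Rightarrow> nat set set pmf" where
  "random_regular_graph \<Delta> n = pmf_of_set (regular_graphs \<Delta> n)"

definition adjacency_matrix :: "nat \<Rightarrow> nat set set \<Rightarrow> real Matrix.mat" where
  "adjacency_matrix n E = Matrix.mat n n (\<lambda>(v, w). if {v, w} \<in> E then 1 else 0)"

definition lambda_min :: "real Matrix.mat \<Rightarrow> real" where
  "lambda_min A = Min {k. eigenvalue A k}"


definition configs :: "nat \<Rightarrow> 'v set \<Rightarrow> ('v \<Rightarrow> nat) set" where
  "configs q V = V \<rightarrow>\<^sub>E {1..q}"

definition mono_edges :: "'v set set \<Rightarrow> ('v \<Rightarrow> nat) \<Rightarrow> nat" where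
  "mono_edges E \<sigma> = card {{v, w} | v w. {v, w} \<in> E \<and> \<sigma> v = \<sigma> w}"

definition potts :: "nat \<Rightarrow> 'v set \<Rightarrow> 'v set set \<Rightarrow> real \<Rightarrow> ('v \<Rightarrow> nat) pmf" where
  "potts q V E B = weight_pmf (configs q V) (\<lambda>\<sigma>. B ^ mono_edges E \<sigma>)"


(* For an index set J, the space of multi-indices over J is represented by the functions to nat
   that vanish outside J. *)

definition multi_indices :: "'j set \<Rightarrow> ('j \<Rightarrow> nat) set" where
  "multi_indices J = {m. \<forall>i. i \<notin> J \<longrightarrow> m i = 0}"

definition downward_closed :: "('j \<Rightarrow> nat) set \<Rightarrow> bool" where
  "downward_closed S \<longleftrightarrow> (\<forall>n\<in>S. \<forall>m. m \<le> n \<longrightarrow> m \<in> S)"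

(* n + e_i *)
definition add_unit :: "('j \<Rightarrow> nat) \<Rightarrow> 'j \<Rightarrow> 'j \<Rightarrow> nat" where
  "add_unit n i = n(i := n i + 1)"

definition psd_on :: "'i set \<Rightarrow> ('i \<Rightarrow> 'i \<Rightarrow> real) \<Rightarrow> bool" where
  "psd_on I M \<longleftrightarrow> (\<forall>i\<in>I. \<forall>j\<in>I. M i j = M j i) \<and>
                 (\<forall>x. 0 \<le> (\<Sum>i\<in>I. \<Sum>j\<in>I. x i * M i j * x j))"

(* a(n) = n! * mu(n) *)
definition ulc_weight :: "'j set \<Rightarrow> ('j \<Rightarrow> nat) pmf \<Rightarrow> ('j \<Rightarrow> nat) \<Rightarrow> real" where
  "ulc_weight J \<mu> n = (\<Prod>i\<in>J. fact (n i)) * pmf \<mu> n"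

definition ULC :: "real \<Rightarrow> 'j set \<Rightarrow> ('j \<Rightarrow> nat) pmf \<Rightarrow> bool" where
  "ULC \<delta> J \<mu> \<longleftrightarrow>
     0 < \<delta> \<and> finite J \<and> set_pmf \<mu> \<subseteq> multi_indices J \<and> downward_closed (set_pmf \<mu>) \<and>
     (\<forall>n\<in>set_pmf \<mu>.
        let a = ulc_weight J \<mu>
        in psd_on {i \<in> J. add_unit n i \<in> set_pmf \<mu>}
             (\<lambda>i j. (1 - a n * a (add_unit (add_unit n i) j) / (a (add_unit n i) * a (add_unit n j)))
                    + (1 - \<delta>) * (if i = j then a n / a (add_unit n i) else 0)))"

(* The colour q is not recorded: a vertex of colour q is mapped to the zero vector. *)
definition embed_config :: "nat \<Rightarrow> 'v set \<Rightarrow> ('v \<Rightarrow> nat) \<Rightarrow> 'v \<times> nat \<Rightarrow> nat" where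
  "embed_config q V \<sigma> = (\<lambda>(v, k). if v \<in> V \<and> k \<in> {1..q - 1} \<and> \<sigma> v = k then 1 else 0)"

definition embedded_potts :: "nat \<Rightarrow> 'v set \<Rightarrow> 'v set set \<Rightarrow> real \<Rightarrow> ('v \<times> nat \<Rightarrow> nat) pmf" where
  "embedded_potts q V E B = map_pmf (embed_config q V) (potts q V E B)"


definition colour_degree :: "'v set \<Rightarrow> 'v set set \<Rightarrow> ('v \<Rightarrow> nat) \<Rightarrow> 'v \<Rightarrow> nat \<Rightarrow> nat" where
  "colour_degree V E \<sigma> v c = card {w \<in> V. {v, w} \<in> E \<and> \<sigma> w = c}"

definition glauber_update ::
  "nat \<Rightarrow> 'v set \<Rightarrow> 'v set set \<Rightarrow> real \<Rightarrow> 'v \<Rightarrow> ('v \<Rightarrow> nat) \<Rightarrow> ('v \<Rightarrow> nat) pmf" where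
  "glauber_update q V E B v \<sigma> =
     map_pmf (\<lambda>c. \<sigma>(v := c)) (weight_pmf {1..q} (\<lambda>c. B ^ colour_degree V E \<sigma> v c))"

definition glauber :: "nat \<Rightarrow> 'v set \<Rightarrow> 'v set set \<Rightarrow> real \<Rightarrow> ('v \<Rightarrow> nat) \<Rightarrow> ('v \<Rightarrow> nat) pmf" where
  "glauber q V E B \<sigma> = bind_pmf (pmf_of_set V) (\<lambda>v. glauber_update q V E B v \<sigma>)"

primrec kernel_pow :: "('s \<Rightarrow> 's pmf) \<Rightarrow> nat \<Rightarrow> 's \<Rightarrow> 's pmf" where
  "kernel_pow P 0 x = return_pmf x"
| "kernel_pow P (Suc t) x = bind_pmf (kernel_pow P t x) P"

definition total_variation :: "'s pmf \<Rightarrow> 's pmf \<Rightarrow> real" where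
  "total_variation \<mu> \<nu> = (SUP A. \<bar>measure_pmf.prob \<mu> A - measure_pmf.prob \<nu> A\<bar>)"

(* For a finite state space \<Omega> and a kernel P with stationary law \<mu>. The minimum is taken in enat,
   so that it is infinite if the total variation distance never drops to \<epsilon>. *)
definition mixing_time :: "'s set \<Rightarrow> ('s \<Rightarrow> 's pmf) \<Rightarrow> 's pmf \<Rightarrow> real \<Rightarrow> enat" where
  "mixing_time \<Omega> P \<mu> \<epsilon> =
     Max ((\<lambda>x. INF t\<in>{t. total_variation (kernel_pow P t x) \<mu> \<le> \<epsilon>}. enat t) ` \<Omega>)"

(* The measure potts is reversible, hence stationary, for the Glauber dynamics; it is therefore the
   target law in the mixing time of the latter. *)

lemma finite_configs: "finite V \<Longrightarrow> finite (configs q V)"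
  by (auto simp: configs_def intro: finite_PiE)

lemma configs_nonempty: "1 \<le> q \<Longrightarrow> configs q V \<noteq> {}"
  by (auto simp: configs_def PiE_eq_empty_iff)

lemma configs_upd: "\<sigma> \<in> configs q V \<Longrightarrow> v \<in> V \<Longrightarrow> c \<in> {1..q} \<Longrightarrow> \<sigma>(v := c) \<in> configs q V"
  by (auto simp: configs_def PiE_iff extensional_def)

lemma pmf_potts:
  assumes "finite V" "1 \<le> q" "0 < B"
  shows "pmf (potts q V E B) \<sigma> =
           (if \<sigma> \<in> configs q V
            then B ^ mono_edges E \<sigma> / (\<Sum>\<tau>\<in>configs q V. B ^ mono_edges E \<tau>) else 0)"
  unfolding potts_def
  using assms by (intro pmf_weight_pmf finite_configs configs_nonempty) auto

lemma colour_degree_upd: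
  assumes "{v} \<notin> E"
  shows "colour_degree V E (\<sigma>(v := c)) v d = colour_degree V E \<sigma> v d"
proof -
  have "{w \<in> V. {v, w} \<in> E \<and> (\<sigma>(v := c)) w = d} = {w \<in> V. {v, w} \<in> E \<and> \<sigma> w = d}"
    using assms by auto
  then show ?thesis by (simp add: colour_degree_def)
qed

lemma mono_edges_split:
  assumes "finite V" "E \<subseteq> {e. e \<subseteq> V \<and> card e = 2}"
  shows "mono_edges E \<sigma> =
    card {{u, w} | u w. {u, w} \<in> E \<and> \<sigma> u = \<sigma> w \<and> v \<noteq> u \<and> v \<noteq> w} + colour_degree V E \<sigma> v (\<sigma> v)"
proof -
  let ?R = "{{u, w} | u w. {u, w} \<in> E \<and> \<sigma> u = \<sigma> w \<and> v \<noteq> u \<and> v \<noteq> w}"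
  let ?N = "{w \<in> V. {v, w} \<in> E \<and> \<sigma> w = \<sigma> v}"
  have fE: "finite E"
    using assms by (auto intro: finite_subset[of E "Pow V"])
  have "{{u, w} | u w. {u, w} \<in> E \<and> \<sigma> u = \<sigma> w} = ?R \<union> (\<lambda>w. {v, w}) ` ?N"
  proof (intro equalityI subsetI)
    fix e assume "e \<in> {{u, w} | u w. {u, w} \<in> E \<and> \<sigma> u = \<sigma> w}"
    then obtain u w where e: "e = {u, w}" "{u, w} \<in> E" "\<sigma> u = \<sigma> w" by blast
    moreover have "u \<in> V" "w \<in> V" using e(2) assms(2) by auto
    ultimately show "e \<in> ?R \<union> (\<lambda>w. {v, w}) ` ?N"
      by (cases "u = v"; cases "w = v") (auto simp: insert_commute image_iff)
  next
    fix e assume "e \<in> ?R \<union> (\<lambda>w. {v, w}) ` ?N"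
    then show "e \<in> {{u, w} | u w. {u, w} \<in> E \<and> \<sigma> u = \<sigma> w}"
      by (auto 4 3)
  qed
  moreover have "finite ?R" by (rule finite_subset[OF _ fE]) auto
  moreover have "?R \<inter> (\<lambda>w. {v, w}) ` ?N = {}" by (auto simp: doubleton_eq_iff)
  moreover have "card ((\<lambda>w. {v, w}) ` ?N) = card ?N"
    by (rule card_image) (auto simp: inj_on_def doubleton_eq_iff)
  ultimately show ?thesis
    using assms(1) by (simp add: mono_edges_def colour_degree_def card_Un_disjoint)
qed

lemma pmf_glauber_update:
  assumes "1 \<le> q" "0 < B"
  shows "pmf (glauber_update q V E B v \<sigma>) \<tau> =
    (if \<tau> = \<sigma>(v := \<tau> v) \<and> \<tau> v \<in> {1..q}
     then B ^ colour_degree V E \<sigma> v (\<tau> v) / (\<Sum>c\<in>{1..q}. B ^ colour_degree V E \<sigma> v c) else 0)"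
proof -
  let ?p = "weight_pmf {1..q} (\<lambda>c. B ^ colour_degree V E \<sigma> v c)"
  have p: "pmf ?p c = (if c \<in> {1..q} then B ^ colour_degree V E \<sigma> v c /
                        (\<Sum>c\<in>{1..q}. B ^ colour_degree V E \<sigma> v c) else 0)" for c
    using assms by (intro pmf_weight_pmf) auto
  have inj: "inj (\<lambda>c. \<sigma>(v := c))" by (auto simp: inj_def fun_upd_eqD)
  show ?thesis
  proof (cases "\<tau> = \<sigma>(v := \<tau> v)")
    case True
    then have "pmf (map_pmf (\<lambda>c. \<sigma>(v := c)) ?p) \<tau> = pmf ?p (\<tau> v)"
      using pmf_map_inj'[OF inj, of ?p "\<tau> v"] by simp
    then show ?thesis unfolding glauber_update_def p using True by auto
  next
    case False
    then have "\<tau> \<notin> (\<lambda>c. \<sigma>(v := c)) ` set_pmf ?p" by (metis fun_upd_same imageE)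
    then show ?thesis unfolding glauber_update_def using False
      by (auto simp: pmf_map_outside)
  qed
qed

lemma potts_detailed_balance:
  assumes fin: "finite V" and E: "E \<subseteq> {e. e \<subseteq> V \<and> card e = 2}" and q: "1 \<le> q" and B: "0 < B"
    and v: "v \<in> V" and s: "\<sigma> \<in> configs q V" and t: "\<tau> \<in> configs q V"
  shows "pmf (potts q V E B) \<sigma> * pmf (glauber_update q V E B v \<sigma>) \<tau> =
         pmf (potts q V E B) \<tau> * pmf (glauber_update q V E B v \<tau>) \<sigma>"
proof (cases "\<tau> = \<sigma>(v := \<tau> v)")
  case True
  then have st: "\<sigma> = \<tau>(v := \<sigma> v)" by (metis fun_upd_triv fun_upd_upd)
  have loop: "{v} \<notin> E" using E by auto
  have deg: "colour_degree V E \<tau> v c = colour_degree V E \<sigma> v c" for c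
    using colour_degree_upd[OF loop, of V \<sigma> "\<tau> v" c] True by simp
  have off: "\<tau> u = \<sigma> u" if "v \<noteq> u" for u
    using that fun_cong[OF True, of u] by simp
  have R: "{{u, w} | u w. {u, w} \<in> E \<and> \<tau> u = \<tau> w \<and> v \<noteq> u \<and> v \<noteq> w} =
           {{u, w} | u w. {u, w} \<in> E \<and> \<sigma> u = \<sigma> w \<and> v \<noteq> u \<and> v \<noteq> w}"
    using off by metis
  have range: "\<sigma> v \<in> {1..q}" "\<tau> v \<in> {1..q}"
    using s t v by (auto simp: configs_def PiE_iff)
  show ?thesis
    using s t st[symmetric] True[symmetric] range
    by (simp add: pmf_potts[OF fin q B] pmf_glauber_update[OF q B] deg power_add R
        mono_edges_split[OF fin E, where v = v and \<sigma> = \<sigma>]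
        mono_edges_split[OF fin E, where v = v and \<sigma> = \<tau>])
next
  case False
  then have "\<sigma> \<noteq> \<tau>(v := \<sigma> v)" by (metis fun_upd_triv fun_upd_upd)
  with False show ?thesis by (simp add: pmf_glauber_update[OF q B])
qed

lemma potts_stationary:
  assumes fin: "finite V" and ne: "V \<noteq> {}" and E: "E \<subseteq> {e. e \<subseteq> V \<and> card e = 2}"
    and q: "1 \<le> q" and B: "0 < B"
  shows "bind_pmf (potts q V E B) (glauber q V E B) = potts q V E B"
proof -
  let ?\<Omega> = "configs q V" and ?p = "potts q V E B"
  have fO: "finite ?\<Omega>" using fin by (rule finite_configs)
  have sp: "set_pmf ?p \<subseteq> ?\<Omega>" by (auto simp: set_pmf_iff pmf_potts[OF fin q B] split: if_splits)
  have su: "set_pmf (glauber_update q V E B v \<sigma>) \<subseteq> ?\<Omega>" if "v \<in> V" "\<sigma> \<in> ?\<Omega>" for v \<sigma>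
  proof
    fix \<tau> assume "\<tau> \<in> set_pmf (glauber_update q V E B v \<sigma>)"
    then have "\<tau> = \<sigma>(v := \<tau> v)" "\<tau> v \<in> {1..q}"
      by (auto simp: set_pmf_iff pmf_glauber_update[OF q B] split: if_splits)
    then show "\<tau> \<in> ?\<Omega>" using configs_upd[OF that(2,1), of "\<tau> v"] by simp
  qed
  have inv: "bind_pmf ?p (glauber_update q V E B v) = ?p" if v: "v \<in> V" for v
  proof (rule pmf_eqI)
    fix \<tau>
    let ?k = "glauber_update q V E B v"
    have sum: "pmf (bind_pmf ?p ?k) \<tau> = (\<Sum>\<sigma>\<in>?\<Omega>. pmf ?p \<sigma> * pmf (?k \<sigma>) \<tau>)"
      unfolding pmf_bind using sp fO by (subst integral_measure_pmf[of ?\<Omega>]) auto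
    show "pmf (bind_pmf ?p ?k) \<tau> = pmf ?p \<tau>"
    proof (cases "\<tau> \<in> ?\<Omega>")
      case True
      have "(\<Sum>\<sigma>\<in>?\<Omega>. pmf ?p \<sigma> * pmf (?k \<sigma>) \<tau>) = (\<Sum>\<sigma>\<in>?\<Omega>. pmf ?p \<tau> * pmf (?k \<tau>) \<sigma>)"
        using potts_detailed_balance[OF fin E q B v _ True] by (intro sum.cong) auto
      also have "\<dots> = pmf ?p \<tau>"
        using sum_pmf_eq_1[OF fO su[OF v True]] by (simp flip: sum_distrib_left)
      finally show ?thesis using sum by simp
    next
      case False
      then have "pmf (?k \<sigma>) \<tau> = 0" if "\<sigma> \<in> ?\<Omega>" for \<sigma>
        using su[OF v that] by (auto simp: pmf_eq_0_set_pmf)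
      then show ?thesis using sum False by (simp add: pmf_potts[OF fin q B])
    qed
  qed
  have "bind_pmf ?p (glauber q V E B) =
        bind_pmf (pmf_of_set V) (\<lambda>v. bind_pmf ?p (glauber_update q V E B v))"
    unfolding glauber_def by (rule bind_commute_pmf)
  also have "\<dots> = bind_pmf (pmf_of_set V) (\<lambda>v. ?p)"
    using inv fin ne by (intro bind_pmf_cong) auto
  finally show ?thesis by simp
qed

end

theory Submission
  imports Defs "HOL-Real_Asymp.Real_Asymp"
begin

text \<open>
  Spectrum: for the uniform random regular graph, simple switchings give a differential inequality for the
  moment generating function of the number of edges between two vertex sets. It yields Poisson-type tails sharp
  enough for a union bound over all pairs of vertex sets, so with probability tending to 1 every edge count
  \<open>e(S, T)\<close> is within \<open>O(sqrt \<Delta>) sqrt (|S| |T|)\<close> of \<open>\<Delta> |S| |T| / n\<close>. The converse to the expander mixing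
  lemma due to Bilu and Linial turns this into \<open>\<lambda>* = O(sqrt \<Delta> log \<Delta>)\<close>. The logarithm is harmless:
  \<open>B^(-\<Delta>) \<le> \<Delta>^(1/2 - \<zeta>/2)\<close> leaves a factor \<open>\<Delta>^(\<zeta>/2)\<close> to spare, and \<open>\<delta> \<ge> 1/2\<close> follows.

  ULC: with \<open>U\<close> the set of vertices of colour \<open>q\<close> and \<open>J\<close> the all-ones matrix on colours, the matrix in
  question is \<open>I \<otimes> J + A_U \<otimes> ((1 - B) J + B (1 - B) I)\<close> plus a diagonal with entries at least
  \<open>(1 - \<delta>) B^\<Delta>\<close>, and \<open>A_U \<ge> -\<lambda>*\<close>.

  Mixing: a Bochner-type identity shows that \<open>\<delta>\<close>-ULC implies spectral gap \<open>\<delta>\<close> for the continuous-time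
  birth-death chain on multi-indices. Comparing Dirichlet forms costs a factor \<open>2 q n B^(-\<Delta>)\<close>, and the
  smallest probability is at least \<open>q^(-n) B^(n \<Delta>)\<close>.
\<close>

section \<open>Switchings in regular graphs\<close>

text \<open>The edges of a uniform simple regular graph are not independent, so their moment
  generating function does not factor; the involution given by switchings replaces independence.
  Only the least eigenvalue is needed, which shortens the spectral part: subtracting (\<Delta>/n) J
  from the adjacency matrix can only lower its quadratic form, so a lower bound for the difference
  is one for the matrix itself, on all vectors and not only on the complement of the constants. No
  spectral theorem is invoked: the least eigenvalue and the Poincare constant both come from
  minimising a quadratic form over a compact sphere. The event \<open>pseudorandom\<close> does not
  mention B and therefore serves every B in the range. The final constant depends on q alone because
  the losses in \<Delta>, namely B^(-\<Delta>) and the n ln \<Delta> hidden in the smallest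
  probability, have a product of at most n sqrt \<Delta>.\<close>

definition switch :: "'v set set \<Rightarrow> 'v \<Rightarrow> 'v \<Rightarrow> 'v \<Rightarrow> 'v \<Rightarrow> 'v set set" where
  "switch E a b c d = (E - {{a, b}, {c, d}}) \<union> {{a, d}, {c, b}}"

text \<open>The two inequalities prevent loops. In a simple graph every other coincidence among the
  four vertices is already excluded by the conditions on the edges.\<close>

definition switchable :: "'v set set \<Rightarrow> 'v \<Rightarrow> 'v \<Rightarrow> 'v \<Rightarrow> 'v \<Rightarrow> bool" where
  "switchable E a b c d \<longleftrightarrow>
     {a, b} \<in> E \<and> {c, d} \<in> E \<and> {a, d} \<notin> E \<and> {c, b} \<notin> E \<and> a \<noteq> d \<and> c \<noteq> b"

definition adj :: "'v set set \<Rightarrow> 'v \<Rightarrow> 'v \<Rightarrow> real" where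
  "adj E u v = of_bool ({u, v} \<in> E)"

lemma adj_sym: "adj E u v = adj E v u"
  by (simp add: adj_def insert_commute)

lemma adj_bounds [simp]: "0 \<le> adj E u v" "adj E u v \<le> 1"
  by (auto simp: adj_def)

lemma switchable_distinct:
  assumes "\<And>e. e \<in> E \<Longrightarrow> card e = 2" "switchable E a b c d"
  shows "a \<noteq> b" "c \<noteq> d" "a \<noteq> c" "b \<noteq> d" "a \<noteq> d" "c \<noteq> b"
    "{a, b} \<noteq> {c, d}" "{a, d} \<noteq> {c, b}"
proof -
  have "card {a, b} = 2" "card {c, d} = 2"
    using assms by (auto simp: switchable_def)
  then show *: "a \<noteq> b" "c \<noteq> d" by auto
  show **: "a \<noteq> c" "b \<noteq> d" "a \<noteq> d" "c \<noteq> b"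
    using assms(2) by (auto simp: switchable_def)
  show "{a, b} \<noteq> {c, d}" "{a, d} \<noteq> {c, b}"
    using * ** by (auto simp: doubleton_eq_iff)
qed

lemma sum_switch:
  fixes w :: "'v set \<Rightarrow> real"
  assumes fin: "finite E" and E: "\<And>e. e \<in> E \<Longrightarrow> card e = 2" and sw: "switchable E a b c d"
  shows "(\<Sum>e\<in>switch E a b c d. w e) = (\<Sum>e\<in>E. w e) - w {a, b} - w {c, d} + w {a, d} + w {c, b}"
proof -
  note dist = switchable_distinct[OF E sw]
  have ins: "{a, b} \<in> E" "{c, d} \<in> E" "{a, d} \<notin> E" "{c, b} \<notin> E"
    using sw by (auto simp: switchable_def)
  have "(\<Sum>e\<in>switch E a b c d. w e) = (\<Sum>e\<in>E - {{a, b}, {c, d}}. w e) + (\<Sum>e\<in>{{a, d}, {c, b}}. w e)"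
    unfolding switch_def using fin ins by (intro sum.union_disjoint) auto
  also have "(\<Sum>e\<in>{{a, d}, {c, b}}. w e) = w {a, d} + w {c, b}"
    using dist by simp
  also have "(\<Sum>e\<in>E - {{a, b}, {c, d}}. w e) = (\<Sum>e\<in>E. w e) - (\<Sum>e\<in>{{a, b}, {c, d}}. w e)"
    using fin ins by (intro sum_diff) auto
  also have "(\<Sum>e\<in>{{a, b}, {c, d}}. w e) = w {a, b} + w {c, d}"
    using dist by simp
  finally show ?thesis by simp
qed

lemma switch_involution:
  assumes E: "\<And>e. e \<in> E \<Longrightarrow> card e = 2" and sw: "switchable E a b c d"
  shows "switchable (switch E a b c d) a d c b" "switch (switch E a b c d) a d c b = E"
proof -
  note dist = switchable_distinct[OF E sw]
  have ins: "{a, b} \<in> E" "{c, d} \<in> E" "{a, d} \<notin> E" "{c, b} \<notin> E"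
    using sw by (auto simp: switchable_def)
  have ne: "{a, b} \<noteq> {a, d}" "{a, b} \<noteq> {c, b}" "{c, d} \<noteq> {a, d}" "{c, d} \<noteq> {c, b}"
    using dist by (auto simp: doubleton_eq_iff)
  show "switchable (switch E a b c d) a d c b"
    using dist ins ne unfolding switchable_def switch_def by blast
  show "switch (switch E a b c d) a d c b = E"
    using dist ins ne unfolding switch_def by blast
qed

lemma regular_graphsD:
  assumes "E \<in> regular_graphs \<Delta> n"
  shows "finite E" "\<And>e. e \<in> E \<Longrightarrow> card e = 2" "\<And>e. e \<in> E \<Longrightarrow> e \<subseteq> {..<n}"
    "\<And>v. v < n \<Longrightarrow> card {e \<in> E. v \<in> e} = \<Delta>"
    "\<And>v. {v} \<notin> E"
proof -
  show "finite E"
    using assms by (intro finite_subset[of E "Pow {..<n}"]) (auto simp: regular_graphs_def)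
  show *: "\<And>e. e \<in> E \<Longrightarrow> card e = 2" "\<And>e. e \<in> E \<Longrightarrow> e \<subseteq> {..<n}"
    "\<And>v. v < n \<Longrightarrow> card {e \<in> E. v \<in> e} = \<Delta>"
    using assms by (auto simp: regular_graphs_def)
  show "{v} \<notin> E" for v using *(1)[of "{v}"] by auto
qed

lemma finite_regular_graphs: "finite (regular_graphs \<Delta> n)"
  by (rule finite_subset[of _ "Pow (Pow {..<n})"]) (auto simp: regular_graphs_def)

lemma switch_regular:
  assumes E: "E \<in> regular_graphs \<Delta> n" and sw: "switchable E a b c d"
  shows "switch E a b c d \<in> regular_graphs \<Delta> n"
proof -
  note R = regular_graphsD[OF E]
  note dist = switchable_distinct[OF R(2) sw]
  have lt: "a < n" "b < n" "c < n" "d < n"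
    using R(3)[of "{a, b}"] R(3)[of "{c, d}"] sw by (auto simp: switchable_def)
  let ?E = "switch E a b c d"
  have fin: "finite ?E" using R(1) by (simp add: switch_def)
  have deg: "card {e \<in> ?E. v \<in> e} = \<Delta>" if "v < n" for v
  proof -
    have "real (card {e \<in> ?E. v \<in> e}) = (\<Sum>e\<in>?E. of_bool (v \<in> e))"
      using fin by (simp add: sum.If_cases Int_def of_bool_def if_distrib)
    \<comment> \<open>Each of the four vertices lies in exactly one removed and one added edge, so
      the indicator weights cancel.\<close>
    also have "\<dots> = (\<Sum>e\<in>E. of_bool (v \<in> e))"
      using dist by (subst sum_switch[OF R(1,2) sw]) auto
    also have "\<dots> = real (card {e \<in> E. v \<in> e})"
      using R(1) by (simp add: sum.If_cases Int_def of_bool_def if_distrib)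
    finally show ?thesis using R(4)[OF that] by simp
  qed
  have "?E \<subseteq> {e. e \<subseteq> {..<n} \<and> card e = 2}"
  proof
    fix e assume "e \<in> ?E"
    then consider "e \<in> E" | "e = {a, d}" | "e = {c, b}" by (auto simp: switch_def)
    then show "e \<in> {e. e \<subseteq> {..<n} \<and> card e = 2}"
      by cases (use R(2,3) lt dist in simp_all)
  qed
  with deg show ?thesis by (simp add: regular_graphs_def)
qed

lemma sum_adj:
  assumes "E \<in> regular_graphs \<Delta> n" "u < n"
  shows "(\<Sum>v<n. adj E u v) = real \<Delta>" "(\<Sum>v<n. adj E v u) = real \<Delta>"
proof -
  note R = regular_graphsD[OF assms(1)]
  have "bij_betw (\<lambda>v. {u, v}) {v. v < n \<and> {u, v} \<in> E} {e \<in> E. u \<in> e}"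
  proof (rule bij_betw_imageI)
    show "inj_on (\<lambda>v. {u, v}) {v. v < n \<and> {u, v} \<in> E}"
      by (auto simp: inj_on_def doubleton_eq_iff)
    have "\<exists>v. e = {u, v} \<and> v < n" if e: "e \<in> E" "u \<in> e" for e
    proof -
      obtain x y where "e = {x, y}" using R(2)[OF e(1)] by (auto simp: card_2_iff)
      with e R(3)[OF e(1)] show ?thesis by (auto simp: doubleton_eq_iff)
    qed
    then show "(\<lambda>v. {u, v}) ` {v. v < n \<and> {u, v} \<in> E} = {e \<in> E. u \<in> e}"
      by (fastforce simp: image_iff)
  qed
  then have "card {v. v < n \<and> {u, v} \<in> E} = \<Delta>"
    using R(4)[OF assms(2)] by (simp add: bij_betw_same_card)
  then show *: "(\<Sum>v<n. adj E u v) = real \<Delta>"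
    by (simp add: adj_def sum.If_cases of_bool_def if_distrib Int_def)
  then show "(\<Sum>v<n. adj E v u) = real \<Delta>" by (simp add: adj_sym)
qed

text \<open>Switching is an involution on the quintuples \<open>(E, a, b, c, d)\<close> that
  exchanges \<open>b\<close> and \<open>d\<close>. This is the double counting that turns a
  statistic of the edge a b into a statistic of the almost independent pair a, d.\<close>

lemma sum_switchable_reindex:
  fixes \<Phi> :: "nat set set \<Rightarrow> nat \<Rightarrow> nat \<Rightarrow> nat \<Rightarrow> nat \<Rightarrow> real"
  shows "(\<Sum>E\<in>regular_graphs \<Delta> n. \<Sum>a<n. \<Sum>b<n. \<Sum>c<n. \<Sum>d<n. of_bool (switchable E a b c d) * \<Phi> E a b c d) =
    (\<Sum>E\<in>regular_graphs \<Delta> n. \<Sum>a<n. \<Sum>b<n. \<Sum>c<n. \<Sum>d<n.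
       of_bool (switchable E a b c d) * \<Phi> (switch E a b c d) a d c b)"
proof -
  let ?X = "regular_graphs \<Delta> n \<times> {..<n} \<times> {..<n} \<times> {..<n} \<times> {..<n}"
  let ?Q = "{p \<in> ?X. case p of (E, a, b, c, d) \<Rightarrow> switchable E a b c d}"
  let ?i = "\<lambda>(E, a, b, c, d). (switch E a b c d, a, d, c, b)"
  have conv: "(\<Sum>E\<in>regular_graphs \<Delta> n. \<Sum>a<n. \<Sum>b<n. \<Sum>c<n. \<Sum>d<n. of_bool (switchable E a b c d) * \<Psi> E a b c d)
     = (\<Sum>(E, a, b, c, d)\<in>?Q. \<Psi> E a b c d)" (is "?l = ?r") for \<Psi> :: "nat set set \<Rightarrow> nat \<Rightarrow> nat \<Rightarrow> nat \<Rightarrow> nat \<Rightarrow> real"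
  proof -
    have "?l = (\<Sum>(E, a, b, c, d)\<in>?X. of_bool (switchable E a b c d) * \<Psi> E a b c d)"
      by (simp only: sum.cartesian_product)
    also have "\<dots> = ?r"
      by (rule sum.mono_neutral_cong_right) (auto simp: finite_regular_graphs)
    finally show ?thesis .
  qed
  have i: "?i p \<in> ?Q \<and> ?i (?i p) = p" if "p \<in> ?Q" for p
    using that switch_involution[OF regular_graphsD(2)] switch_regular by fastforce
  have "(\<Sum>(E, a, b, c, d)\<in>?Q. \<Phi> E a b c d) = (\<Sum>(E, a, b, c, d)\<in>?Q. \<Phi> (switch E a b c d) a d c b)"
    by (rule sum.reindex_bij_witness[of _ ?i ?i]) (use i switch_involution[OF regular_graphsD(2)] in \<open>auto\<close>)
  then show ?thesis by (simp only: conv)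
qed

text \<open>Ordered pairs are counted, so an edge inside both sets counts twice. Weight functions
  stand in for the indicators of the sets.\<close>

definition edge_count :: "nat \<Rightarrow> (nat \<Rightarrow> real) \<Rightarrow> (nat \<Rightarrow> real) \<Rightarrow> nat set set \<Rightarrow> real" where
  "edge_count n s t E = (\<Sum>a<n. \<Sum>b<n. s a * t b * adj E a b)"

text \<open>Two edges are added, and each is met by at most two ordered pairs. This one-sided bound
  is enough for both tails: for negative \<theta> it turns into a lower bound on the
  exponential.\<close>

lemma edge_count_switch_le:
  assumes s: "\<And>v. 0 \<le> s v \<and> s v \<le> 1" and t: "\<And>v. 0 \<le> t v \<and> t v \<le> 1"
  shows "edge_count n s t (switch E a b c d) \<le> edge_count n s t E + 4"
proof -
  have one: "(\<Sum>u<n. \<Sum>v<n. of_bool (u = x \<and> v = y)) \<le> (1::real)" for x y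
  proof -
    have "(\<Sum>u<n. \<Sum>v<n. of_bool (u = x \<and> v = y)) = (\<Sum>u<n. of_bool (u = x) * (\<Sum>v<n. of_bool (v = y)) :: real)"
      by (simp only: of_bool_conj sum_distrib_left)
    also have "\<dots> = (of_bool (x < n) * of_bool (y < n) :: real)"
      by simp
    also have "\<dots> \<le> 1" by (simp add: of_bool_def)
    finally show ?thesis .
  qed
  have two: "(\<Sum>u<n. \<Sum>v<n. if {u, v} = {x, y} then 1 else 0) \<le> (2::real)" for x y
  proof -
    have "(\<Sum>u<n. \<Sum>v<n. if {u, v} = {x, y} then 1 else 0) \<le>
        (\<Sum>u<n. \<Sum>v<n. of_bool (u = x \<and> v = y) + of_bool (u = y \<and> v = x) :: real)"
      by (intro sum_mono) (auto simp: doubleton_eq_iff)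
    then show ?thesis
      unfolding sum.distrib using one[of x y] one[of y x] by linarith
  qed
  have "edge_count n s t (switch E a b c d) \<le> (\<Sum>u<n. \<Sum>v<n. s u * t v * adj E u v +
      ((if {u, v} = {a, d} then 1 else 0) + (if {u, v} = {c, b} then 1 else 0)))"
    unfolding edge_count_def
  proof (intro sum_mono)
    fix u v
    define k :: real where "k = (if {u, v} = {a, d} then 1 else 0) + (if {u, v} = {c, b} then 1 else 0)"
    have st: "0 \<le> s u * t v" "s u * t v \<le> 1" using s t by (auto intro: mult_le_one)
    have k: "0 \<le> k" by (simp add: k_def)
    have "adj (switch E a b c d) u v \<le> adj E u v + k"
      by (auto simp: adj_def switch_def k_def)
    then have "s u * t v * adj (switch E a b c d) u v \<le> s u * t v * adj E u v + s u * t v * k"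
      using mult_left_mono[OF _ st(1)] by (metis distrib_left)
    also have "s u * t v * k \<le> k" using mult_right_mono[OF st(2) k] by simp
    finally show "s u * t v * adj (switch E a b c d) u v \<le> s u * t v * adj E u v +
      ((if {u, v} = {a, d} then 1 else 0) + (if {u, v} = {c, b} then 1 else 0))"
      unfolding k_def by simp
  qed
  also have "\<dots> \<le> edge_count n s t E + 4"
    unfolding sum.distrib edge_count_def using two[of a d] two[of c b] by linarith
  finally show ?thesis .
qed

text \<open>The last identity counts the obstructions to switching a given edge a b with an ordered
  edge c d: a new edge would be a loop, or would already be present.\<close>

lemma sum_adj_adj:
  assumes E: "E \<in> regular_graphs \<Delta> n"
  shows "(\<Sum>c<n. \<Sum>d<n. adj E c d) = real n * real \<Delta>"
    "(\<Sum>c<n. \<Sum>d<n. adj E c d * t d) = real \<Delta> * (\<Sum>d<n. t d)"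
    "a < n \<Longrightarrow> b < n \<Longrightarrow> (\<Sum>c<n. \<Sum>d<n. adj E c d * (of_bool (a = d) + of_bool (c = b) + adj E a d + adj E c b)) =
       2 * real \<Delta> + 2 * (real \<Delta>)\<^sup>2"
proof -
  note S = sum_adj[OF E]
  show "(\<Sum>c<n. \<Sum>d<n. adj E c d) = real n * real \<Delta>"
    using S by simp
  show t: "(\<Sum>c<n. \<Sum>d<n. adj E c d * t d) = real \<Delta> * (\<Sum>d<n. t d)" for t
  proof -
    have "(\<Sum>c<n. \<Sum>d<n. adj E c d * t d) = (\<Sum>d<n. (\<Sum>c<n. adj E c d) * t d)"
      unfolding sum_distrib_right by (rule sum.swap)
    then show ?thesis using S by (simp add: sum_distrib_left)
  qed
  show "(\<Sum>c<n. \<Sum>d<n. adj E c d * (of_bool (a = d) + of_bool (c = b) + adj E a d + adj E c b)) =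
       2 * real \<Delta> + 2 * (real \<Delta>)\<^sup>2" if ab: "a < n" "b < n"
  proof -
    have 1: "(\<Sum>c<n. \<Sum>d<n. adj E c d * of_bool (a = d)) = real \<Delta>"
      using t[of "\<lambda>d. of_bool (a = d)"] ab by (simp add: of_bool_def)
    have 2: "(\<Sum>c<n. \<Sum>d<n. adj E c d * adj E a d) = (real \<Delta>)\<^sup>2"
      using t[of "adj E a"] S ab by (simp add: power2_eq_square)
    have 3: "(\<Sum>c<n. \<Sum>d<n. adj E c d * of_bool (c = b)) = real \<Delta>"
    proof -
      have "(\<Sum>c<n. \<Sum>d<n. adj E c d * of_bool (c = b)) = (\<Sum>c<n. real \<Delta> * of_bool (c = b))"
        by (intro sum.cong) (simp_all only: sum_distrib_right[symmetric] S lessThan_iff)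
      then show ?thesis using ab by simp
    qed
    have 4: "(\<Sum>c<n. \<Sum>d<n. adj E c d * adj E c b) = (real \<Delta>)\<^sup>2"
      using S ab by (simp flip: sum_distrib_right sum_distrib_left add: power2_eq_square)
    show ?thesis using 1 2 3 4 by (simp add: distrib_left sum.distrib)
  qed
qed

text \<open>The lower bound is a union bound over the four obstructions.\<close>

lemma switchable_bounds:
  shows "of_bool (switchable E a b c d) \<le> adj E a b * adj E c d"
    "adj E a b * (adj E c d - adj E c d * (of_bool (a = d) + of_bool (c = b) + adj E a d + adj E c b))
      \<le> of_bool (switchable E a b c d)"
  by (auto simp: switchable_def adj_def)

text \<open>For the weight on \<open>(a, b)\<close>, every counted edge has n \<Delta> partners
  minus the obstructed ones. For the weight on \<open>(a, d)\<close>, all pairs of ordered edges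
  together give \<Delta>^2 times the two sums, and the obstructed pairs are subtracted with weight
  at most 1.\<close>

lemma sum_switchable_ge:
  assumes E: "E \<in> regular_graphs \<Delta> n" and s: "\<And>v. 0 \<le> s v \<and> s v \<le> 1" and t: "\<And>v. 0 \<le> t v \<and> t v \<le> 1"
  shows "(real n * real \<Delta> - 2 * real \<Delta> - 2 * (real \<Delta>)\<^sup>2) * edge_count n s t E \<le>
      (\<Sum>a<n. \<Sum>b<n. \<Sum>c<n. \<Sum>d<n. of_bool (switchable E a b c d) * (s a * t b))"
    "(real \<Delta>)\<^sup>2 * (\<Sum>v<n. s v) * (\<Sum>v<n. t v) - real n * real \<Delta> * (2 * real \<Delta> + 2 * (real \<Delta>)\<^sup>2) \<le>
      (\<Sum>a<n. \<Sum>b<n. \<Sum>c<n. \<Sum>d<n. of_bool (switchable E a b c d) * (s a * t d))"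
proof -
  note A = sum_adj_adj[OF E]
  let ?g = "\<lambda>a b c d. adj E c d * (of_bool (a = d) + of_bool (c = b) + adj E a d + adj E c b)"
  have "(real n * real \<Delta> - 2 * real \<Delta> - 2 * (real \<Delta>)\<^sup>2) * edge_count n s t E =
     (\<Sum>a<n. \<Sum>b<n. s a * t b * adj E a b * (\<Sum>c<n. \<Sum>d<n. adj E c d - ?g a b c d))"
    unfolding edge_count_def sum_distrib_left[of "_ - _"]
    by (intro sum.cong refl) (simp add: A sum_subtractf)
  also have "\<dots> \<le> (\<Sum>a<n. \<Sum>b<n. \<Sum>c<n. \<Sum>d<n. of_bool (switchable E a b c d) * (s a * t b))"
    unfolding sum_distrib_left
  proof (intro sum_mono)
    fix a b c d
    have "(s a * t b) * (adj E a b * (adj E c d - ?g a b c d)) \<le> (s a * t b) * of_bool (switchable E a b c d)"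
      using s t by (intro mult_left_mono switchable_bounds) auto
    then show "s a * t b * adj E a b * (adj E c d - ?g a b c d) \<le> of_bool (switchable E a b c d) * (s a * t b)"
      by (simp add: mult_ac)
  qed
  finally show "(real n * real \<Delta> - 2 * real \<Delta> - 2 * (real \<Delta>)\<^sup>2) * edge_count n s t E \<le>
      (\<Sum>a<n. \<Sum>b<n. \<Sum>c<n. \<Sum>d<n. of_bool (switchable E a b c d) * (s a * t b))" .
  have "(real \<Delta>)\<^sup>2 * (\<Sum>v<n. s v) * (\<Sum>v<n. t v) - real n * real \<Delta> * (2 * real \<Delta> + 2 * (real \<Delta>)\<^sup>2)
     = (\<Sum>a<n. s a * real \<Delta>) * (real \<Delta> * (\<Sum>d<n. t d)) - (\<Sum>a<n. \<Sum>b<n. adj E a b) * (2 * real \<Delta> + 2 * (real \<Delta>)\<^sup>2)"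
    by (simp add: A sum_distrib_right[symmetric] power2_eq_square)
  also have "(\<Sum>a<n. s a * real \<Delta>) = (\<Sum>a<n. \<Sum>b<n. s a * adj E a b)"
    by (intro sum.cong) (simp_all add: sum_distrib_left[symmetric] sum_adj[OF E])
  also have "(\<Sum>a<n. \<Sum>b<n. s a * adj E a b) * (real \<Delta> * (\<Sum>d<n. t d)) - (\<Sum>a<n. \<Sum>b<n. adj E a b) * (2 * real \<Delta> + 2 * (real \<Delta>)\<^sup>2)
     = (\<Sum>a<n. \<Sum>b<n. s a * adj E a b * (\<Sum>c<n. \<Sum>d<n. adj E c d * t d) - adj E a b * (\<Sum>c<n. \<Sum>d<n. ?g a b c d))"
    unfolding sum_subtractf sum_distrib_right by (simp add: A)
  also have "\<dots> = (\<Sum>a<n. \<Sum>b<n. \<Sum>c<n. \<Sum>d<n. s a * adj E a b * (adj E c d * t d) - adj E a b * ?g a b c d)"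
    by (simp only: sum_subtractf sum_distrib_left)
  also have "\<dots> \<le> (\<Sum>a<n. \<Sum>b<n. \<Sum>c<n. \<Sum>d<n. of_bool (switchable E a b c d) * (s a * t d))"
  proof (intro sum_mono)
    fix a b c d
    have "0 \<le> s a * t d" "s a * t d \<le> 1" using s t by (auto intro: mult_le_one)
    have "(s a * t d) * (adj E a b * (adj E c d - ?g a b c d)) \<le> (s a * t d) * of_bool (switchable E a b c d)"
      using s t by (intro mult_left_mono switchable_bounds) auto
    moreover have "(s a * t d) * (adj E a b * ?g a b c d) \<le> 1 * (adj E a b * ?g a b c d)"
      using s t by (intro mult_right_mono mult_le_one) auto
    ultimately show "s a * adj E a b * (adj E c d * t d) - adj E a b * ?g a b c d \<le>
       of_bool (switchable E a b c d) * (s a * t d)"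
      by (simp add: algebra_simps)
  qed
  finally show "(real \<Delta>)\<^sup>2 * (\<Sum>v<n. s v) * (\<Sum>v<n. t v) - real n * real \<Delta> * (2 * real \<Delta> + 2 * (real \<Delta>)\<^sup>2) \<le>
      (\<Sum>a<n. \<Sum>b<n. \<Sum>c<n. \<Sum>d<n. of_bool (switchable E a b c d) * (s a * t d))" .
qed

lemma sum_switchable_le:
  assumes E: "E \<in> regular_graphs \<Delta> n" and s: "\<And>v. 0 \<le> s v \<and> s v \<le> 1" and t: "\<And>v. 0 \<le> t v \<and> t v \<le> 1"
  shows "(\<Sum>a<n. \<Sum>b<n. \<Sum>c<n. \<Sum>d<n. of_bool (switchable E a b c d) * (s a * t b)) \<le>
      real n * real \<Delta> * edge_count n s t E"
    "(\<Sum>a<n. \<Sum>b<n. \<Sum>c<n. \<Sum>d<n. of_bool (switchable E a b c d) * (s a * t d)) \<le>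
      (real \<Delta>)\<^sup>2 * (\<Sum>v<n. s v) * (\<Sum>v<n. t v)"
proof -
  note A = sum_adj_adj[OF E]
  have "(\<Sum>a<n. \<Sum>b<n. \<Sum>c<n. \<Sum>d<n. of_bool (switchable E a b c d) * (s a * t b)) \<le>
     (\<Sum>a<n. \<Sum>b<n. \<Sum>c<n. \<Sum>d<n. (adj E a b * adj E c d) * (s a * t b))"
    using s t by (intro sum_mono mult_right_mono switchable_bounds) auto
  also have "\<dots> = (\<Sum>a<n. \<Sum>b<n. s a * t b * adj E a b * (\<Sum>c<n. \<Sum>d<n. adj E c d))"
    by (simp only: sum_distrib_left mult_ac)
  also have "\<dots> = real n * real \<Delta> * edge_count n s t E"
    unfolding A edge_count_def by (simp only: sum_distrib_left mult_ac)
  finally show "(\<Sum>a<n. \<Sum>b<n. \<Sum>c<n. \<Sum>d<n. of_bool (switchable E a b c d) * (s a * t b)) \<le>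
      real n * real \<Delta> * edge_count n s t E" .
  have "(\<Sum>a<n. \<Sum>b<n. \<Sum>c<n. \<Sum>d<n. of_bool (switchable E a b c d) * (s a * t d)) \<le>
     (\<Sum>a<n. \<Sum>b<n. \<Sum>c<n. \<Sum>d<n. (adj E a b * adj E c d) * (s a * t d))"
    using s t by (intro sum_mono mult_right_mono switchable_bounds) auto
  also have "\<dots> = (\<Sum>a<n. s a * ((\<Sum>b<n. adj E a b) * (\<Sum>c<n. \<Sum>d<n. adj E c d * t d)))"
    by (simp only: sum_distrib_right) (simp only: sum_distrib_left mult_ac)
  also have "\<dots> = (\<Sum>a<n. s a * (real \<Delta> * (real \<Delta> * (\<Sum>v<n. t v))))"
    by (intro sum.cong) (simp_all add: A sum_adj[OF E])
  also have "\<dots> = (real \<Delta>)\<^sup>2 * (\<Sum>v<n. s v) * (\<Sum>v<n. t v)"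
    by (simp only: sum_distrib_right[symmetric]) (simp add: power2_eq_square)
  finally show "(\<Sum>a<n. \<Sum>b<n. \<Sum>c<n. \<Sum>d<n. of_bool (switchable E a b c d) * (s a * t d)) \<le>
      (real \<Delta>)\<^sup>2 * (\<Sum>v<n. s v) * (\<Sum>v<n. t v)" .
qed

text \<open>\<open>Z'\<close> sums the edge count against the exponential. The count is, up to
  obstructions, the number of switchable quadruples divided by n \<Delta>; after reindexing the
  weight sits on \<open>(a, d)\<close>, where its sum is essentially deterministic, and the
  exponential has changed by at most the factor \<open>exp (4 * \<theta>)\<close>. Each sign of
  \<theta> gets the direction that its tail needs.\<close>

lemma edge_count_mgf_deriv:
  fixes \<Delta> n :: nat and s t :: "nat \<Rightarrow> real"
  assumes s: "\<And>v. 0 \<le> s v \<and> s v \<le> 1" and t: "\<And>v. 0 \<le> t v \<and> t v \<le> 1"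
  defines "Y \<equiv> edge_count n s t"
  defines "Z \<equiv> (\<lambda>\<theta>. \<Sum>E\<in>regular_graphs \<Delta> n. exp (\<theta> * Y E))"
  defines "Z' \<equiv> (\<lambda>\<theta>. \<Sum>E\<in>regular_graphs \<Delta> n. Y E * exp (\<theta> * Y E))"
  shows "0 \<le> \<theta> \<Longrightarrow> (real n * real \<Delta> - 2 * real \<Delta> - 2 * (real \<Delta>)\<^sup>2) * Z' \<theta> \<le>
      (real \<Delta>)\<^sup>2 * (\<Sum>v<n. s v) * (\<Sum>v<n. t v) * exp (4 * \<theta>) * Z \<theta>"
    "\<theta> \<le> 0 \<Longrightarrow> ((real \<Delta>)\<^sup>2 * (\<Sum>v<n. s v) * (\<Sum>v<n. t v) - real n * real \<Delta> * (2 * real \<Delta> + 2 * (real \<Delta>)\<^sup>2))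
        * exp (4 * \<theta>) * Z \<theta> \<le> real n * real \<Delta> * Z' \<theta>"
proof -
  let ?G = "regular_graphs \<Delta> n"
  let ?S1 = "\<lambda>E. \<Sum>a<n. \<Sum>b<n. \<Sum>c<n. \<Sum>d<n. of_bool (switchable E a b c d) * (s a * t b)"
  let ?S2 = "\<lambda>E. \<Sum>a<n. \<Sum>b<n. \<Sum>c<n. \<Sum>d<n. of_bool (switchable E a b c d) * (s a * t d)"
  let ?R = "\<lambda>\<theta>. \<Sum>E\<in>?G. \<Sum>a<n. \<Sum>b<n. \<Sum>c<n. \<Sum>d<n.
     of_bool (switchable E a b c d) * (s a * t d * exp (\<theta> * Y (switch E a b c d)))"
  have key: "(\<Sum>E\<in>?G. ?S1 E * exp (\<theta> * Y E)) = ?R \<theta>" for \<theta>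
  proof -
    have "(\<Sum>E\<in>?G. ?S1 E * exp (\<theta> * Y E)) = (\<Sum>E\<in>?G. \<Sum>a<n. \<Sum>b<n. \<Sum>c<n. \<Sum>d<n.
     of_bool (switchable E a b c d) * (s a * t b * exp (\<theta> * Y E)))"
      unfolding sum_distrib_right by (simp only: mult.assoc)
    also have "\<dots> = ?R \<theta>"
      by (rule sum_switchable_reindex)
    finally show ?thesis .
  qed
  have Ysw: "Y (switch E a b c d) \<le> Y E + 4" for E a b c d
    unfolding Y_def by (rule edge_count_switch_le[OF s t])
  have R2: "exp (4 * \<theta>) * (\<Sum>E\<in>?G. exp (\<theta> * Y E) * ?S2 E) = (\<Sum>E\<in>?G. \<Sum>a<n. \<Sum>b<n. \<Sum>c<n. \<Sum>d<n.
     of_bool (switchable E a b c d) * (s a * t d * exp (\<theta> * (Y E + 4))))" for \<theta>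
    unfolding sum_distrib_left by (simp only: distrib_left exp_add mult_ac)
  {
    assume th: "0 \<le> \<theta>"
    have "(real n * real \<Delta> - 2 * real \<Delta> - 2 * (real \<Delta>)\<^sup>2) * Z' \<theta> =
       (\<Sum>E\<in>?G. ((real n * real \<Delta> - 2 * real \<Delta> - 2 * (real \<Delta>)\<^sup>2) * Y E) * exp (\<theta> * Y E))"
      by (simp only: Z'_def sum_distrib_left mult.assoc)
    also have "\<dots> \<le> (\<Sum>E\<in>?G. ?S1 E * exp (\<theta> * Y E))"
      unfolding Y_def by (intro sum_mono mult_right_mono sum_switchable_ge s t) auto
    also have "\<dots> = ?R \<theta>" by (rule key)
    also have "\<dots> \<le> exp (4 * \<theta>) * (\<Sum>E\<in>?G. exp (\<theta> * Y E) * ?S2 E)"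
      unfolding R2
    proof (intro sum_mono mult_left_mono)
      fix E a b c d
      show "exp (\<theta> * Y (switch E a b c d)) \<le> exp (\<theta> * (Y E + 4))"
        using mult_left_mono[OF Ysw th] by simp
    qed (use s t in auto)
    also have "\<dots> \<le> exp (4 * \<theta>) * (\<Sum>E\<in>?G. exp (\<theta> * Y E) * ((real \<Delta>)\<^sup>2 * (\<Sum>v<n. s v) * (\<Sum>v<n. t v)))"
      by (intro sum_mono mult_left_mono sum_switchable_le s t) auto
    also have "\<dots> = (real \<Delta>)\<^sup>2 * (\<Sum>v<n. s v) * (\<Sum>v<n. t v) * exp (4 * \<theta>) * Z \<theta>"
      by (simp only: Z_def sum_distrib_right[symmetric]) (simp only: mult_ac)
    finally show "(real n * real \<Delta> - 2 * real \<Delta> - 2 * (real \<Delta>)\<^sup>2) * Z' \<theta> \<le>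
      (real \<Delta>)\<^sup>2 * (\<Sum>v<n. s v) * (\<Sum>v<n. t v) * exp (4 * \<theta>) * Z \<theta>" .
  }
  {
    assume th: "\<theta> \<le> 0"
    let ?m = "(real \<Delta>)\<^sup>2 * (\<Sum>v<n. s v) * (\<Sum>v<n. t v) - real n * real \<Delta> * (2 * real \<Delta> + 2 * (real \<Delta>)\<^sup>2)"
    have "?m * exp (4 * \<theta>) * Z \<theta> = exp (4 * \<theta>) * (\<Sum>E\<in>?G. exp (\<theta> * Y E) * ?m)"
      by (simp only: Z_def sum_distrib_right[symmetric]) (simp only: mult_ac)
    also have "\<dots> \<le> exp (4 * \<theta>) * (\<Sum>E\<in>?G. exp (\<theta> * Y E) * ?S2 E)"
      by (intro sum_mono mult_left_mono sum_switchable_ge s t) auto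
    also have "\<dots> \<le> ?R \<theta>"
      unfolding R2
    proof (intro sum_mono mult_left_mono)
      fix E a b c d
      show "exp (\<theta> * (Y E + 4)) \<le> exp (\<theta> * Y (switch E a b c d))"
        using mult_left_mono_neg[OF Ysw th] by simp
    qed (use s t in auto)
    also have "\<dots> = (\<Sum>E\<in>?G. ?S1 E * exp (\<theta> * Y E))" by (rule key[symmetric])
    also have "\<dots> \<le> (\<Sum>E\<in>?G. (real n * real \<Delta> * Y E) * exp (\<theta> * Y E))"
      unfolding Y_def by (intro sum_mono mult_right_mono sum_switchable_le s t) auto
    also have "\<dots> = real n * real \<Delta> * Z' \<theta>"
      by (simp only: Z'_def sum_distrib_left mult.assoc)
    finally show "?m * exp (4 * \<theta>) * Z \<theta> \<le> real n * real \<Delta> * Z' \<theta>" .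
  }
qed

text \<open>Gronwall's argument: the integral of \<open>m * exp (4 * x)\<close> from 0 to \<theta>
  is the exponent. Moving left from 0 reverses both the inequality and the direction, so the
  conclusion is the same.\<close>

lemma exp_growth_bound:
  fixes Z Z' :: "real \<Rightarrow> real"
  assumes Z: "\<And>x. (Z has_real_derivative Z' x) (at x)"
  shows "0 \<le> \<theta> \<Longrightarrow> (\<And>x. 0 \<le> x \<Longrightarrow> Z' x \<le> m * exp (4 * x) * Z x) \<Longrightarrow> Z \<theta> \<le> Z 0 * exp (m * (exp (4 * \<theta>) - 1) / 4)"
    "\<theta> \<le> 0 \<Longrightarrow> (\<And>x. x \<le> 0 \<Longrightarrow> m * exp (4 * x) * Z x \<le> Z' x) \<Longrightarrow> Z \<theta> \<le> Z 0 * exp (m * (exp (4 * \<theta>) - 1) / 4)"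
proof -
  let ?e = "\<lambda>x. exp (- (m * (exp (4 * x) - 1) / 4))"
  let ?g = "\<lambda>x. Z x * ?e x"
  have g: "(?g has_real_derivative (Z' x - m * exp (4 * x) * Z x) * ?e x) (at x)" for x
    by (auto intro!: derivative_eq_intros Z simp: field_simps)
  have fin: "Z \<theta> \<le> Z 0 * exp (m * (exp (4 * \<theta>) - 1) / 4)" if "?g \<theta> \<le> ?g 0"
  proof -
    have "Z \<theta> = ?g \<theta> * exp (m * (exp (4 * \<theta>) - 1) / 4)"
      by (simp add: mult.assoc flip: exp_add)
    also have "\<dots> \<le> ?g 0 * exp (m * (exp (4 * \<theta>) - 1) / 4)"
      using that by (intro mult_right_mono) auto
    finally show ?thesis by simp
  qed
  show "Z \<theta> \<le> Z 0 * exp (m * (exp (4 * \<theta>) - 1) / 4)"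
    if "0 \<le> \<theta>" "\<And>x. 0 \<le> x \<Longrightarrow> Z' x \<le> m * exp (4 * x) * Z x"
  proof (intro fin DERIV_nonpos_imp_nonincreasing[OF that(1)])
    fix x :: real assume "0 \<le> x"
    then show "\<exists>y. (?g has_real_derivative y) (at x) \<and> y \<le> 0"
      using that(2)[of x] mult_nonpos_nonneg[of "Z' x - m * exp (4 * x) * Z x" "?e x"]
      by (intro exI[of _ "(Z' x - m * exp (4 * x) * Z x) * ?e x"] conjI g) simp
  qed
  show "Z \<theta> \<le> Z 0 * exp (m * (exp (4 * \<theta>) - 1) / 4)"
    if "\<theta> \<le> 0" "\<And>x. x \<le> 0 \<Longrightarrow> m * exp (4 * x) * Z x \<le> Z' x"
  proof (intro fin DERIV_nonneg_imp_nondecreasing[OF that(1)])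
    fix x :: real assume "x \<le> 0"
    then show "\<exists>y. (?g has_real_derivative y) (at x) \<and> 0 \<le> y"
      using that(2)[of x] mult_nonneg_nonneg[of "Z' x - m * exp (4 * x) * Z x" "?e x"]
      by (intro exI[of _ "(Z' x - m * exp (4 * x) * Z x) * ?e x"] conjI g) simp
  qed
qed

section \<open>Tail bounds for edge counts\<close>

text \<open>Keeping \<theta> on both sides of the event lets one statement cover the upper tail
  (positive \<theta>) and the lower tail (negative \<theta>).\<close>

lemma uniform_chernoff:
  fixes Y :: "'a \<Rightarrow> real"
  assumes "finite G" "G \<noteq> {}"
  shows "measure_pmf.prob (pmf_of_set G) {x. \<theta> * y \<le> \<theta> * Y x} \<le>
     (\<Sum>x\<in>G. exp (\<theta> * Y x)) / card G * exp (- (\<theta> * y))"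
proof -
  let ?A = "G \<inter> {x. \<theta> * y \<le> \<theta> * Y x}"
  have c: "0 < card G" using assms by (simp add: card_gt_0_iff)
  have "real (card ?A) = (\<Sum>x\<in>?A. 1)" by simp
  also have "\<dots> \<le> (\<Sum>x\<in>?A. exp (\<theta> * Y x - \<theta> * y))"
    by (intro sum_mono) auto
  also have "\<dots> \<le> (\<Sum>x\<in>G. exp (\<theta> * Y x - \<theta> * y))"
    using assms by (intro sum_mono2) auto
  also have "\<dots> = (\<Sum>x\<in>G. exp (\<theta> * Y x)) * exp (- (\<theta> * y))"
    by (simp add: sum_distrib_right exp_diff exp_minus divide_inverse)
  finally show ?thesis
    using assms c by (simp add: measure_pmf_of_set divide_right_mono)
qed

text \<open>Chernoff bounds at \<theta> = \<psi>/4 and \<theta> = -\<psi>/4; the overall factor 1/4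
  thus stems from the jump bound 4. The denominators n - 2 \<Delta> - 2 and n are the coefficients
  of \<open>Z'\<close> after division by \<Delta>.\<close>

lemma edge_count_tails:
  fixes \<Delta> n :: nat and s t :: "nat \<Rightarrow> real"
  assumes s: "\<And>v. 0 \<le> s v \<and> s v \<le> 1" and t: "\<And>v. 0 \<le> t v \<and> t v \<le> 1"
    and ne: "regular_graphs \<Delta> n \<noteq> {}" and \<Delta>: "0 < \<Delta>" and n: "2 * \<Delta> + 2 < n"
  defines "M \<equiv> real \<Delta> * (\<Sum>v<n. s v) * (\<Sum>v<n. t v)"
  shows "0 \<le> \<psi> \<Longrightarrow> measure_pmf.prob (random_regular_graph \<Delta> n) {E. y \<le> edge_count n s t E} \<le>
      exp ((M / (real n - 2 * real \<Delta> - 2) * (exp \<psi> - 1) - \<psi> * y) / 4)"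
    "0 \<le> \<psi> \<Longrightarrow> measure_pmf.prob (random_regular_graph \<Delta> n) {E. edge_count n s t E \<le> y} \<le>
      exp (((M / real n - 2 * real \<Delta> - 2 * (real \<Delta>)\<^sup>2) * (exp (- \<psi>) - 1) + \<psi> * y) / 4)"
proof -
  let ?G = "regular_graphs \<Delta> n" and ?Y = "edge_count n s t"
  define Z where "Z = (\<lambda>\<theta>. \<Sum>E\<in>?G. exp (\<theta> * ?Y E))"
  define Z' where "Z' = (\<lambda>\<theta>. \<Sum>E\<in>?G. ?Y E * exp (\<theta> * ?Y E))"
  have Z: "(Z has_real_derivative Z' x) (at x)" for x
    unfolding Z_def Z'_def by (auto intro!: derivative_eq_intros sum.cong)
  have Z0: "Z 0 = card ?G" by (simp add: Z_def)
  have c: "0 < card ?G" using ne finite_regular_graphs by (simp add: card_gt_0_iff)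
  have pos: "0 < real n - 2 * real \<Delta> - 2" "0 < real n" using n by linarith+
  have D: "0 \<le> x \<Longrightarrow> (real n * real \<Delta> - 2 * real \<Delta> - 2 * (real \<Delta>)\<^sup>2) * Z' x \<le>
      (real \<Delta>)\<^sup>2 * (\<Sum>v<n. s v) * (\<Sum>v<n. t v) * exp (4 * x) * Z x"
    "x \<le> 0 \<Longrightarrow> ((real \<Delta>)\<^sup>2 * (\<Sum>v<n. s v) * (\<Sum>v<n. t v) - real n * real \<Delta> * (2 * real \<Delta> + 2 * (real \<Delta>)\<^sup>2))
        * exp (4 * x) * Z x \<le> real n * real \<Delta> * Z' x" for x
    unfolding Z_def Z'_def by (rule edge_count_mgf_deriv[OF s t]; assumption)+
  have chern: "measure_pmf.prob (random_regular_graph \<Delta> n) {E. \<theta> * y \<le> \<theta> * ?Y E} \<le> Z \<theta> / card ?G * exp (- (\<theta> * y))" for \<theta> y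
    unfolding random_regular_graph_def Z_def by (rule uniform_chernoff[OF finite_regular_graphs ne])
  show "measure_pmf.prob (random_regular_graph \<Delta> n) {E. y \<le> edge_count n s t E} \<le>
      exp ((M / (real n - 2 * real \<Delta> - 2) * (exp \<psi> - 1) - \<psi> * y) / 4)" if psi: "0 \<le> \<psi>"
  proof (cases "\<psi> = 0")
    case True
    then show ?thesis by simp
  next
    case False
    with psi have psi: "0 < \<psi>" by simp
    let ?m = "M / (real n - 2 * real \<Delta> - 2)"
    have "Z' x \<le> ?m * exp (4 * x) * Z x" if "0 \<le> x" for x
    proof -
      have "real \<Delta> * ((real n - 2 * real \<Delta> - 2) * Z' x) = (real n * real \<Delta> - 2 * real \<Delta> - 2 * (real \<Delta>)\<^sup>2) * Z' x"
        by (simp add: algebra_simps power2_eq_square)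
      also have "\<dots> \<le> real \<Delta> * (M * exp (4 * x) * Z x)"
        using D(1)[OF that] by (simp add: M_def power2_eq_square mult_ac)
      finally have "(real n - 2 * real \<Delta> - 2) * Z' x \<le> M * exp (4 * x) * Z x"
        using \<Delta> by simp
      then show ?thesis using pos by (simp add: field_simps)
    qed
    from exp_growth_bound(1)[OF Z _ this, of "\<psi> / 4"] psi
    have "Z (\<psi> / 4) \<le> card ?G * exp (?m * (exp \<psi> - 1) / 4)" by (simp add: Z0)
    then have "Z (\<psi> / 4) / card ?G * exp (- (\<psi> / 4 * y)) \<le> exp (?m * (exp \<psi> - 1) / 4) * exp (- (\<psi> / 4 * y))"
      using c by (intro mult_right_mono) (simp_all add: field_simps)
    also have "\<dots> = exp ((?m * (exp \<psi> - 1) - \<psi> * y) / 4)"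
      by (simp only: exp_add[symmetric]) (simp add: diff_divide_distrib)
    finally show ?thesis using chern[of "\<psi> / 4" y] psi by simp
  qed
  show "measure_pmf.prob (random_regular_graph \<Delta> n) {E. edge_count n s t E \<le> y} \<le>
      exp (((M / real n - 2 * real \<Delta> - 2 * (real \<Delta>)\<^sup>2) * (exp (- \<psi>) - 1) + \<psi> * y) / 4)" if psi: "0 \<le> \<psi>"
  proof (cases "\<psi> = 0")
    case True
    then show ?thesis by simp
  next
    case False
    with psi have psi: "0 < \<psi>" by simp
    let ?m = "M / real n - 2 * real \<Delta> - 2 * (real \<Delta>)\<^sup>2"
    have "?m * exp (4 * x) * Z x \<le> Z' x" if "x \<le> 0" for x
    proof -
      have "real \<Delta> * (real n * (?m * exp (4 * x) * Z x)) =
        ((real \<Delta>)\<^sup>2 * (\<Sum>v<n. s v) * (\<Sum>v<n. t v) - real n * real \<Delta> * (2 * real \<Delta> + 2 * (real \<Delta>)\<^sup>2)) * exp (4 * x) * Z x"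
      proof -
        have "real \<Delta> * (real n * ?m) = (real \<Delta>)\<^sup>2 * (\<Sum>v<n. s v) * (\<Sum>v<n. t v) - real n * real \<Delta> * (2 * real \<Delta> + 2 * (real \<Delta>)\<^sup>2)"
          using pos by (simp add: M_def field_simps power2_eq_square)
        then show ?thesis by (metis mult.assoc)
      qed
      also have "\<dots> \<le> real \<Delta> * (real n * Z' x)"
        using D(2)[OF that] by (simp add: mult_ac)
      finally show ?thesis using \<Delta> pos by simp
    qed
    from exp_growth_bound(2)[OF Z _ this, of "- (\<psi> / 4)"] psi
    have "Z (- (\<psi> / 4)) \<le> card ?G * exp (?m * (exp (- \<psi>) - 1) / 4)" by (simp add: Z0)
    then have "Z (- (\<psi> / 4)) / card ?G * exp (- (- (\<psi> / 4) * y)) \<le> exp (?m * (exp (- \<psi>) - 1) / 4) * exp (- (- (\<psi> / 4) * y))"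
      using c by (intro mult_right_mono) (simp_all add: field_simps)
    also have "\<dots> = exp ((?m * (exp (- \<psi>) - 1) + \<psi> * y) / 4)"
      by (simp only: exp_add[symmetric]) (simp add: add_divide_distrib)
    finally show ?thesis using chern[of "- (\<psi> / 4)" y] psi by simp
  qed
qed

text \<open>With \<open>\<rho> = \<tau> / \<mu>\<close>, the Gaussian choice \<open>\<psi> = \<rho> / 243\<close> works for \<open>\<rho> \<le> 243 = 3^5\<close> and the Poisson choice
  \<open>\<psi> = ln (\<rho> / 8)\<close> beyond; 14400 is the square of the constant 120 in the discrepancy bound.\<close>

lemma upper_tail_exponent:
  fixes \<mu> \<mu>' \<tau> n t D :: real
  assumes \<mu>: "0 < \<mu>" and \<tau>: "0 < \<tau>" and sq: "\<tau>\<^sup>2 = 14400 * n * \<mu>"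
    and \<mu>': "\<mu>' \<le> 2 * \<mu>" "\<mu>' \<le> \<mu> + D" "0 \<le> \<mu>'" "0 \<le> D" "D \<le> n" and t: "0 < t" "t \<le> n" "14400 * t \<le> \<tau>"
  shows "\<exists>\<psi>\<ge>0. \<mu>' * (exp \<psi> - 1) - \<psi> * (\<mu> + \<tau>) \<le> - 24 * (t * (1 + ln (n / t)))"
proof -
  define \<rho> where "\<rho> = \<tau> / \<mu>"
  have \<rho>: "0 < \<rho>" "\<rho> * \<mu> = \<tau>" "\<rho> * \<tau> = 14400 * n"
    using \<mu> \<tau> sq by (auto simp: \<rho>_def field_simps power2_eq_square)
  have n: "0 < n" using t by linarith
  show ?thesis
  proof (cases "\<rho> \<le> 243")
    case True
    define \<psi> where "\<psi> = \<rho> / 243"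
    have psi: "0 \<le> \<psi>" "\<psi> \<le> 1" using True \<rho> by (auto simp: \<psi>_def)
    have sq1: "\<psi>\<^sup>2 \<le> 1" using psi by (simp add: power_le_one)
    have "exp \<psi> - 1 \<le> \<psi> + \<psi>\<^sup>2" using exp_bound[OF psi] by simp
    then have "\<mu>' * (exp \<psi> - 1) \<le> \<mu>' * (\<psi> + \<psi>\<^sup>2)" using \<mu>' by (intro mult_left_mono) auto
    also have "\<dots> \<le> (\<mu> + D) * (\<psi> + \<psi>\<^sup>2)" using \<mu>' psi by (intro mult_right_mono) auto
    also have "\<dots> = \<mu> * \<psi> + \<psi> * (\<mu> * \<psi>) + D * (\<psi> + \<psi>\<^sup>2)" by (simp add: algebra_simps power2_eq_square)
    also have "D * (\<psi> + \<psi>\<^sup>2) \<le> D * 2" using psi sq1 \<mu>' by (intro mult_left_mono) auto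
    also have "\<psi> * (\<mu> * \<psi>) = \<psi> * \<tau> / 243" using \<rho>(2) by (simp add: \<psi>_def mult_ac)
    finally have "\<mu>' * (exp \<psi> - 1) - \<psi> * (\<mu> + \<tau>) \<le> \<psi> * \<tau> / 243 + D * 2 - \<psi> * \<tau>"
      by (simp add: algebra_simps)
    also have "\<psi> * \<tau> = 14400 * n / 243" using \<rho>(3) by (simp add: \<psi>_def)
    \<comment> \<open>The constants leave room: 14400/243 exceeds 59, whereas the second-order term
      and \<open>D * 2\<close> together cost less than 3, each times n.\<close>
    finally have 1: "\<mu>' * (exp \<psi> - 1) - \<psi> * (\<mu> + \<tau>) \<le> - 24 * n"
      using \<mu>' n by (simp add: field_simps)
    have "ln (n / t) \<le> n / t - 1" using n t by (intro ln_le_minus_one) auto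
    then have "t * (1 + ln (n / t)) \<le> t * (n / t)" using t by (intro mult_left_mono) auto
    with t have "t * (1 + ln (n / t)) \<le> n" by simp
    with 1 psi show ?thesis by (intro exI[of _ \<psi>]) auto
  next
    case False
    then have big: "243 < \<rho>" by simp
    have "exp 5 = exp (1::real) ^ 5" by (simp flip: exp_of_nat_mult)
    also have "\<dots> \<le> 3 ^ 5" using exp_le by (intro power_mono) auto
    finally have "5 \<le> ln (243::real)" by (subst ln_ge_iff) auto
    also have "\<dots> \<le> ln \<rho>" using big by simp
    finally have l5: "5 \<le> ln \<rho>" .
    have "ln (8::real) = ln (2 ^ 3)" by simp
    also have "\<dots> = 3 * ln 2" by (simp only: ln_realpow)
    also have "\<dots> \<le> 3 * (25 / 36)" using ln2_le_25_over_36 by simp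
    finally have l8: "ln (8::real) \<le> 2.1" by simp
    define \<psi> where "\<psi> = ln (\<rho> / 8)"
    have psi: "\<psi> = ln \<rho> - ln 8" using \<rho>(1) unfolding \<psi>_def by (subst ln_div) auto
    have psi0: "0 \<le> \<psi>" using psi l5 l8 by simp
    have "exp \<psi> - 1 \<le> \<rho> / 8" using \<rho>(1) by (simp add: \<psi>_def)
    then have "\<mu>' * (exp \<psi> - 1) \<le> \<mu>' * (\<rho> / 8)" using \<mu>' by (intro mult_left_mono) auto
    also have "\<dots> \<le> 2 * \<mu> * (\<rho> / 8)" using \<mu>' \<rho> by (intro mult_right_mono) auto
    also have "\<dots> = \<tau> / 4" using \<rho>(2) by (simp add: mult_ac)
    finally have "\<mu>' * (exp \<psi> - 1) - \<psi> * (\<mu> + \<tau>) \<le> \<tau> / 4 - \<psi> * \<tau>"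
      using mult_nonneg_nonneg[OF psi0 less_imp_le[OF \<mu>]] by (simp add: distrib_left)
    also have "\<dots> = \<tau> * (1 / 4 - \<psi>)" by (simp add: algebra_simps)
    \<comment> \<open>Because ln \<rho> is at least 5, half of it exceeds 1/4 + ln 8, which is at
      most 2.35.\<close>
    also have "\<dots> \<le> \<tau> * (- (ln \<rho> / 2))" using psi l5 l8 \<tau> by (intro mult_left_mono) auto
    finally have 1: "\<mu>' * (exp \<psi> - 1) - \<psi> * (\<mu> + \<tau>) \<le> - (\<tau> * ln \<rho> / 2)" by simp
    \<comment> \<open>Since \<rho> \<tau> = 14400 n, this choice splits n/t as \<rho> y with y at
      least 1, so that ln (n/t) is controlled by ln \<rho> and y.\<close>
    define y where "y = \<tau> / (14400 * t)"
    have y: "1 \<le> y" "\<tau> = 14400 * t * y" using t by (auto simp: y_def)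
    have "n / t = \<rho> * y" using \<rho>(3) t by (simp add: y_def field_simps)
    then have "ln (n / t) = ln \<rho> + ln y" using \<rho> y by (simp add: ln_mult)
    also have "\<dots> \<le> ln \<rho> + (y - 1)" using ln_le_minus_one[of y] y by simp
    finally have "1 + ln (n / t) \<le> ln \<rho> + y" by simp
    also have "\<dots> \<le> y * ln \<rho> + y * ln \<rho>"
    proof -
      have "1 * ln \<rho> \<le> y * ln \<rho>" using y l5 by (intro mult_right_mono) auto
      moreover have "y * 1 \<le> y * ln \<rho>" using y l5 by (intro mult_left_mono) auto
      ultimately show ?thesis by simp
    qed
    finally have "t * (1 + ln (n / t)) \<le> t * (2 * (y * ln \<rho>))" using t by (intro mult_left_mono) auto
    also have "\<dots> = \<tau> * ln \<rho> / 7200" by (simp add: y)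
    finally have "t * (1 + ln (n / t)) \<le> \<tau> * ln \<rho> / 7200" .
    moreover have "0 \<le> \<tau> * ln \<rho>" using \<tau> l5 by simp
    ultimately have "24 * (t * (1 + ln (n / t))) \<le> \<tau> * ln \<rho> / 2" by linarith
    with 1 psi0 show ?thesis by (intro exI[of _ \<psi>]) auto
  qed
qed

text \<open>Below the mean only the Gaussian regime occurs, because \<tau> is at most \<mu>. The
  exponent is at most -\<psi> \<tau> + \<mu> \<psi>^2 + D, and \<psi> = \<tau>/(2 \<mu>) minimises
  this, with value -3600 n + D.\<close>

lemma lower_tail_exponent:
  fixes \<mu> \<tau> n D :: real
  assumes \<mu>: "0 < \<mu>" and \<tau>: "0 < \<tau>" "\<tau> \<le> \<mu>" and sq: "\<tau>\<^sup>2 = 14400 * n * \<mu>" and D: "0 \<le> D" "D \<le> n"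
  shows "\<exists>\<psi>\<ge>0. (\<mu> - D) * (exp (- \<psi>) - 1) + \<psi> * (\<mu> - \<tau>) \<le> - 24 * n"
proof -
  define \<psi> where "\<psi> = \<tau> / (2 * \<mu>)"
  have psi: "0 < \<psi>" "\<mu> * \<psi> = \<tau> / 2" "\<psi> * \<tau> = 7200 * n"
    using \<mu> \<tau> sq by (auto simp: \<psi>_def field_simps power2_eq_square)
  have "exp (- \<psi>) = 1 / exp \<psi>" by (simp add: exp_minus divide_inverse)
  also have "\<dots> \<le> 1 / (1 + \<psi>)" using psi by (intro divide_left_mono) (auto simp: add_pos_pos)
  also have "\<dots> \<le> 1 - \<psi> + \<psi>\<^sup>2"
  proof -
    have "1 \<le> (1 - \<psi> + \<psi>\<^sup>2) * (1 + \<psi>)"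
      using psi by (simp add: algebra_simps power2_eq_square)
    then show ?thesis using psi by (simp add: divide_le_eq)
  qed
  finally have e: "exp (- \<psi>) - 1 \<le> - \<psi> + \<psi>\<^sup>2" by simp
  have "(\<mu> - D) * (exp (- \<psi>) - 1) = \<mu> * (exp (- \<psi>) - 1) + D * (1 - exp (- \<psi>))" by (simp add: algebra_simps)
  also have "\<dots> \<le> \<mu> * (- \<psi> + \<psi>\<^sup>2) + D * 1"
    using e \<mu> D psi by (intro add_mono mult_left_mono) auto
  also have "\<mu> * (- \<psi> + \<psi>\<^sup>2) = - (\<mu> * \<psi>) + \<psi> * (\<mu> * \<psi>)" by (simp add: algebra_simps power2_eq_square)
  finally have "(\<mu> - D) * (exp (- \<psi>) - 1) + \<psi> * (\<mu> - \<tau>) \<le> - (\<psi> * \<tau> / 2) + D"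
    using psi(2) by (simp add: algebra_simps)
  also have "\<dots> \<le> - 24 * n" using psi(3) D by simp
  finally show ?thesis using psi(1) by (intro exI[of _ \<psi>]) auto
qed

definition pair_count :: "nat \<Rightarrow> nat set \<Rightarrow> nat set \<Rightarrow> nat set set \<Rightarrow> real" where
  "pair_count n S T E = edge_count n (\<lambda>v. of_bool (v \<in> S)) (\<lambda>v. of_bool (v \<in> T)) E"

lemma pair_count_sym: "pair_count n S T E = pair_count n T S E"
  unfolding pair_count_def edge_count_def by (subst sum.swap) (simp add: adj_sym mult_ac)

lemma sum_indicator: "S \<subseteq> {..<n} \<Longrightarrow> (\<Sum>v<n. of_bool (v \<in> S)) = real (card S)" for n :: nat
  by (simp add: Int_absorb1)

lemma pair_count_nonneg: "0 \<le> pair_count n S T E"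
  unfolding pair_count_def edge_count_def by (intro sum_nonneg) auto

lemma pair_count_le:
  assumes E: "E \<in> regular_graphs \<Delta> n" and S: "S \<subseteq> {..<n}"
  shows "pair_count n S T E \<le> real \<Delta> * card S"
proof -
  have "pair_count n S T E \<le> (\<Sum>a<n. \<Sum>b<n. of_bool (a \<in> S) * adj E a b)"
    unfolding pair_count_def edge_count_def by (intro sum_mono mult_right_mono) auto
  also have "\<dots> = (\<Sum>a<n. of_bool (a \<in> S) * real \<Delta>)"
    by (intro sum.cong) (simp_all only: sum_distrib_left[symmetric] sum_adj[OF E] lessThan_iff)
  also have "\<dots> = real \<Delta> * card S"
    unfolding sum_distrib_right[symmetric] sum_indicator[OF S] by simp
  finally show ?thesis .
qed

text \<open>The function x (1 + ln (n/x)) has derivative ln (n/x), which is nonnegative up to n. It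
  bounds the logarithm of the number of x-element subsets.\<close>

lemma entropy_bound_mono:
  fixes s t n :: real
  assumes "0 < s" "s \<le> t" "t \<le> n"
  shows "s * (1 + ln (n / s)) \<le> t * (1 + ln (n / t))"
proof -
  have "ln (n / s) = ln ((n / t) * (t / s))" using assms by simp
  also have "\<dots> = ln (n / t) + ln (t / s)" using assms by (subst ln_mult) auto
  also have "ln (t / s) \<le> t / s - 1" using assms by (intro ln_le_minus_one) auto
  finally have "s * (1 + ln (n / s)) \<le> s * (1 + (ln (n / t) + (t / s - 1)))"
    using assms by (intro mult_left_mono) auto
  also have "\<dots> = s * ln (n / t) + t" using assms by (simp add: field_simps)
  also have "\<dots> \<le> t * ln (n / t) + t" using assms by (intro add_right_mono mult_right_mono) auto
  finally show ?thesis by (simp add: algebra_simps)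
qed

text \<open>The bound is stated through the larger set, whose entropy dominates that of both sets;
  the 6 is the 24 of the exponent estimates divided by 4.\<close>

lemma discrepancy_prob:
  fixes \<Delta> n :: nat
  assumes ne: "regular_graphs \<Delta> n \<noteq> {}" and \<Delta>: "0 < \<Delta>" and n: "4 * \<Delta> * (\<Delta> + 1) \<le> n"
    and S: "S \<subseteq> {..<n}" "S \<noteq> {}" and T: "T \<subseteq> {..<n}" "T \<noteq> {}" and le: "card S \<le> card T"
  shows "measure_pmf.prob (random_regular_graph \<Delta> n)
      {E. 120 * sqrt \<Delta> * sqrt (real (card S) * real (card T)) < \<bar>pair_count n S T E - real \<Delta> * real (card S) * real (card T) / real n\<bar>}
    \<le> 2 * exp (- 6 * (card T * (1 + ln (n / card T))))"
proof -
  let ?P = "measure_pmf.prob (random_regular_graph \<Delta> n)"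
  let ?Y = "pair_count n S T"
  define s t where "s = real (card S)" and "t = real (card T)"
  have fin: "finite S" "finite T" using S T by (auto intro: finite_subset)
  have st: "1 \<le> s" "1 \<le> t" "s \<le> t" using S T le fin by (auto simp: s_def t_def Suc_le_eq card_gt_0_iff)
  have tn: "t \<le> n" using card_mono[of "{..<n}" T] T by (simp add: t_def)
  define \<mu> where "\<mu> = \<Delta> * s * t / n"
  define \<tau> where "\<tau> = 120 * sqrt \<Delta> * sqrt (s * t)"
  have n0: "0 < real n" using tn st by linarith
  have \<mu>: "0 < \<mu>" using \<Delta> st n0 by (simp add: \<mu>_def)
  have \<tau>: "0 < \<tau>" using \<Delta> st by (simp add: \<tau>_def)
  have sq: "\<tau>\<^sup>2 = 14400 * real n * \<mu>"
    using st n0 by (simp add: \<tau>_def \<mu>_def power_mult_distrib)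
  have nr: "4 * real \<Delta> * (real \<Delta> + 1) \<le> n"
  proof -
    have "real (4 * \<Delta> * (\<Delta> + 1)) \<le> real n" using n by (simp only: of_nat_le_iff)
    then show ?thesis by (simp add: distrib_left)
  qed
  have "4 * 1 * (real \<Delta> + 1) \<le> 4 * real \<Delta> * (real \<Delta> + 1)" using \<Delta> by (intro mult_mono) auto
  with nr have n4: "4 * (real \<Delta> + 1) \<le> n" by simp
  then have "real (2 * \<Delta> + 2) < real n" using \<Delta> by simp
  then have n2: "2 * \<Delta> + 2 < n" by (simp only: of_nat_less_iff)
  have b: "0 \<le> (of_bool (v \<in> A) :: real) \<and> (of_bool (v \<in> A) :: real) \<le> 1" for v :: nat and A by simp
  have sums: "(\<Sum>v<n. of_bool (v \<in> S)) = s" "(\<Sum>v<n. of_bool (v \<in> T)) = t"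
    unfolding s_def t_def by (rule sum_indicator[OF S(1)] sum_indicator[OF T(1)])+
  have tails: "?P {E. y \<le> ?Y E} \<le> exp ((\<Delta> * s * t / (real n - 2 * real \<Delta> - 2) * (exp \<psi> - 1) - \<psi> * y) / 4)"
    "?P {E. ?Y E \<le> y} \<le>
      exp (((\<Delta> * s * t / real n - 2 * real \<Delta> - 2 * (real \<Delta>)\<^sup>2) * (exp (- \<psi>) - 1) + \<psi> * y) / 4)"
    if "0 \<le> \<psi>" for \<psi> y
    using edge_count_tails[of "\<lambda>v. of_bool (v \<in> S)" "\<lambda>v. of_bool (v \<in> T)" \<Delta> n \<psi> y, OF b b ne \<Delta> n2 that]
    by (simp_all only: sums pair_count_def)
  have H: "t * (1 + ln (n / t)) \<le> n"
    using entropy_bound_mono[of t "real n" "real n"] st tn by simp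
  have set_pmf: "E \<in> regular_graphs \<Delta> n" if "E \<in> set_pmf (random_regular_graph \<Delta> n)" for E
    using that ne finite_regular_graphs by (simp add: random_regular_graph_def)
  have up: "?P {E. \<mu> + \<tau> < ?Y E} \<le> exp (- 6 * (t * (1 + ln (n / t))))"
  \<comment> \<open>In the first case the degree bound makes the event impossible. In the second,
    \<tau>^2 = 14400 t \<Delta> s forces 14400 t \<le> \<tau>, the hypothesis of the Poisson
    regime.\<close>
  proof (cases "\<Delta> * s \<le> \<tau>")
    case True
    have "?Y E \<le> \<mu> + \<tau>" if "E \<in> set_pmf (random_regular_graph \<Delta> n)" for E
      using pair_count_le[OF set_pmf[OF that] S(1), of T] True \<mu> by (simp add: s_def)
    then have "?P {E. \<mu> + \<tau> < ?Y E} = 0"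
      by (subst measure_pmf_zero_iff) force
    then show ?thesis by simp
  next
    case False
    let ?m = "\<Delta> * s * t / (real n - 2 * real \<Delta> - 2)"
    have den: "real n / 2 \<le> real n - 2 * real \<Delta> - 2" using n4 by simp
    have m2: "?m \<le> 2 * \<mu>"
    proof -
      have "?m \<le> \<Delta> * s * t / (real n / 2)" using den n0 st by (intro divide_left_mono) auto
      then show ?thesis by (simp add: \<mu>_def mult_ac)
    qed
    \<comment> \<open>Replacing n by n - 2 \<Delta> - 2 in the denominator moves the mean by a
      bounded amount; this is the error \<open>D\<close> of
      \<open>upper_tail_exponent\<close>.\<close>
    have mD: "?m \<le> \<mu> + 4 * real \<Delta> * (real \<Delta> + 1)"
    proof -
      have "?m - \<mu> = ?m * (2 * real \<Delta> + 2) / n"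
      proof -
        have "A / D - A / N = A / D * (N - D) / N" if "0 < D" "0 < N" for A D N :: real
          using that by (simp add: field_simps)
        from this[of "real n - 2 * real \<Delta> - 2" "real n"] show ?thesis
          using den n0 by (simp add: \<mu>_def diff_diff_eq)
      qed
      also have "\<dots> \<le> 2 * \<mu> * (2 * real \<Delta> + 2) / n"
        using m2 by (intro divide_right_mono mult_right_mono) auto
      also have "\<dots> = 4 * real \<Delta> * (real \<Delta> + 1) * ((s / n) * (t / n))"
        unfolding \<mu>_def by (simp add: algebra_simps add_divide_distrib)
      also have "\<dots> \<le> 4 * real \<Delta> * (real \<Delta> + 1) * (1 * 1)"
        using st tn n0 by (intro mult_left_mono mult_mono) auto
      finally show ?thesis by simp
    qed
    have m0: "0 \<le> ?m" using den n0 st by (intro divide_nonneg_nonneg) auto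
    have Lt: "14400 * t \<le> \<tau>"
    proof -
      have "\<tau> * \<tau> \<le> \<tau> * (\<Delta> * s)" using False \<tau> by (intro mult_left_mono) auto
      moreover have "\<tau> * \<tau> = 14400 * t * (\<Delta> * s)"
        using sq n0 by (simp add: power2_eq_square \<mu>_def)
      ultimately show ?thesis using \<Delta> st by simp
    qed
    obtain \<psi> where psi: "0 \<le> \<psi>" "?m * (exp \<psi> - 1) - \<psi> * (\<mu> + \<tau>) \<le> - 24 * (t * (1 + ln (n / t)))"
      using upper_tail_exponent[OF \<mu> \<tau> sq m2 mD m0 _ nr _ tn Lt] st by auto
    have "?P {E. \<mu> + \<tau> < ?Y E} \<le> ?P {E. \<mu> + \<tau> \<le> ?Y E}"
      by (rule measure_pmf.finite_measure_mono) auto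
    also have "\<dots> \<le> exp ((?m * (exp \<psi> - 1) - \<psi> * (\<mu> + \<tau>)) / 4)"
      by (rule tails(1)[OF psi(1)])
    also have "\<dots> \<le> exp (- 6 * (t * (1 + ln (n / t))))" using psi(2) by simp
    finally show ?thesis .
  qed
  have low: "?P {E. ?Y E < \<mu> - \<tau>} \<le> exp (- 6 * (t * (1 + ln (n / t))))"
  proof (cases "\<tau> \<le> \<mu>")
    case False
    have "\<not> ?Y E < \<mu> - \<tau>" for E using pair_count_nonneg[of n S T E] False by linarith
    then show ?thesis by simp
  next
    case True
    have "0 \<le> 2 * real \<Delta> + 2 * (real \<Delta>)\<^sup>2" "2 * real \<Delta> + 2 * (real \<Delta>)\<^sup>2 \<le> n"
      using nr by (auto simp: power2_eq_square algebra_simps)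
    then obtain \<psi> where psi: "0 \<le> \<psi>" "(\<mu> - (2 * real \<Delta> + 2 * (real \<Delta>)\<^sup>2)) * (exp (- \<psi>) - 1) + \<psi> * (\<mu> - \<tau>) \<le> - 24 * real n"
      using lower_tail_exponent[OF \<mu> \<tau> True sq] by blast
    have "?P {E. ?Y E < \<mu> - \<tau>} \<le> ?P {E. ?Y E \<le> \<mu> - \<tau>}"
      by (rule measure_pmf.finite_measure_mono) auto
    also have "\<dots> \<le> exp (((\<mu> - 2 * real \<Delta> - 2 * (real \<Delta>)\<^sup>2) * (exp (- \<psi>) - 1) + \<psi> * (\<mu> - \<tau>)) / 4)"
      unfolding \<mu>_def by (rule tails(2)[OF psi(1)])
    also have "\<dots> \<le> exp (- 6 * (t * (1 + ln (n / t))))" using psi(2) H by (simp add: diff_diff_eq)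
    finally show ?thesis .
  qed
  have "?P {E. \<tau> < \<bar>?Y E - \<mu>\<bar>} \<le> ?P ({E. \<mu> + \<tau> < ?Y E} \<union> {E. ?Y E < \<mu> - \<tau>})"
    by (rule measure_pmf.finite_measure_mono) auto
  also have "\<dots> \<le> ?P {E. \<mu> + \<tau> < ?Y E} + ?P {E. ?Y E < \<mu> - \<tau>}"
    by (rule measure_Un_le) auto
  finally show ?thesis using up low by (simp add: \<tau>_def \<mu>_def s_def t_def)
qed

section \<open>Union bound over pairs of vertex sets\<close>

lemma power_div_fact_le_exp: "0 \<le> x \<Longrightarrow> x ^ k / fact k \<le> exp (x :: real)"
proof -
  assume x: "0 \<le> x"
  have s: "summable (\<lambda>n. x ^ n /\<^sub>R fact n)" by (rule summable_exp_generic)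
  have "(\<Sum>n\<in>{k}. x ^ n /\<^sub>R fact n) \<le> (\<Sum>n. x ^ n /\<^sub>R fact n)"
    by (rule sum_le_suminf[OF s]) (use x in auto)
  then show ?thesis by (simp add: exp_def divide_inverse mult.commute)
qed

text \<open>This is the usual bound (e n/k)^k, using k^k/k! \<le> e^k.\<close>

lemma binomial_le_entropy:
  assumes "1 \<le> k" "k \<le> n"
  shows "real (n choose k) \<le> exp (k * (1 + ln (n / k)))"
proof -
  have "real (n choose k) * fact k \<le> real n ^ k"
    using binomial_fact_pow[of n k] by (metis of_nat_fact of_nat_le_iff of_nat_mult of_nat_power)
  then have "real (n choose k) \<le> real n ^ k / fact k" by (simp add: field_simps)
  also have "\<dots> = (n / k) ^ k * (real k ^ k / fact k)" using assms by (simp add: power_divide)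
  also have "\<dots> \<le> (n / k) ^ k * exp k"
    by (intro mult_left_mono power_div_fact_le_exp) auto
  also have "(real n / k) ^ k = exp (k * ln (n / k))"
    using assms by (subst exp_of_nat_mult) (auto simp: exp_ln)
  also have "exp (k * ln (n / k)) * exp (real k) = exp (k * (1 + ln (n / k)))"
    by (simp flip: exp_add add: algebra_simps)
  finally show ?thesis .
qed

text \<open>One of the three copies of the entropy pays for the number of k-subsets. By monotonicity
  in k the other two are at least 2 ln n, and there are n sizes k.\<close>

lemma sum_subsets_entropy:
  assumes n: "1 \<le> n"
  shows "(\<Sum>S\<in>Pow {..<n} - {{}}. exp (- 3 * (card S * (1 + ln (n / card S))))) \<le> 1 / real n"
proof -
  let ?f = "\<lambda>k::nat. exp (- 3 * (k * (1 + ln (real n / real k))))"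
  let ?A = "Pow {..<n} - {{}}"
  have "(\<Sum>S\<in>?A. ?f (card S)) = (\<Sum>k\<in>{1..n}. \<Sum>S\<in>{S \<in> ?A. card S = k}. ?f (card S))"
  proof -
    have "card ` ?A \<subseteq> {1..n}"
    proof (rule image_subsetI)
      fix S assume "S \<in> ?A"
      then show "card S \<in> {1..n}"
        using card_mono[of "{..<n}" S] by (auto simp: Suc_le_eq card_gt_0_iff intro: finite_subset)
    qed
    then show ?thesis by (intro sum.group[symmetric]) auto
  qed
  also have "\<dots> \<le> (\<Sum>k\<in>{1..n}. 1 / (real n)\<^sup>2)"
  proof (intro sum_mono)
    fix k assume k: "k \<in> {1..n}"
    have "{S \<in> ?A. card S = k} = {S. S \<subseteq> {..<n} \<and> card S = k}" using k by auto
    then have "card {S \<in> ?A. card S = k} = n choose k" by (simp add: n_subsets)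
    then have "(\<Sum>S\<in>{S \<in> ?A. card S = k}. ?f (card S)) = real (n choose k) * ?f k"
      by simp
    also have "real (n choose k) * ?f k \<le> exp (k * (1 + ln (n / k))) * ?f k"
      using k by (intro mult_right_mono binomial_le_entropy) auto
    also have "\<dots> = exp (- 2 * (k * (1 + ln (n / k))))" by (simp flip: exp_add)
    also have "\<dots> \<le> exp (- 2 * ln n)"
      using entropy_bound_mono[of 1 "real k" "real n"] k by simp
    also have "\<dots> = 1 / (real n)\<^sup>2"
    proof -
      have "exp (2 * ln (real n)) = (real n)\<^sup>2" using n by (simp add: exp_double exp_ln)
      then show ?thesis by (simp add: exp_minus divide_inverse)
    qed
    finally show "(\<Sum>S\<in>{S \<in> ?A. card S = k}. ?f (card S)) \<le> 1 / (real n)\<^sup>2" .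
  qed
  also have "\<dots> = 1 / real n" using n by (simp add: power2_eq_square)
  finally show ?thesis .
qed

definition pseudorandom :: "nat \<Rightarrow> nat \<Rightarrow> nat set set \<Rightarrow> bool" where
  "pseudorandom \<Delta> n E \<longleftrightarrow> (\<forall>S\<subseteq>{..<n}. \<forall>T\<subseteq>{..<n}.
     \<bar>pair_count n S T E - real \<Delta> * real (card S) * real (card T) / real n\<bar> \<le> 120 * sqrt \<Delta> * sqrt (real (card S) * real (card T)))"

text \<open>Six copies of the larger entropy dominate three copies of each, so the sum over pairs of
  sets factors into the square of a sum over single sets.\<close>

lemma pseudorandom_prob:
  fixes \<Delta> n :: nat
  assumes ne: "regular_graphs \<Delta> n \<noteq> {}" and \<Delta>: "0 < \<Delta>" and n: "4 * \<Delta> * (\<Delta> + 1) \<le> n"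
  shows "1 - 2 / (real n)\<^sup>2 \<le> measure_pmf.prob (random_regular_graph \<Delta> n)
      {E \<in> regular_graphs \<Delta> n. pseudorandom \<Delta> n E}"
proof -
  let ?M = "random_regular_graph \<Delta> n"
  let ?P = "measure_pmf.prob ?M"
  let ?A = "Pow {..<n} - {{}}"
  let ?bad = "\<lambda>S T. {E. 120 * sqrt \<Delta> * sqrt (real (card S) * real (card T)) < \<bar>pair_count n S T E - real \<Delta> * real (card S) * real (card T) / real n\<bar>}"
  let ?h = "\<lambda>S. exp (- 3 * (card S * (1 + ln (n / card S))))"
  have n1: "1 \<le> n" using n \<Delta> by (cases n) auto
  have bad: "?P (?bad S T) \<le> 2 * (?h S * ?h T)" if "S \<in> ?A" "T \<in> ?A" for S T
  proof -
    have main: "?P (?bad S T) \<le> 2 * (?h S * ?h T)" if S: "S \<in> ?A" and T: "T \<in> ?A" and le: "card S \<le> card T" for S T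
    proof -
      have "finite S" "finite T" using S T by (auto intro: finite_subset)
      then have "0 < card S" "card T \<le> n" using S T card_mono[of "{..<n}" T] by (auto simp: card_gt_0_iff)
      then have "card S * (1 + ln (n / card S)) \<le> card T * (1 + ln (n / card T))"
        using le by (intro entropy_bound_mono) auto
      then have "exp (- 6 * (card T * (1 + ln (n / card T)))) \<le> ?h S * ?h T"
        by (simp flip: exp_add)
      moreover have "?P (?bad S T) \<le> 2 * exp (- 6 * (card T * (1 + ln (n / card T))))"
        using S T by (intro discrepancy_prob ne \<Delta> n le) auto
      ultimately show ?thesis by linarith
    qed
    show ?thesis
    proof (cases "card S \<le> card T")
      case True
      then show ?thesis using main that by blast
    next
      case False
      have "?bad S T = ?bad T S" by (simp add: pair_count_sym[of n S T] mult_ac)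
      then show ?thesis using main[OF that(2,1)] False by (simp add: mult_ac)
    qed
  qed
  have "?P (\<Union>p\<in>?A \<times> ?A. ?bad (fst p) (snd p)) \<le> (\<Sum>p\<in>?A \<times> ?A. ?P (?bad (fst p) (snd p)))"
    by (rule measure_pmf.finite_measure_subadditive_finite) auto
  also have "\<dots> \<le> (\<Sum>p\<in>?A \<times> ?A. 2 * (?h (fst p) * ?h (snd p)))"
    by (intro sum_mono bad) auto
  also have "\<dots> = 2 * ((\<Sum>S\<in>?A. ?h S) * (\<Sum>S\<in>?A. ?h S))"
    unfolding sum_product sum.cartesian_product by (simp only: sum_distrib_left split_def)
  also have "\<dots> \<le> 2 * (1 / real n * (1 / real n))"
    using sum_subsets_entropy[OF n1] by (intro mult_left_mono mult_mono sum_nonneg) auto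
  also have "\<dots> = 2 / (real n)\<^sup>2" by (simp add: power2_eq_square)
  finally have le: "?P (\<Union>p\<in>?A \<times> ?A. ?bad (fst p) (snd p)) \<le> 2 / (real n)\<^sup>2" .
  have "1 - ?P (\<Union>p\<in>?A \<times> ?A. ?bad (fst p) (snd p)) = ?P (- (\<Union>p\<in>?A \<times> ?A. ?bad (fst p) (snd p)))"
    using measure_pmf.prob_compl[of "\<Union>p\<in>?A \<times> ?A. ?bad (fst p) (snd p)" ?M] by (simp add: Compl_eq_Diff_UNIV)
  also have "\<dots> \<le> ?P {E \<in> regular_graphs \<Delta> n. pseudorandom \<Delta> n E}"
  proof (rule measure_pmf.finite_measure_mono_AE)
    have "AE E in ?M. E \<in> regular_graphs \<Delta> n"
      using ne finite_regular_graphs by (simp add: AE_measure_pmf_iff random_regular_graph_def)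
    then show "AE E in ?M. E \<in> - (\<Union>p\<in>?A \<times> ?A. ?bad (fst p) (snd p)) \<longrightarrow> E \<in> {E \<in> regular_graphs \<Delta> n. pseudorandom \<Delta> n E}"
    proof (rule AE_mp, intro AE_I2 impI)
      fix E assume E: "E \<in> regular_graphs \<Delta> n" and g: "E \<in> - (\<Union>p\<in>?A \<times> ?A. ?bad (fst p) (snd p))"
      have emp: "pair_count n {} T E = 0" "pair_count n T {} E = 0" for T
        by (auto simp: pair_count_def edge_count_def)
      have "\<bar>pair_count n S T E - real \<Delta> * real (card S) * real (card T) / real n\<bar> \<le> 120 * sqrt \<Delta> * sqrt (real (card S) * real (card T))"
        if "S \<subseteq> {..<n}" "T \<subseteq> {..<n}" for S T
      proof (cases "S = {} \<or> T = {}")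
        case True
        then show ?thesis by (auto simp: emp)
      next
        case False
        then have "(S, T) \<in> ?A \<times> ?A" using that by auto
        then have "E \<notin> ?bad S T" using g by fastforce
        then show ?thesis by simp
      qed
      with E show "E \<in> {E \<in> regular_graphs \<Delta> n. pseudorandom \<Delta> n E}" by (simp add: pseudorandom_def)
    qed
  qed auto
  finally show ?thesis using le by linarith
qed

section \<open>From discrepancy to the least eigenvalue\<close>

lemma nat_binary_expansion:
  fixes m :: nat
  assumes "m < 2 ^ N"
  shows "real m = (\<Sum>k<N. 2 ^ k * of_bool (bit m k))"
proof -
  have "m = take_bit N m" using assms by (simp add: take_bit_nat_eq_self)
  also have "\<dots> = (\<Sum>k = 0..<N. push_bit k (of_bool (bit m k)))" by (rule take_bit_sum)
  finally have "m = (\<Sum>k<N. 2 ^ k * of_bool (bit m k))"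
    by (simp add: push_bit_eq_mult atLeast0LessThan mult.commute)
  from arg_cong[OF this, of real] show ?thesis by simp
qed

lemma sum_squares_le_square_sum:
  fixes f :: "'a \<Rightarrow> real"
  assumes "finite A" "\<And>x. x \<in> A \<Longrightarrow> 0 \<le> f x"
  shows "(\<Sum>x\<in>A. (f x)\<^sup>2) \<le> (\<Sum>x\<in>A. f x)\<^sup>2"
proof -
  have "(\<Sum>x\<in>A. (f x)\<^sup>2) \<le> (\<Sum>x\<in>A. f x * (\<Sum>y\<in>A. f y))"
    unfolding power2_eq_square using assms by (intro sum_mono mult_left_mono member_le_sum) auto
  then show ?thesis by (simp add: power2_eq_square sum_distrib_right)
qed

lemma sum_far_levels:
  "(\<Sum>j<N. of_bool (\<gamma> < j) * (1/2) ^ j) \<le> (1/2 :: real) ^ \<gamma>"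
proof (cases "\<gamma> < N")
  case False
  then have "(\<Sum>j<N. of_bool (\<gamma> < j) * (1/2) ^ j) = (\<Sum>j<N. 0 :: real)" by (intro sum.cong) auto
  then show ?thesis by simp
next
  case True
  have "(\<Sum>j<Suc \<gamma> + d. of_bool (\<gamma> < j) * (1/2) ^ j) = (1/2 :: real) ^ \<gamma> - 2 * (1/2) ^ (Suc \<gamma> + d)" for d
  proof (induction d)
    case 0
    have "(\<Sum>j<Suc \<gamma>. of_bool (\<gamma> < j) * (1/2) ^ j) = (\<Sum>j<Suc \<gamma>. 0 :: real)" by (intro sum.cong) auto
    then show ?case by simp
  next
    case (Suc d)
    then show ?case by simp
  qed
  from this[of "N - Suc \<gamma>"] True show ?thesis by simp
qed

text \<open>A row sum of a kernel that depends only on the distance of k and l, the distance being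
  spelled out because of truncated subtraction. Each distance occurs at most twice; distances up to
  \<gamma> cost \<alpha>/2 each and the rest form a geometric series.\<close>

lemma sum_level_weights:
  fixes \<alpha> D :: real and \<gamma> k N :: nat
  assumes "0 \<le> \<alpha>" "0 \<le> D" "k < N"
  defines "w \<equiv> (\<lambda>j::nat. if j \<le> \<gamma> then \<alpha> / 2 else D * (1/2) ^ j)"
  shows "(\<Sum>l<N. w (if l \<le> k then k - l else l - k)) \<le> \<alpha> * (real \<gamma> + 1) + 2 * D * (1/2) ^ \<gamma>"
proof -
  have w0: "0 \<le> w j" for j using assms by (simp add: w_def)
  have "{..<N} = {..k} \<union> {k<..<N}" "{..k} \<inter> {k<..<N} = {}" using assms by auto
  then have "(\<Sum>l<N. w (if l \<le> k then k - l else l - k)) =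
     (\<Sum>l\<le>k. w (if l \<le> k then k - l else l - k)) + (\<Sum>l\<in>{k<..<N}. w (if l \<le> k then k - l else l - k))"
    by (simp add: sum.union_disjoint)
  also have "(\<Sum>l\<le>k. w (if l \<le> k then k - l else l - k)) = (\<Sum>j\<le>k. w j)"
    by (rule sum.reindex_bij_witness[of _ "\<lambda>j. k - j" "\<lambda>j. k - j"]) auto
  also have "\<dots> \<le> (\<Sum>j<N. w j)" using assms by (intro sum_mono2 w0) auto
  also have "(\<Sum>l\<in>{k<..<N}. w (if l \<le> k then k - l else l - k)) = (\<Sum>j\<in>{1..<N - k}. w j)"
    by (rule sum.reindex_bij_witness[of _ "\<lambda>j. k + j" "\<lambda>l. l - k"]) auto
  also have "\<dots> \<le> (\<Sum>j<N. w j)" by (intro sum_mono2 w0) auto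
  finally have "(\<Sum>l<N. w (if l \<le> k then k - l else l - k)) \<le> 2 * (\<Sum>j<N. w j)" by simp
  also have "(\<Sum>j<N. w j) \<le> (\<Sum>j<N. \<alpha> / 2 * of_bool (j \<le> \<gamma>) + D * (of_bool (\<gamma> < j) * (1/2) ^ j))"
    by (intro sum_mono) (auto simp: w_def)
  also have "\<dots> = \<alpha> / 2 * (\<Sum>j<N. of_bool (j \<le> \<gamma>)) + D * (\<Sum>j<N. of_bool (\<gamma> < j) * (1/2) ^ j)"
    by (simp only: sum.distrib sum_distrib_left)
  also have "\<dots> \<le> \<alpha> / 2 * (real \<gamma> + 1) + D * (1/2) ^ \<gamma>"
  proof (intro add_mono mult_left_mono sum_far_levels)
    have "(\<Sum>j<N. of_bool (j \<le> \<gamma>)) = real (card ({..<N} \<inter> {..\<gamma>}))"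
      by (simp add: Int_def)
    also have "\<dots> \<le> real (card {..\<gamma>})" by (intro of_nat_mono card_mono) auto
    finally show "(\<Sum>j<N. of_bool (j \<le> \<gamma>)) \<le> real \<gamma> + 1" by simp
  qed (use assms in auto)
  finally show ?thesis by (simp add: algebra_simps add_divide_distrib)
qed

text \<open>The bilinear form of the adjacency matrix minus its average (\<Delta>/n) J.\<close>

definition disc :: "nat \<Rightarrow> nat \<Rightarrow> nat set set \<Rightarrow> (nat \<Rightarrow> real) \<Rightarrow> (nat \<Rightarrow> real) \<Rightarrow> real" where
  "disc \<Delta> n E x y = (\<Sum>u<n. \<Sum>v<n. x u * y v * (adj E u v - \<Delta> / n))"

lemma disc_indicator:
  assumes "S \<subseteq> {..<n}" "T \<subseteq> {..<n}"
  shows "disc \<Delta> n E (\<lambda>u. of_bool (u \<in> S)) (\<lambda>v. of_bool (v \<in> T)) = pair_count n S T E - real \<Delta> * real (card S) * real (card T) / real n"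
proof -
  have "disc \<Delta> n E (\<lambda>u. of_bool (u \<in> S)) (\<lambda>v. of_bool (v \<in> T)) =
     pair_count n S T E - (\<Sum>u<n. of_bool (u \<in> S)) * (\<Sum>v<n. of_bool (v \<in> T)) * (\<Delta> / n)"
    unfolding disc_def pair_count_def edge_count_def right_diff_distrib sum_subtractf
    unfolding sum_product unfolding sum_distrib_right ..
  then show ?thesis unfolding sum_indicator[OF assms(1)] sum_indicator[OF assms(2)] by simp
qed

lemma disc_sum:
  assumes "finite I"
  shows "disc \<Delta> n E (\<lambda>u. \<Sum>i\<in>I. c i * f i u) (\<lambda>u. \<Sum>i\<in>I. c i * f i u) =
     (\<Sum>i\<in>I. \<Sum>j\<in>I. c i * c j * disc \<Delta> n E (f i) (f j))"
proof -
  let ?m = "\<lambda>u v. adj E u v - \<Delta> / n"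
  have "disc \<Delta> n E (\<lambda>u. \<Sum>i\<in>I. c i * f i u) (\<lambda>u. \<Sum>i\<in>I. c i * f i u) =
     (\<Sum>u<n. \<Sum>v<n. \<Sum>i\<in>I. \<Sum>j\<in>I. c i * f i u * (c j * f j v) * ?m u v)"
    unfolding disc_def unfolding sum_product unfolding sum_distrib_right ..
  also have "\<dots> = (\<Sum>u<n. \<Sum>i\<in>I. \<Sum>v<n. \<Sum>j\<in>I. c i * f i u * (c j * f j v) * ?m u v)"
    by (intro sum.cong refl sum.swap)
  also have "\<dots> = (\<Sum>i\<in>I. \<Sum>u<n. \<Sum>v<n. \<Sum>j\<in>I. c i * f i u * (c j * f j v) * ?m u v)"
    by (rule sum.swap)
  also have "\<dots> = (\<Sum>i\<in>I. \<Sum>u<n. \<Sum>j\<in>I. \<Sum>v<n. c i * f i u * (c j * f j v) * ?m u v)"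
    by (intro sum.cong refl sum.swap)
  also have "\<dots> = (\<Sum>i\<in>I. \<Sum>j\<in>I. \<Sum>u<n. \<Sum>v<n. c i * f i u * (c j * f j v) * ?m u v)"
    by (intro sum.cong refl sum.swap)
  also have "\<dots> = (\<Sum>i\<in>I. \<Sum>j\<in>I. c i * c j * disc \<Delta> n E (f i) (f j))"
    unfolding disc_def sum_distrib_left by (simp only: mult_ac)
  finally show ?thesis .
qed

text \<open>The last two bounds hold for every regular graph: the edge count and its average both
  lie between 0 and \<Delta> times the size of either set. They take over where the sizes of two
  level sets are too unbalanced.\<close>

lemma disc_indicator_bounds:
  assumes E: "E \<in> regular_graphs \<Delta> n" and P: "pseudorandom \<Delta> n E" and S: "S \<subseteq> {..<n}" and T: "T \<subseteq> {..<n}"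
  defines "d \<equiv> \<bar>disc \<Delta> n E (\<lambda>u. of_bool (u \<in> S)) (\<lambda>v. of_bool (v \<in> T))\<bar>"
  shows "d \<le> 120 * sqrt \<Delta> * sqrt (real (card S) * real (card T))" "d \<le> real \<Delta> * card S" "d \<le> real \<Delta> * card T"
proof -
  note d = d_def[unfolded disc_indicator[OF S T]]
  show "d \<le> 120 * sqrt \<Delta> * sqrt (real (card S) * real (card T))"
    using P S T unfolding d pseudorandom_def by blast
  have le: "real (card X) \<le> n" if "X \<subseteq> {..<n}" for X using card_mono[of "{..<n}" X] that by simp
  have q: "real (card X) * real (card Y) / n \<le> real (card X)" if "Y \<subseteq> {..<n}" for X Y
    using mult_left_mono[OF le[OF that], of "real (card X)"] by (cases "n = 0") (auto simp: divide_le_eq)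
  have q1: "real \<Delta> * real (card S) * real (card T) / real n \<le> real \<Delta> * card S"
    using mult_left_mono[OF q[OF T, of S], of "real \<Delta>"] by (simp add: mult_ac)
  have q2: "real \<Delta> * real (card S) * real (card T) / real n \<le> real \<Delta> * card T"
    using mult_left_mono[OF q[OF S, of T], of "real \<Delta>"] by (simp add: mult_ac)
  have p0: "0 \<le> pair_count n S T E" "0 \<le> real \<Delta> * real (card S) * real (card T) / real n"
    using pair_count_nonneg by auto
  show "d \<le> real \<Delta> * card S"
    unfolding d using pair_count_le[OF E S, of T] q1 p0 by linarith
  show "d \<le> real \<Delta> * card T"
    unfolding d using pair_count_le[OF E T, of S] pair_count_sym[of n S T E] q2 p0 by linarith
qed

text \<open>Bilu and Linial's converse to the expander mixing lemma: after decomposing the vector into the level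
  sets of its binary digits, nearby levels are controlled by the discrepancy and distant ones by the degree.\<close>

lemma disc_int_vector_bound:
  fixes x :: "nat \<Rightarrow> int"
  assumes E: "E \<in> regular_graphs \<Delta> n" and P: "pseudorandom \<Delta> n E"
  shows "- (480 * sqrt \<Delta> * (real \<gamma> + 1) + 8 * real \<Delta> * (1/2) ^ \<gamma>) * (\<Sum>u<n. (real_of_int (x u))\<^sup>2)
     \<le> disc \<Delta> n E (\<lambda>u. real_of_int (x u)) (\<lambda>u. real_of_int (x u))"
proof -
  \<comment> \<open>A crude number of binary digits that suffices for all entries; it does not enter
    the final bound.\<close>
  define N where "N = (\<Sum>u<n. nat \<bar>x u\<bar>)"
  define p where "p = (\<lambda>s u. if s then nat (x u) else nat (- x u))"
  have pN: "p s u < 2 ^ N" if "u < n" for s u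
  proof -
    have "p s u \<le> nat \<bar>x u\<bar>" by (auto simp: p_def)
    also have "\<dots> \<le> N" unfolding N_def using that by (intro member_le_sum) auto
    also have "N < 2 ^ N" by (rule less_exp)
    finally show ?thesis .
  qed
  define I where "I = (UNIV :: bool set) \<times> {..<N}"
  define c :: "bool \<times> nat \<Rightarrow> real" where "c = (\<lambda>(s, k). (if s then 1 else - 1) * 2 ^ k)"
  define U where "U = (\<lambda>(s, k). {u. u < n \<and> bit (p s u) k})"
  define f :: "bool \<times> nat \<Rightarrow> nat \<Rightarrow> real" where "f = (\<lambda>i u. of_bool (u \<in> U i))"
  have finI: "finite I" by (simp add: I_def)
  have Un: "U i \<subseteq> {..<n}" for i by (auto simp: U_def)
  have xu: "real_of_int (x u) = (\<Sum>i\<in>I. c i * f i u)" if u: "u < n" for u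
  proof -
    have "(\<Sum>i\<in>I. c i * f i u) = (\<Sum>s\<in>UNIV. \<Sum>k<N. c (s, k) * f (s, k) u)"
      by (simp add: I_def sum.cartesian_product)
    also have "\<dots> = (\<Sum>k<N. 2 ^ k * of_bool (bit (p True u) k)) - (\<Sum>k<N. 2 ^ k * of_bool (bit (p False u) k))"
      using u by (simp add: UNIV_bool c_def f_def U_def sum_negf)
    also have "\<dots> = real (p True u) - real (p False u)"
      using nat_binary_expansion[OF pN[OF u]] by simp
    also have "\<dots> = real_of_int (x u)" by (auto simp: p_def)
    finally show ?thesis by simp
  qed
  \<comment> \<open>The squared mass of one signed digit level. Digits are nonnegative and an entry
    has only one sign, so all levels together have at most the squared norm of
    \<open>x\<close>.\<close>
  define w where "w = (\<lambda>i. (c i)\<^sup>2 * card (U i))"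
  have w0: "0 \<le> w i" for i by (simp add: w_def)
  have sum_w: "(\<Sum>i\<in>I. w i) \<le> (\<Sum>u<n. (real_of_int (x u))\<^sup>2)"
  proof -
    have "(\<Sum>i\<in>I. w i) = (\<Sum>i\<in>I. \<Sum>u<n. (c i * f i u)\<^sup>2)"
    proof (intro sum.cong refl)
      fix i
      have "(\<Sum>u<n. (c i * f i u)\<^sup>2) = (\<Sum>u<n. (c i)\<^sup>2 * of_bool (u \<in> U i))"
        by (intro sum.cong) (auto simp: f_def)
      also have "\<dots> = (c i)\<^sup>2 * card (U i)"
        unfolding sum_distrib_left[symmetric] sum_indicator[OF Un] ..
      finally show "w i = (\<Sum>u<n. (c i * f i u)\<^sup>2)" by (simp add: w_def)
    qed
    also have "\<dots> = (\<Sum>u<n. \<Sum>i\<in>I. (c i * f i u)\<^sup>2)" by (rule sum.swap)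
    also have "\<dots> \<le> (\<Sum>u<n. (real_of_int (x u))\<^sup>2)"
    proof (intro sum_mono)
      fix u assume "u \<in> {..<n}"
      then have u: "u < n" by simp
      have "(\<Sum>i\<in>I. (c i * f i u)\<^sup>2) = (\<Sum>s\<in>UNIV. \<Sum>k<N. (c (s, k) * f (s, k) u)\<^sup>2)"
        by (simp add: I_def sum.cartesian_product)
      also have "\<dots> = (\<Sum>s\<in>UNIV. \<Sum>k<N. (2 ^ k * of_bool (bit (p s u) k))\<^sup>2)"
        using u by (intro sum.cong refl) (auto simp: c_def f_def U_def)
      also have "\<dots> \<le> (\<Sum>s\<in>UNIV. (real (p s u))\<^sup>2)"
        unfolding nat_binary_expansion[OF pN[OF u]] by (intro sum_mono sum_squares_le_square_sum) auto
      also have "\<dots> = (real_of_int (x u))\<^sup>2" by (cases "0 \<le> x u") (auto simp: UNIV_bool p_def)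
      finally show "(\<Sum>i\<in>I. (c i * f i u)\<^sup>2) \<le> (real_of_int (x u))\<^sup>2" .
    qed
    finally show ?thesis .
  qed
  define \<alpha> where "\<alpha> = 120 * sqrt \<Delta>"
  \<comment> \<open>Up to distance \<gamma> the discrepancy bound and the arithmetic-geometric mean
    give \<alpha>/2 times \<open>w i + w j\<close>; beyond it the degree bound gives geometric
    decay.\<close>
  define b where "b = (\<lambda>j::nat. if j \<le> \<gamma> then \<alpha> / 2 else real \<Delta> * (1/2) ^ j)"
  define B where "B = (\<lambda>k l::nat. b (if l \<le> k then k - l else l - k))"
  have Bsym: "B k l = B l k" for k l by (simp add: B_def)
  have \<alpha>0: "0 \<le> \<alpha>" by (simp add: \<alpha>_def)
  have b0: "0 \<le> b j" for j using \<alpha>0 by (simp add: b_def)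
  \<comment> \<open>If k is the higher level, 2^k 2^l = 2^(-(k - l)) 4^k, so the degree bound taken
    on the set of the higher level already decays in the distance.\<close>
  have far: "\<bar>c i\<bar> * \<bar>c j\<bar> * (real \<Delta> * card (U i)) = real \<Delta> * (1/2) ^ (snd i - snd j) * w i" if "snd j \<le> snd i" for i j
  proof -
    obtain s k t l where ij: "i = (s, k)" "j = (t, l)" by (cases i, cases j) auto
    have "(2::real) ^ k = 2 ^ (k - l) * 2 ^ l" using that ij by (simp flip: power_add)
    then have "(1/2) ^ (k - l) * (2::real) ^ k = 2 ^ l" by (simp add: power_one_over field_simps)
    moreover have "\<bar>c i\<bar> = 2 ^ k" "\<bar>c j\<bar> = 2 ^ l" "w i = 2 ^ k * 2 ^ k * card (U i)"
      by (auto simp: ij c_def w_def power2_eq_square abs_mult)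
    ultimately show ?thesis by (simp add: ij mult_ac)
  qed
  have entry: "\<bar>c i * c j * disc \<Delta> n E (f i) (f j)\<bar> \<le> B (snd i) (snd j) * (w i + w j)" for i j
  proof -
    let ?j = "if snd j \<le> snd i then snd i - snd j else snd j - snd i"
    let ?d = "\<bar>disc \<Delta> n E (f i) (f j)\<bar>"
    have "(\<lambda>u. of_bool (u \<in> U i)) = f i" for i by (simp add: f_def)
    note d = disc_indicator_bounds[OF E P Un[of i] Un[of j], unfolded this]
    have eq: "\<bar>c i * c j * disc \<Delta> n E (f i) (f j)\<bar> = \<bar>c i\<bar> * \<bar>c j\<bar> * ?d" by (simp add: abs_mult)
    show ?thesis
    proof (cases "?j \<le> \<gamma>")
      case True
      have "\<bar>c i\<bar> * \<bar>c j\<bar> * ?d \<le> \<bar>c i\<bar> * \<bar>c j\<bar> * (\<alpha> * sqrt (real (card (U i)) * real (card (U j))))"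
        unfolding \<alpha>_def by (intro mult_left_mono d) auto
      also have "\<dots> = \<alpha> * (sqrt (w i) * sqrt (w j))"
        by (simp add: w_def real_sqrt_mult)
      also have "\<dots> \<le> \<alpha> * ((w i + w j) / 2)"
        using arith_geo_mean_sqrt[OF w0 w0, of i j] \<alpha>0 by (intro mult_left_mono) (auto simp: real_sqrt_mult)
      also have "\<dots> = B (snd i) (snd j) * (w i + w j)" using True by (simp add: B_def b_def)
      finally show ?thesis using eq by simp
    next
      case False
      then have Bv: "B (snd i) (snd j) = real \<Delta> * (1/2) ^ ?j" by (simp add: B_def b_def)
      show ?thesis
      proof (cases "snd j \<le> snd i")
        case True
        have "\<bar>c i\<bar> * \<bar>c j\<bar> * ?d \<le> \<bar>c i\<bar> * \<bar>c j\<bar> * (real \<Delta> * card (U i))"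
          by (intro mult_left_mono d) auto
        also have "\<dots> = B (snd i) (snd j) * w i" using far[OF True] True Bv by simp
        also have "\<dots> \<le> B (snd i) (snd j) * (w i + w j)"
          using w0 b0 by (intro mult_left_mono) (auto simp: B_def)
        finally show ?thesis using eq by simp
      next
        case F: False
        have "\<bar>c i\<bar> * \<bar>c j\<bar> * ?d \<le> \<bar>c j\<bar> * \<bar>c i\<bar> * (real \<Delta> * card (U j))"
          unfolding mult.commute[of "\<bar>c i\<bar>"] by (intro mult_left_mono d) auto
        also have "\<dots> = B (snd i) (snd j) * w j" using far[of i j] F Bv by simp
        also have "\<dots> \<le> B (snd i) (snd j) * (w i + w j)"
          using w0 b0 by (intro mult_left_mono) (auto simp: B_def)
        finally show ?thesis using eq by simp
      qed
    qed
  qed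
  \<comment> \<open>The outer factor 2 accounts for the two signs of each digit level.\<close>
  have rowsum: "(\<Sum>j\<in>I. B (snd i) (snd j)) \<le> 2 * (\<alpha> * (real \<gamma> + 1) + 2 * real \<Delta> * (1/2) ^ \<gamma>)" if "i \<in> I" for i
  proof -
    have "(\<Sum>j\<in>I. B (snd i) (snd j)) = (\<Sum>s\<in>(UNIV::bool set). \<Sum>l<N. B (snd i) l)"
      unfolding I_def sum.cartesian_product by (simp only: split_def snd_conv)
    also have "\<dots> = 2 * (\<Sum>l<N. B (snd i) l)" by (simp add: UNIV_bool)
    also have "(\<Sum>l<N. B (snd i) l) \<le> \<alpha> * (real \<gamma> + 1) + 2 * real \<Delta> * (1/2) ^ \<gamma>"
      unfolding B_def b_def using that \<alpha>0 by (intro sum_level_weights) (auto simp: I_def)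
    finally show ?thesis by simp
  qed
  let ?R = "2 * (\<alpha> * (real \<gamma> + 1) + 2 * real \<Delta> * (1/2) ^ \<gamma>)"
  have "disc \<Delta> n E (\<lambda>u. real_of_int (x u)) (\<lambda>u. real_of_int (x u)) =
     disc \<Delta> n E (\<lambda>u. \<Sum>i\<in>I. c i * f i u) (\<lambda>u. \<Sum>i\<in>I. c i * f i u)"
    unfolding disc_def by (intro sum.cong refl) (simp add: xu)
  also have "\<dots> = (\<Sum>i\<in>I. \<Sum>j\<in>I. c i * c j * disc \<Delta> n E (f i) (f j))"
    by (rule disc_sum[OF finI])
  finally have "- disc \<Delta> n E (\<lambda>u. real_of_int (x u)) (\<lambda>u. real_of_int (x u)) =
     (\<Sum>i\<in>I. \<Sum>j\<in>I. - (c i * c j * disc \<Delta> n E (f i) (f j)))" by (simp add: sum_negf)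
  also have "\<dots> \<le> (\<Sum>i\<in>I. \<Sum>j\<in>I. B (snd i) (snd j) * (w i + w j))"
    using entry by (intro sum_mono) (smt (verit))
  also have "\<dots> = (\<Sum>i\<in>I. \<Sum>j\<in>I. B (snd i) (snd j) * w i) + (\<Sum>i\<in>I. \<Sum>j\<in>I. B (snd i) (snd j) * w j)"
    by (simp only: distrib_left sum.distrib)
  also have "(\<Sum>i\<in>I. \<Sum>j\<in>I. B (snd i) (snd j) * w j) = (\<Sum>j\<in>I. \<Sum>i\<in>I. B (snd j) (snd i) * w j)"
    by (subst sum.swap) (simp only: Bsym)
  also have "(\<Sum>i\<in>I. \<Sum>j\<in>I. B (snd i) (snd j) * w i) + (\<Sum>i\<in>I. \<Sum>j\<in>I. B (snd i) (snd j) * w i)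
     = 2 * (\<Sum>i\<in>I. (\<Sum>j\<in>I. B (snd i) (snd j)) * w i)"
    by (simp add: sum_distrib_right)
  also have "\<dots> \<le> 2 * (\<Sum>i\<in>I. ?R * w i)"
    by (intro mult_left_mono sum_mono mult_right_mono rowsum w0) auto
  also have "\<dots> = 2 * ?R * (\<Sum>i\<in>I. w i)" by (simp only: sum_distrib_left mult.assoc)
  also have "\<dots> \<le> 2 * ?R * (\<Sum>u<n. (real_of_int (x u))\<^sup>2)"
    using \<alpha>0 by (intro mult_left_mono sum_w) auto
  also have "2 * ?R = 480 * sqrt \<Delta> * (real \<gamma> + 1) + 8 * real \<Delta> * (1/2) ^ \<gamma>"
    by (simp add: \<alpha>_def algebra_simps)
  finally show ?thesis unfolding mult_minus_left by linarith
qed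

text \<open>Integer vectors scale to rational ones by homogeneity, and rounding down
  \<open>N * x\<close> extends the bound to real vectors by continuity. At the end (\<Delta>/n)
  times the square of the sum of \<open>x\<close> is added back; it is nonnegative, so the constant
  direction needs no special care.\<close>

lemma adj_quadratic_form_ge:
  fixes x :: "nat \<Rightarrow> real"
  assumes E: "E \<in> regular_graphs \<Delta> n" and P: "pseudorandom \<Delta> n E"
  shows "- (480 * sqrt \<Delta> * (real \<gamma> + 1) + 8 * real \<Delta> * (1/2) ^ \<gamma>) * (\<Sum>u<n. (x u)\<^sup>2)
     \<le> (\<Sum>u<n. \<Sum>v<n. x u * x v * adj E u v)"
proof -
  let ?K = "- (480 * sqrt \<Delta> * (real \<gamma> + 1) + 8 * real \<Delta> * (1/2) ^ \<gamma>)"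
  define y where "y = (\<lambda>N u. real_of_int \<lfloor>real N * x u\<rfloor> / real N)"
  have lim: "(\<lambda>N. y N u) \<longlonglongrightarrow> x u" for u
  proof (rule tendsto_sandwich)
    show "eventually (\<lambda>N. x u - 1 / real N \<le> y N u) sequentially"
      using eventually_gt_at_top[of 0]
    proof eventually_elim
      case (elim N)
      have "real N * x u - 1 \<le> real_of_int \<lfloor>real N * x u\<rfloor>" by linarith
      then have "(real N * x u - 1) / real N \<le> y N u" unfolding y_def by (intro divide_right_mono) auto
      then show ?case using elim by (simp add: diff_divide_distrib)
    qed
    show "eventually (\<lambda>N. y N u \<le> x u) sequentially"
      using eventually_gt_at_top[of 0]
    proof eventually_elim
      case (elim N)
      have "real_of_int \<lfloor>real N * x u\<rfloor> \<le> real N * x u" by linarith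
      then show ?case using elim by (simp add: y_def divide_le_eq mult.commute)
    qed
    show "(\<lambda>N. x u - 1 / real N) \<longlonglongrightarrow> x u"
      using tendsto_diff[OF tendsto_const lim_1_over_n, of "x u"] by simp
  qed auto
  have ineq: "?K * (\<Sum>u<n. (y N u)\<^sup>2) \<le> disc \<Delta> n E (y N) (y N)" for N
  proof -
    let ?z = "\<lambda>u. \<lfloor>real N * x u\<rfloor>"
    have "(1 / real N)\<^sup>2 * (?K * (\<Sum>u<n. (real_of_int (?z u))\<^sup>2)) \<le>
        (1 / real N)\<^sup>2 * disc \<Delta> n E (\<lambda>u. real_of_int (?z u)) (\<lambda>u. real_of_int (?z u))"
      by (rule mult_left_mono[OF disc_int_vector_bound[OF E P]]) simp
    moreover have "(1 / real N)\<^sup>2 * (?K * (\<Sum>u<n. (real_of_int (?z u))\<^sup>2)) = ?K * (\<Sum>u<n. (y N u)\<^sup>2)"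
      by (simp add: y_def power_divide flip: sum_divide_distrib)
    moreover have "(1 / real N)\<^sup>2 * disc \<Delta> n E (\<lambda>u. real_of_int (?z u)) (\<lambda>u. real_of_int (?z u)) = disc \<Delta> n E (y N) (y N)"
      unfolding disc_def sum_distrib_left y_def by (intro sum.cong refl) (simp add: power2_eq_square)
    ultimately show ?thesis by (simp only:)
  qed
  have "?K * (\<Sum>u<n. (x u)\<^sup>2) \<le> disc \<Delta> n E x x"
  proof (rule LIMSEQ_le)
    show "(\<lambda>N. ?K * (\<Sum>u<n. (y N u)\<^sup>2)) \<longlonglongrightarrow> ?K * (\<Sum>u<n. (x u)\<^sup>2)"
      by (intro tendsto_intros lim)
    show "(\<lambda>N. disc \<Delta> n E (y N) (y N)) \<longlonglongrightarrow> disc \<Delta> n E x x"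
      unfolding disc_def by (intro tendsto_intros lim)
  qed (use ineq in auto)
  also have "disc \<Delta> n E x x = (\<Sum>u<n. \<Sum>v<n. x u * x v * adj E u v) - (\<Sum>u<n. x u)\<^sup>2 * (\<Delta> / n)"
    unfolding disc_def right_diff_distrib sum_subtractf power2_eq_square
    unfolding sum_product unfolding sum_distrib_right ..
  also have "\<dots> \<le> (\<Sum>u<n. \<Sum>v<n. x u * x v * adj E u v)" by simp
  finally show ?thesis .
qed

section \<open>Minimisers of Rayleigh quotients\<close>

text \<open>A quadratic polynomial that is nonnegative and vanishes at 0 has derivative 0 there: the
  first-variation step of the minimisation below.\<close>

lemma linear_coeff_zero:
  fixes a b :: real
  assumes "\<And>e. 0 \<le> 2 * e * b + e\<^sup>2 * a"
  shows "b = 0"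
proof (rule ccontr)
  assume b: "b \<noteq> 0"
  define A where "A = \<bar>a\<bar> + 1"
  have A: "0 < A" "a < A" by (auto simp: A_def)
  have "2 * (- b / A) * b + (- b / A)\<^sup>2 * a = (b / A)\<^sup>2 * (a - 2 * A)"
    using A by (simp add: field_simps power2_eq_square)
  moreover have "(b / A)\<^sup>2 * (a - 2 * A) < 0"
    using A b by (intro mult_pos_neg) auto
  ultimately show False using assms[of "- b / A"] by simp
qed

text \<open>\<open>Q\<close> attains its minimum over the unit sphere of a weighted L2 space on
  \<open>S\<close>, and the first variation at the minimiser is the weak eigenvalue equation.
  Vectors are functions on the whole type that vanish off \<open>S\<close>, and \<open>Q\<close> is
  an abstract symmetric form, so one lemma serves adjacency matrices and the birth-death generator
  alike.\<close>

lemma rayleigh_minimizer: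
  fixes Q :: "('a \<Rightarrow> real) \<Rightarrow> ('a \<Rightarrow> real) \<Rightarrow> real"
  assumes S: "finite S" "S \<noteq> {}" and \<mu>: "\<And>x. x \<in> S \<Longrightarrow> 0 < \<mu> x"
    and sym: "\<And>f g. Q f g = Q g f"
    and add: "\<And>f g h. Q (\<lambda>x. f x + g x) h = Q f h + Q g h"
    and scale: "\<And>c f h. Q (\<lambda>x. c * f x) h = c * Q f h"
    and cont: "continuous_on UNIV (\<lambda>f. Q f f)"
  obtains g lam where "\<And>x. x \<notin> S \<Longrightarrow> g x = 0" "\<exists>x\<in>S. g x \<noteq> 0"
    "\<And>h. (\<And>x. x \<notin> S \<Longrightarrow> h x = 0) \<Longrightarrow> Q g h = lam * (\<Sum>x\<in>S. \<mu> x * (g x * h x))"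
    "\<And>f. (\<And>x. x \<notin> S \<Longrightarrow> f x = 0) \<Longrightarrow> lam * (\<Sum>x\<in>S. \<mu> x * (f x)\<^sup>2) \<le> Q f f"
proof -
  let ?N = "\<lambda>f. \<Sum>x\<in>S. \<mu> x * (f x)\<^sup>2"
  define b where "b = (\<lambda>x. sqrt (1 / \<mu> x))"
  \<comment> \<open>On the unit sphere the value at x is bounded by sqrt (1/\<mu> x), and off
    \<open>S\<close> it is pinned to 0. A product of compact sets thus contains the sphere, which is
    compact by Tychonoff.\<close>
  let ?box = "Pi\<^sub>E UNIV (\<lambda>x. if x \<in> S then {- b x..b x} else {0})"
  define K where "K = ?box \<inter> {f. ?N f = 1}"
  have "compactin (product_topology (\<lambda>_. euclidean) UNIV) ?box"
    by (subst compactin_PiE) auto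
  then have "compact ?box" by (simp add: euclidean_product_topology)
  moreover have "closed {f. ?N f = 1}"
    by (intro closed_Collect_eq continuous_intros) auto
  ultimately have cK: "compact K" unfolding K_def by (rule compact_Int_closed)
  have term0: "0 \<le> \<mu> x * (f x)\<^sup>2" if "x \<in> S" for f x
    using \<mu>[OF that] by (simp add: less_imp_le)
  have K_iff: "f \<in> K \<longleftrightarrow> (\<forall>x. x \<notin> S \<longrightarrow> f x = 0) \<and> ?N f = 1" for f
  proof -
    have "- b x \<le> f x \<and> f x \<le> b x" if "?N f = 1" "x \<in> S" for x
    proof -
      have "\<mu> x * (f x)\<^sup>2 \<le> ?N f"
        using that S term0 by (intro member_le_sum) auto
      then have "(f x)\<^sup>2 \<le> 1 / \<mu> x" using that \<mu>[of x] by (simp add: field_simps)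
      then have "\<bar>f x\<bar> \<le> b x" unfolding b_def by (metis real_sqrt_abs real_sqrt_le_iff)
      then show ?thesis by auto
    qed
    moreover have "f \<in> K \<longleftrightarrow> (\<forall>x. (x \<in> S \<longrightarrow> - b x \<le> f x \<and> f x \<le> b x) \<and> (x \<notin> S \<longrightarrow> f x = 0)) \<and> ?N f = 1"
    proof -
      have "f x \<in> (if x \<in> S then {- b x..b x} else {0}) \<longleftrightarrow>
          (x \<in> S \<longrightarrow> - b x \<le> f x \<and> f x \<le> b x) \<and> (x \<notin> S \<longrightarrow> f x = 0)" for x by simp
      then show ?thesis by (simp only: K_def Int_iff PiE_UNIV_domain Pi_iff ball_UNIV mem_Collect_eq simp_thms)
    qed
    ultimately show ?thesis by blast
  qed
  have N0: "f x = 0" if "?N f = 0" "x \<in> S" for f x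
  proof -
    have "\<forall>x\<in>S. \<mu> x * (f x)\<^sup>2 = 0"
      using that S term0 by (subst sum_nonneg_eq_0_iff[symmetric]) auto
    with that \<mu>[of x] show ?thesis by auto
  qed
  have Nnn: "0 \<le> ?N f" for f by (intro sum_nonneg term0)
  have norm: "(\<lambda>x. 1 / sqrt (?N f) * f x) \<in> K" if "\<And>x. x \<notin> S \<Longrightarrow> f x = 0" "?N f \<noteq> 0" for f
  proof -
    have "?N (\<lambda>x. 1 / sqrt (?N f) * f x) = (1 / sqrt (?N f))\<^sup>2 * ?N f"
      unfolding sum_distrib_left by (simp only: power_mult_distrib mult_ac)
    also have "\<dots> = 1" using that(2) Nnn[of f] by (simp add: power_divide)
    finally show ?thesis using that(1) by (simp add: K_iff)
  qed
  obtain s where s: "s \<in> S" using S by auto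
  have "?N (\<lambda>x. of_bool (x = s)) = (\<Sum>x\<in>S. if x = s then \<mu> x else 0)"
    by (intro sum.cong) auto
  also have "\<dots> = \<mu> s" using s S by (simp add: sum.delta)
  finally have "?N (\<lambda>x. of_bool (x = s)) = \<mu> s" .
  then have "K \<noteq> {}" using norm[of "\<lambda>x. of_bool (x = s)"] s \<mu>[of s] by fastforce
  then obtain g where g: "g \<in> K" and min: "\<And>f. f \<in> K \<Longrightarrow> Q g g \<le> Q f f"
    using continuous_attains_inf[OF cK _ continuous_on_subset[OF cont]] by blast
  define lam where "lam = Q g g"
  have scale2: "Q (\<lambda>x. c * f x) (\<lambda>x. c * f x) = c\<^sup>2 * Q f f" for c f
    by (simp only: scale sym[of f "\<lambda>x. c * f x"] power2_eq_square mult.assoc)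
  have lower: "lam * ?N f \<le> Q f f" if f: "\<And>x. x \<notin> S \<Longrightarrow> f x = 0" for f
  proof (cases "?N f = 0")
    case True
    then have "f = (\<lambda>x. 0 * f x)" using N0[OF True] f by fastforce
    then have "Q f f = 0" using scale[of 0 f f] by simp
    with True show ?thesis by simp
  next
    case False
    have "lam \<le> Q (\<lambda>x. 1 / sqrt (?N f) * f x) (\<lambda>x. 1 / sqrt (?N f) * f x)"
      unfolding lam_def using norm[OF f False] by (intro min) auto
    also have "\<dots> = Q f f / ?N f" using Nnn[of f] unfolding scale2 by (simp add: power_divide)
    finally show ?thesis using Nnn[of f] False by (simp add: field_simps)
  qed
  have gS: "\<And>x. x \<notin> S \<Longrightarrow> g x = 0" and gN: "?N g = 1" using g by (auto simp: K_iff)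
  have euler: "Q g h = lam * (\<Sum>x\<in>S. \<mu> x * (g x * h x))" if h: "\<And>x. x \<notin> S \<Longrightarrow> h x = 0" for h
  proof -
    \<comment> \<open>Perturbing \<open>g\<close> in the direction \<open>h\<close>: the form
      \<open>Q\<close> minus \<open>lam\<close> times the norm is nonnegative everywhere and
      vanishes at \<open>g\<close>.\<close>
    have "0 \<le> 2 * e * (Q g h - lam * (\<Sum>x\<in>S. \<mu> x * (g x * h x))) + e\<^sup>2 * (Q h h - lam * ?N h)" for e
    proof -
      let ?f = "\<lambda>x. g x + e * h x"
      have "Q ?f ?f = Q g ?f + e * Q h ?f" by (simp only: add scale)
      also have "Q g ?f = Q g g + e * Q g h" by (simp only: sym[of g ?f] add scale sym[of h g])
      also have "Q h ?f = Q g h + e * Q h h" by (simp only: sym[of h ?f] add scale)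
      finally have q: "Q ?f ?f = lam + 2 * e * Q g h + e\<^sup>2 * Q h h"
        by (simp add: lam_def algebra_simps power2_eq_square)
      have "?N ?f = (\<Sum>x\<in>S. \<mu> x * (g x)\<^sup>2 + 2 * e * (\<mu> x * (g x * h x)) + e\<^sup>2 * (\<mu> x * (h x)\<^sup>2))"
        by (intro sum.cong refl) (simp add: algebra_simps power2_eq_square)
      also have "\<dots> = 1 + 2 * e * (\<Sum>x\<in>S. \<mu> x * (g x * h x)) + e\<^sup>2 * ?N h"
        by (simp only: sum.distrib sum_distrib_left[symmetric] gN)
      finally have N: "?N ?f = 1 + 2 * e * (\<Sum>x\<in>S. \<mu> x * (g x * h x)) + e\<^sup>2 * ?N h" .
      have "lam * ?N ?f \<le> Q ?f ?f" using h gS by (intro lower) auto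
      then show ?thesis unfolding q N by (simp add: algebra_simps)
    qed
    from linear_coeff_zero[OF this] show ?thesis by simp
  qed
  have "\<exists>x\<in>S. g x \<noteq> 0"
  proof (rule ccontr)
    assume "\<not> ?thesis"
    then have "?N g = 0" by simp
    with gN show False by simp
  qed
  with gS euler lower show thesis using that by blast
qed

text \<open>A circulant graph: u and u + d are joined for d in a set \<open>D\<close> closed under
  negation modulo n. An odd degree needs the antipode n/2, available because n is then even. Without
  such a graph the uniform law would be unspecified.\<close>

lemma circulant_regular:
  assumes "2 * \<Delta> < n" "even (n * \<Delta>)"
  shows "regular_graphs \<Delta> n \<noteq> {}"
proof -
  define m where "m = \<Delta> div 2"
  define D where "D = {1..m} \<union> {n - m..<n} \<union> (if odd \<Delta> then {n div 2} else {})"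
  have mD: "\<Delta> = 2 * m + (if odd \<Delta> then 1 else 0)" by (auto simp: m_def)
  have n_even: "2 * (n div 2) = n" if "odd \<Delta>" using assms that by auto
  have mn: "2 * m < n" using assms mD by linarith
  have Dn: "d < n" "1 \<le> d" if "d \<in> D" for d
    using that mn assms by (auto simp: D_def split: if_splits)
  have Dneg: "n - d \<in> D" if "d \<in> D" for d
    using that mn n_even by (auto simp: D_def split: if_splits)
  have cD: "card D = \<Delta>"
  proof (cases "odd \<Delta>")
    case True
    have "2 * m + 1 < n" using assms mD True by simp
    then have half: "m < n div 2" "n div 2 < n - m" using n_even[OF True] by linarith+
    have "D = {1..m} \<union> ({n - m..<n} \<union> {n div 2})" using True by (auto simp: D_def)
    also have "card \<dots> = card {1..m} + card ({n - m..<n} \<union> {n div 2})"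
      using half mn by (intro card_Un_disjoint) auto
    also have "card ({n - m..<n} \<union> {n div 2}) = card {n - m..<n} + card {n div 2}"
      using half mn by (intro card_Un_disjoint) auto
    finally show ?thesis using mD True mn by simp
  next
    case False
    then have "D = {1..m} \<union> {n - m..<n}" by (auto simp: D_def)
    also have "card \<dots> = card {1..m} + card {n - m..<n}"
      using mn by (intro card_Un_disjoint) auto
    finally show ?thesis using mD False mn by simp
  qed
  \<comment> \<open>Addition modulo n, written as a case distinction because both summands are below
    n.\<close>
  define s where "s = (\<lambda>u d. if u + d < n then u + d else u + d - n)"
  define E where "E = {{u, s u d} | u d. u < n \<and> d \<in> D}"
  have s_lt: "s u d < n" and s_ne: "s u d \<noteq> u" if "u < n" "d \<in> D" for u d
    using that Dn[OF that(2)] by (auto simp: s_def)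
  have s_back: "s (s u d) (n - d) = u" if "u < n" "d \<in> D" for u d
    using that Dn[OF that(2)] by (auto simp: s_def)
  have "E \<subseteq> {e. e \<subseteq> {..<n} \<and> card e = 2}"
    using s_lt s_ne by (fastforce simp: E_def card_2_iff)
  moreover have "card {e \<in> E. v \<in> e} = \<Delta>" if v: "v < n" for v
  proof -
    have "{e \<in> E. v \<in> e} = (\<lambda>d. {v, s v d}) ` D"
    proof (intro equalityI subsetI)
      fix e assume "e \<in> {e \<in> E. v \<in> e}"
      then obtain u d where e: "e = {u, s u d}" "u < n" "d \<in> D" "v \<in> e" by (auto simp: E_def)
      show "e \<in> (\<lambda>d. {v, s v d}) ` D"
      proof (cases "v = u")
        case True
        with e show ?thesis by auto
      next
        case False
        then have "v = s u d" using e by auto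
        then have "e = {v, s v (n - d)}" using e s_back[of u d] by (simp add: insert_commute)
        with Dneg[OF e(3)] show ?thesis by auto
      qed
    qed (use v in \<open>auto simp: E_def\<close>)
    moreover have "inj_on (\<lambda>d. {v, s v d}) D"
    proof (rule inj_onI)
      fix d d' assume d: "d \<in> D" "d' \<in> D" "{v, s v d} = {v, s v d'}"
      then have "s v d = s v d'" using s_ne[OF v] by (auto simp: doubleton_eq_iff)
      then show "d = d'" using Dn[OF d(1)] Dn[OF d(2)] v by (auto simp: s_def split: if_splits)
    qed
    ultimately show ?thesis by (simp add: card_image cD)
  qed
  ultimately have "E \<in> regular_graphs \<Delta> n" by (simp add: regular_graphs_def)
  then show ?thesis by blast
qed

section \<open>The least eigenvalue as the minimum of the quadratic form\<close>

lemma eigenvalue_adjacency_iff: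
  "eigenvalue (adjacency_matrix n E) k \<longleftrightarrow>
     (\<exists>g. (\<exists>u<n. g u \<noteq> 0) \<and> (\<forall>v<n. (\<Sum>u<n. adj E v u * g u) = k * g v))"
proof -
  let ?A = "adjacency_matrix n E"
  have dim: "dim_row ?A = n" "dim_col ?A = n" by (auto simp: adjacency_matrix_def)
  have mult: "(?A *\<^sub>v w) $ v = (\<Sum>u<n. adj E v u * w $ u)" if "v < n" "dim_vec w = n" for w v
    using that by (simp add: adjacency_matrix_def scalar_prod_def adj_def atLeast0LessThan of_bool_def)
  show ?thesis
  proof
    assume "eigenvalue ?A k"
    then obtain w where "w \<in> carrier_vec n" and w: "w \<noteq> 0\<^sub>v n" "?A *\<^sub>v w = k \<cdot>\<^sub>v w"
      unfolding eigenvalue_def eigenvector_def dim by blast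
    then have w0: "dim_vec w = n" by simp
    have "\<exists>u<n. w $ u \<noteq> 0"
    proof (rule ccontr)
      assume "\<not> ?thesis"
      then have "w = 0\<^sub>v n" using w0 by (intro eq_vecI) simp_all
      with w(1) show False by simp
    qed
    moreover have "(\<Sum>u<n. adj E v u * w $ u) = k * w $ v" if "v < n" for v
    proof -
      have "(\<Sum>u<n. adj E v u * w $ u) = (k \<cdot>\<^sub>v w) $ v" using mult[OF that w0] w(2) by simp
      then show ?thesis using w0 that by simp
    qed
    ultimately show "\<exists>g. (\<exists>u<n. g u \<noteq> 0) \<and> (\<forall>v<n. (\<Sum>u<n. adj E v u * g u) = k * g v)" by blast
  next
    assume "\<exists>g. (\<exists>u<n. g u \<noteq> 0) \<and> (\<forall>v<n. (\<Sum>u<n. adj E v u * g u) = k * g v)"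
    then obtain g where g: "\<exists>u<n. g u \<noteq> 0" "\<And>v. v < n \<Longrightarrow> (\<Sum>u<n. adj E v u * g u) = k * g v" by blast
    let ?w = "vec n g"
    have "?w \<noteq> 0\<^sub>v n"
    proof
      assume eq: "?w = 0\<^sub>v n"
      obtain u where u: "u < n" "g u \<noteq> 0" using g(1) by blast
      have "?w $ u = g u" using u(1) by simp
      moreover have "?w $ u = 0" unfolding eq using u(1) by simp
      ultimately show False using u(2) by simp
    qed
    moreover have "?A *\<^sub>v ?w = k \<cdot>\<^sub>v ?w"
    proof (rule eq_vecI)
      fix v assume "v < dim_vec (k \<cdot>\<^sub>v ?w)"
      then have v: "v < n" by simp
      show "(?A *\<^sub>v ?w) $ v = (k \<cdot>\<^sub>v ?w) $ v"
        using mult[OF v, of ?w] g(2)[OF v] v by simp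
    qed (simp add: dim)
    ultimately show "eigenvalue ?A k"
      unfolding eigenvalue_def eigenvector_def dim by (intro exI[of _ ?w]) simp
  qed
qed

text \<open>\<open>lambda_min\<close> is a \<open>Min\<close> over the eigenvalues, so that set must
  be shown finite, by the characteristic polynomial, and nonempty, by the Rayleigh minimiser. The
  minimiser's value bounds the form from below, hence so does the possibly smaller
  \<open>Min\<close>; attainment follows because the \<open>Min\<close> is itself an
  eigenvalue.\<close>

lemma
  assumes n: "0 < n"
  shows lambda_min_le_quadratic_form:
      "lambda_min (adjacency_matrix n E) * (\<Sum>u<n. (x u)\<^sup>2) \<le> (\<Sum>u<n. \<Sum>v<n. x u * x v * adj E u v)"
    and lambda_min_attained: "\<exists>w. (\<exists>u<n. w u \<noteq> 0) \<and>
      (\<Sum>u<n. \<Sum>v<n. w u * w v * adj E u v) = lambda_min (adjacency_matrix n E) * (\<Sum>u<n. (w u)\<^sup>2)"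
proof -
  let ?A = "adjacency_matrix n E"
  define Q where "Q = (\<lambda>f g :: nat \<Rightarrow> real. \<Sum>u<n. \<Sum>v<n. f u * g v * adj E u v)"
  have sym: "Q f g = Q g f" for f g
    unfolding Q_def by (subst sum.swap) (simp add: adj_sym mult_ac)
  have add: "Q (\<lambda>x. f x + g x) h = Q f h + Q g h" for f g h
    by (simp add: Q_def distrib_right sum.distrib)
  have scale: "Q (\<lambda>x. c * f x) h = c * Q f h" for c f h
    by (simp add: Q_def sum_distrib_left mult_ac)
  have cont: "continuous_on UNIV (\<lambda>f. Q f f)"
    unfolding Q_def by (intro continuous_intros) auto
  have S: "finite {..<n}" "{..<n} \<noteq> {}" using n by auto
  have one: "0 < (1 :: real)" if "x \<in> {..<n}" for x :: nat by simp
  obtain g lam where g: "\<And>x. x \<notin> {..<n} \<Longrightarrow> g x = 0" "\<exists>x\<in>{..<n}. g x \<noteq> 0"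
    "\<And>h. (\<And>x. x \<notin> {..<n} \<Longrightarrow> h x = 0) \<Longrightarrow> Q g h = lam * (\<Sum>x\<in>{..<n}. 1 * (g x * h x))"
    "\<And>f. (\<And>x. x \<notin> {..<n} \<Longrightarrow> f x = 0) \<Longrightarrow> lam * (\<Sum>x\<in>{..<n}. 1 * (f x)\<^sup>2) \<le> Q f f"
  proof (rule rayleigh_minimizer[OF S, of "\<lambda>_. 1" Q, OF one sym add scale cont], assumption)
    fix g lam
    assume "\<And>x. x \<notin> {..<n} \<Longrightarrow> g x = 0" "\<exists>x\<in>{..<n}. g x \<noteq> 0"
      "\<And>h. (\<And>x. x \<notin> {..<n} \<Longrightarrow> h x = 0) \<Longrightarrow> Q g h = lam * (\<Sum>x\<in>{..<n}. 1 * (g x * h x))"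
      "\<And>f. (\<And>x. x \<notin> {..<n} \<Longrightarrow> f x = 0) \<Longrightarrow> lam * (\<Sum>x\<in>{..<n}. 1 * (f x)\<^sup>2) \<le> Q f f"
    from that[OF this] show thesis .
  qed
  \<comment> \<open>Testing the weak equation on the point mass at \<open>v\<close> gives the
    eigenvector equation in coordinate \<open>v\<close>.\<close>
  have "(\<Sum>u<n. adj E v u * g u) = lam * g v" if v: "v < n" for v
  proof -
    let ?h = "\<lambda>u. if u = v then 1 else 0 :: real"
    have "Q g ?h = (\<Sum>u<n. g u * adj E u v)"
    proof -
      have "(\<Sum>w<n. g u * ?h w * adj E u w) = (\<Sum>w<n. if w = v then g u * adj E u v else 0)" for u
        by (intro sum.cong) auto
      then show ?thesis using v by (simp add: Q_def sum.delta)
    qed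
    moreover have "(\<Sum>x<n. 1 * (g x * ?h x)) = (\<Sum>x<n. if x = v then g v else 0)"
      by (intro sum.cong) auto
    moreover have "(\<Sum>u<n. adj E v u * g u) = (\<Sum>u<n. g u * adj E u v)"
      by (simp only: adj_sym[of E v] mult.commute)
    ultimately show ?thesis using g(3)[of ?h] v by (simp add: sum.delta)
  qed
  with g(2) have ev: "eigenvalue ?A lam" by (subst eigenvalue_adjacency_iff) blast
  have A: "?A \<in> carrier_mat n n" by (simp add: adjacency_matrix_def)
  have "char_poly ?A \<noteq> 0" using degree_monic_char_poly[OF A] by auto
  then have fin: "finite {k. eigenvalue ?A k}"
    using poly_roots_finite[of "char_poly ?A"] by (simp add: eigenvalue_root_char_poly[OF A])
  have "lambda_min ?A \<le> lam" unfolding lambda_min_def using fin ev by (intro Min_le) auto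
  moreover have "lam * (\<Sum>u<n. (x u)\<^sup>2) \<le> (\<Sum>u<n. \<Sum>v<n. x u * x v * adj E u v)"
  proof -
    let ?x = "\<lambda>u. if u < n then x u else 0"
    have "Q ?x ?x = (\<Sum>u<n. \<Sum>v<n. x u * x v * adj E u v)"
      unfolding Q_def by (intro sum.cong refl) auto
    moreover have "(\<Sum>u<n. 1 * (?x u)\<^sup>2) = (\<Sum>u<n. (x u)\<^sup>2)" by (intro sum.cong) auto
    ultimately show ?thesis using g(4)[of ?x] by simp
  qed
  ultimately show "lambda_min ?A * (\<Sum>u<n. (x u)\<^sup>2) \<le> (\<Sum>u<n. \<Sum>v<n. x u * x v * adj E u v)"
    by (meson mult_right_mono order_trans sum_nonneg zero_le_power2)
  have "eigenvalue ?A (lambda_min ?A)"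
    using Min_in[OF fin] ev unfolding lambda_min_def by blast
  then obtain w where w: "\<exists>u<n. w u \<noteq> 0" "\<And>v. v < n \<Longrightarrow> (\<Sum>u<n. adj E v u * w u) = lambda_min ?A * w v"
    unfolding eigenvalue_adjacency_iff by blast
  have "(\<Sum>u<n. \<Sum>v<n. w u * w v * adj E u v) = (\<Sum>u<n. w u * (\<Sum>v<n. adj E u v * w v))"
    by (simp add: sum_distrib_left mult_ac)
  also have "\<dots> = (\<Sum>u<n. w u * (lambda_min ?A * w u))" using w(2) by (intro sum.cong) auto
  also have "\<dots> = lambda_min ?A * (\<Sum>u<n. (w u)\<^sup>2)"
    by (simp add: sum_distrib_left power2_eq_square mult_ac)
  finally show "\<exists>w. (\<exists>u<n. w u \<noteq> 0) \<and>
      (\<Sum>u<n. \<Sum>v<n. w u * w v * adj E u v) = lambda_min ?A * (\<Sum>u<n. (w u)\<^sup>2)"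
    using w(1) by blast
qed

text \<open>A single vertex as test vector has form 0 in the absence of a loop. The sign is what
  makes \<delta> at most 1.\<close>

lemma lambda_min_nonpos:
  assumes "0 < n" "{0} \<notin> E"
  shows "lambda_min (adjacency_matrix n E) \<le> 0"
proof -
  let ?x = "\<lambda>u::nat. if u = 0 then 1 else 0 :: real"
  have "(\<Sum>u<n. \<Sum>v<n. ?x u * ?x v * adj E u v) = (\<Sum>u<n. 0)"
    using assms(2) by (intro sum.cong sum.neutral refl) (auto simp: adj_def)
  moreover have "(\<Sum>u<n. (?x u)\<^sup>2) = (\<Sum>u<n. ?x u)" by (intro sum.cong) auto
  moreover have "(\<Sum>u<n. ?x u) = 1" using assms(1) by (simp add: sum.delta)
  ultimately show ?thesis using lambda_min_le_quadratic_form[OF assms(1), of E ?x] by simp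
qed

lemma pseudorandom_lambda_min_ge:
  assumes E: "E \<in> regular_graphs \<Delta> n" and P: "pseudorandom \<Delta> n E" and n: "0 < n"
  shows "- lambda_min (adjacency_matrix n E) \<le> 480 * sqrt \<Delta> * (real \<gamma> + 1) + 8 * real \<Delta> * (1/2) ^ \<gamma>"
proof -
  obtain w where w: "\<exists>u<n. w u \<noteq> 0"
      "(\<Sum>u<n. \<Sum>v<n. w u * w v * adj E u v) = lambda_min (adjacency_matrix n E) * (\<Sum>u<n. (w u)\<^sup>2)"
    using lambda_min_attained[OF n] by blast
  obtain u where u: "u < n" "w u \<noteq> 0" using w(1) by blast
  then have pos: "0 < (\<Sum>u<n. (w u)\<^sup>2)" by (intro sum_pos2[of _ u]) auto
  have "- (480 * sqrt \<Delta> * (real \<gamma> + 1) + 8 * real \<Delta> * (1/2) ^ \<gamma>) * (\<Sum>u<n. (w u)\<^sup>2)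
     \<le> lambda_min (adjacency_matrix n E) * (\<Sum>u<n. (w u)\<^sup>2)"
    using adj_quadratic_form_ge[OF E P, of \<gamma> w] unfolding w(2) .
  from mult_right_le_imp_le[OF this pos] show ?thesis by linarith
qed

section \<open>ULC measures and the birth-death chain\<close>

text \<open>Truncated subtraction leaves \<open>n\<close> unchanged when \<open>n i\<close> is 0;
  the death rate \<open>n i\<close> vanishes there too.\<close>

definition sub_unit :: "('j \<Rightarrow> nat) \<Rightarrow> 'j \<Rightarrow> 'j \<Rightarrow> nat" where
  "sub_unit n i = n(i := n i - 1)"

text \<open>The birth rate for which \<open>p\<close> is reversible when deaths in coordinate i have
  rate \<open>n i\<close>. It equals a(n + e_i)/a(n), the quantity from which the ULC matrix is
  built.\<close>

definition birth :: "('j \<Rightarrow> nat) pmf \<Rightarrow> ('j \<Rightarrow> nat) \<Rightarrow> 'j \<Rightarrow> real" where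
  "birth p n i = real (n i + 1) * pmf p (add_unit n i) / pmf p n"

text \<open>The Dirichlet form of the birth-death chain, with each edge from n to n + e_i counted
  once, from its lower end.\<close>

definition energy :: "'j set \<Rightarrow> ('j \<Rightarrow> nat) pmf \<Rightarrow> (('j \<Rightarrow> nat) \<Rightarrow> real) \<Rightarrow> (('j \<Rightarrow> nat) \<Rightarrow> real) \<Rightarrow> real" where
  "energy J p f g = (\<Sum>n\<in>set_pmf p. pmf p n *
     (\<Sum>i\<in>J. birth p n i * ((f (add_unit n i) - f n) * (g (add_unit n i) - g n))))"

definition death_op :: "'j set \<Rightarrow> (('j \<Rightarrow> nat) \<Rightarrow> real) \<Rightarrow> ('j \<Rightarrow> nat) \<Rightarrow> real" where
  "death_op J f n = (\<Sum>i\<in>J. real (n i) * (f n - f (sub_unit n i)))"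

definition birth_op :: "'j set \<Rightarrow> ('j \<Rightarrow> nat) pmf \<Rightarrow> (('j \<Rightarrow> nat) \<Rightarrow> real) \<Rightarrow> ('j \<Rightarrow> nat) \<Rightarrow> real" where
  "birth_op J p f n = (\<Sum>i\<in>J. birth p n i * (f (add_unit n i) - f n))"

lemma sub_add_unit [simp]: "sub_unit (add_unit n i) i = n"
  by (auto simp: sub_unit_def add_unit_def)

lemma add_sub_unit: "0 < n i \<Longrightarrow> add_unit (sub_unit n i) i = n"
  by (auto simp: sub_unit_def add_unit_def)

lemma sub_unit_le: "sub_unit n i \<le> n" and add_unit_ge: "n \<le> add_unit n i"
  by (auto simp: sub_unit_def add_unit_def le_fun_def)

lemma add_unit_commute: "add_unit (add_unit n i) j = add_unit (add_unit n j) i"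
  by (auto simp: add_unit_def fun_eq_iff)

lemma sub_add_unit_commute: "i \<noteq> j \<Longrightarrow> sub_unit (add_unit n j) i = add_unit (sub_unit n i) j"
  by (auto simp: sub_unit_def add_unit_def fun_eq_iff)

lemma birth_nonneg: "0 \<le> birth p n i"
  by (simp add: birth_def)

lemma birth_eq_0: "add_unit n i \<notin> set_pmf p \<Longrightarrow> birth p n i = 0"
  by (simp add: birth_def pmf_eq_0_set_pmf)

text \<open>Detailed balance, summed: the shift from n to n + e_i trades deaths for births. Downward
  closure keeps n - e_i inside the support.\<close>

lemma birth_shift:
  assumes fin: "finite (set_pmf p)" and dc: "downward_closed (set_pmf p)"
  shows "(\<Sum>n\<in>set_pmf p. pmf p n * (\<Sum>i\<in>J. real (n i) * g n i)) =
    (\<Sum>n\<in>set_pmf p. pmf p n * (\<Sum>i\<in>J. birth p n i * g (add_unit n i) i))"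
proof -
  let ?S = "set_pmf p"
  have one: "(\<Sum>n\<in>?S. pmf p n * (real (n i) * g n i)) = (\<Sum>n\<in>?S. pmf p n * (birth p n i * g (add_unit n i) i))" for i
  proof -
    have "(\<Sum>n\<in>?S. pmf p n * (real (n i) * g n i)) = (\<Sum>n\<in>{n \<in> ?S. 0 < n i}. pmf p n * (real (n i) * g n i))"
      using fin by (intro sum.mono_neutral_right) auto
    also have "\<dots> = (\<Sum>n\<in>{n \<in> ?S. add_unit n i \<in> ?S}. pmf p (add_unit n i) * (real (n i + 1) * g (add_unit n i) i))"
    proof (rule sum.reindex_bij_witness[of _ "\<lambda>n. add_unit n i" "\<lambda>n. sub_unit n i"])
      fix n assume n: "n \<in> {n \<in> ?S. 0 < n i}"
      then show "add_unit (sub_unit n i) i = n" by (simp add: add_sub_unit)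
      show "sub_unit n i \<in> {n \<in> ?S. add_unit n i \<in> ?S}"
        using n dc sub_unit_le[of n i] unfolding downward_closed_def by (auto simp: add_sub_unit)
      show "pmf p (add_unit (sub_unit n i) i) * (real (sub_unit n i i + 1) * g (add_unit (sub_unit n i) i) i) =
         pmf p n * (real (n i) * g n i)"
        using n by (simp add: add_sub_unit) (simp add: sub_unit_def)
    qed (auto simp: add_unit_def sub_unit_def)
    also have "\<dots> = (\<Sum>n\<in>{n \<in> ?S. add_unit n i \<in> ?S}. pmf p n * (birth p n i * g (add_unit n i) i))"
      by (intro sum.cong refl) (auto simp: birth_def set_pmf_iff)
    also have "\<dots> = (\<Sum>n\<in>?S. pmf p n * (birth p n i * g (add_unit n i) i))"
      using fin by (intro sum.mono_neutral_left) (auto simp: birth_eq_0)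
    finally show ?thesis .
  qed
  have "(\<Sum>n\<in>?S. pmf p n * (\<Sum>i\<in>J. real (n i) * g n i)) = (\<Sum>i\<in>J. \<Sum>n\<in>?S. pmf p n * (real (n i) * g n i))"
    unfolding sum_distrib_left by (rule sum.swap)
  also have "\<dots> = (\<Sum>i\<in>J. \<Sum>n\<in>?S. pmf p n * (birth p n i * g (add_unit n i) i))"
    by (simp only: one)
  also have "\<dots> = (\<Sum>n\<in>?S. pmf p n * (\<Sum>i\<in>J. birth p n i * g (add_unit n i) i))"
    unfolding sum_distrib_left by (rule sum.swap)
  finally show ?thesis .
qed

text \<open>\<open>death_op\<close> minus \<open>birth_op\<close> is the negative of the generator,
  so this is summation by parts for the reversible chain.\<close>

lemma energy_by_parts:
  assumes fin: "finite (set_pmf p)" and dc: "downward_closed (set_pmf p)"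
  shows "(\<Sum>n\<in>set_pmf p. pmf p n * (f n * (death_op J g n - birth_op J p g n))) = energy J p f g"
proof -
  let ?S = "set_pmf p"
  have "(\<Sum>n\<in>?S. pmf p n * (f n * death_op J g n)) =
     (\<Sum>n\<in>?S. pmf p n * (\<Sum>i\<in>J. real (n i) * (f n * (g n - g (sub_unit n i)))))"
    unfolding death_op_def sum_distrib_left by (simp only: mult_ac)
  also have "\<dots> = (\<Sum>n\<in>?S. pmf p n * (\<Sum>i\<in>J. birth p n i * (f (add_unit n i) * (g (add_unit n i) - g n))))"
    by (subst birth_shift[OF fin dc]) simp
  finally have D: "(\<Sum>n\<in>?S. pmf p n * (f n * death_op J g n)) = \<dots>" .
  have B: "(\<Sum>n\<in>?S. pmf p n * (f n * birth_op J p g n)) =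
     (\<Sum>n\<in>?S. pmf p n * (\<Sum>i\<in>J. birth p n i * (f n * (g (add_unit n i) - g n))))"
    unfolding birth_op_def sum_distrib_left by (simp only: mult_ac)
  have "(\<Sum>n\<in>?S. pmf p n * (f n * (death_op J g n - birth_op J p g n))) =
    (\<Sum>n\<in>?S. pmf p n * (f n * death_op J g n)) - (\<Sum>n\<in>?S. pmf p n * (f n * birth_op J p g n))"
    by (simp only: right_diff_distrib sum_subtractf)
  also have "\<dots> = energy J p f g"
    unfolding D B energy_def sum_subtractf[symmetric] right_diff_distrib[symmetric]
    by (simp only: left_diff_distrib)
  finally show ?thesis .
qed

lemma ULC_D:
  assumes "ULC \<delta> J p"
  shows "0 < \<delta>" "finite J" "set_pmf p \<subseteq> multi_indices J" "downward_closed (set_pmf p)"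
  using assms unfolding ULC_def by simp_all

lemma ulc_weight_add_unit:
  assumes "finite J" "i \<in> J" "pmf p n \<noteq> 0"
  shows "ulc_weight J p (add_unit n i) = birth p n i * ulc_weight J p n"
proof -
  have "(\<Prod>j\<in>J. fact (add_unit n i j) :: real) = fact (n i + 1) * (\<Prod>j\<in>J - {i}. fact (n j))"
    using assms by (simp add: prod.remove[of J i] add_unit_def)
  also have "\<dots> = real (n i + 1) * (\<Prod>j\<in>J. fact (n j))"
    using assms by (simp add: prod.remove[of J i] algebra_simps)
  finally show ?thesis using assms by (simp add: ulc_weight_def birth_def)
qed

text \<open>Both routes from n to n + e_i + e_j multiply to a(n + e_i + e_j)/a(n). Downward closure
  covers the case in which the intermediate point leaves the support, where both sides are
  0.\<close>

lemma birth_swap: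
  assumes "finite J" "i \<in> J" "j \<in> J" "n \<in> set_pmf p" "downward_closed (set_pmf p)"
  shows "birth p n i * birth p (add_unit n i) j * ulc_weight J p n = ulc_weight J p (add_unit (add_unit n i) j)"
    "birth p n i * birth p (add_unit n i) j = birth p n j * birth p (add_unit n j) i"
proof -
  have pn: "pmf p n \<noteq> 0" using assms by (simp add: set_pmf_iff)
  have dc: "add_unit n i \<in> set_pmf p" if "add_unit (add_unit n i) j \<in> set_pmf p" for i j
    using that assms(5) add_unit_ge[of "add_unit n i" j] unfolding downward_closed_def by blast
  have *: "birth p n i * birth p (add_unit n i) j * ulc_weight J p n = ulc_weight J p (add_unit (add_unit n i) j)"
    if "i \<in> J" "j \<in> J" for i j
  proof (cases "add_unit n i \<in> set_pmf p")
    case True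
    then have "pmf p (add_unit n i) \<noteq> 0" by (simp add: set_pmf_iff)
    with that pn assms(1) show ?thesis by (simp add: ulc_weight_add_unit)
  next
    case False
    then have "add_unit (add_unit n i) j \<notin> set_pmf p" using dc by blast
    with False show ?thesis by (simp add: birth_eq_0 ulc_weight_def pmf_eq_0_set_pmf)
  qed
  show "birth p n i * birth p (add_unit n i) j * ulc_weight J p n = ulc_weight J p (add_unit (add_unit n i) j)"
    using * assms by blast
  have "ulc_weight J p n \<noteq> 0" using pn assms(1) by (simp add: ulc_weight_def)
  moreover have "birth p n i * birth p (add_unit n i) j * ulc_weight J p n = birth p n j * birth p (add_unit n j) i * ulc_weight J p n"
    using *[of i j] *[of j i] assms by (simp add: add_unit_commute)
  ultimately show "birth p n i * birth p (add_unit n i) j = birth p n j * birth p (add_unit n j) i"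
    by simp
qed

text \<open>The matrix inequality of the ULC condition, tested on the vector with entries
  \<open>birth p n i * d i\<close>; outside the index set of that condition the birth rates vanish.\<close>

lemma ULC_quadratic:
  assumes ulc: "ULC \<delta> J p" and n: "n \<in> set_pmf p"
  shows "0 \<le> (\<Sum>i\<in>J. \<Sum>j\<in>J. (birth p n i * birth p n j - birth p n i * birth p (add_unit n i) j) * (d i * d j)) +
     (1 - \<delta>) * (\<Sum>i\<in>J. birth p n i * (d i)\<^sup>2)"
proof -
  let ?a = "ulc_weight J p" and ?b = "birth p n"
  let ?I = "{i \<in> J. add_unit n i \<in> set_pmf p}"
  let ?M = "\<lambda>i j. (1 - ?a n * ?a (add_unit (add_unit n i) j) / (?a (add_unit n i) * ?a (add_unit n j)))
                    + (1 - \<delta>) * (if i = j then ?a n / ?a (add_unit n i) else 0)"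
  have fin: "finite J" and dc: "downward_closed (set_pmf p)" and psd: "psd_on ?I ?M"
    using ulc n unfolding ULC_def Let_def by auto
  have pn: "pmf p n \<noteq> 0" using n by (simp add: set_pmf_iff)
  have an: "?a n \<noteq> 0" using pn fin by (simp add: ulc_weight_def)
  have bI: "?b i \<noteq> 0" if "i \<in> ?I" for i
    using that pn by (auto simp: birth_def set_pmf_iff)
  define x where "x i = ?b i * d i" for i
  have entry: "x i * ?M i j * x j = (?b i * ?b j - ?b i * birth p (add_unit n i) j) * (d i * d j) +
      (1 - \<delta>) * (if i = j then ?b i * (d i)\<^sup>2 else 0)" if ij: "i \<in> ?I" "j \<in> ?I" for i j
  proof -
    have a: "?a (add_unit n i) = ?b i * ?a n" "?a (add_unit n j) = ?b j * ?a n"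
      using ij pn fin by (auto intro: ulc_weight_add_unit)
    have a2: "?a (add_unit (add_unit n i) j) = ?b i * birth p (add_unit n i) j * ?a n"
      using birth_swap(1)[OF fin _ _ n dc, of i j] ij by simp
    have "?a n * ?a (add_unit (add_unit n i) j) / (?a (add_unit n i) * ?a (add_unit n j)) = birth p (add_unit n i) j / ?b j"
      unfolding a a2 using an bI[OF ij(1)] bI[OF ij(2)] by (simp add: field_simps)
    moreover have "?a n / ?a (add_unit n i) = 1 / ?b i" unfolding a using an by simp
    ultimately have M: "?M i j = 1 - birth p (add_unit n i) j / ?b j + (1 - \<delta>) * (if i = j then 1 / ?b i else 0)"
      by (simp only:)
    have "x i * ?M i j * x j = x i * (1 - birth p (add_unit n i) j / ?b j) * x j +
        (1 - \<delta>) * (if i = j then x i * (1 / ?b i) * x j else 0)"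
      unfolding M by (cases "i = j") (simp_all add: algebra_simps)
    also have "x i * (1 - birth p (add_unit n i) j / ?b j) * x j = (?b i * ?b j - ?b i * birth p (add_unit n i) j) * (d i * d j)"
      using bI[OF ij(2)] by (simp add: x_def field_simps)
    also have "(if i = j then x i * (1 / ?b i) * x j else 0) = (if i = j then ?b i * (d i)\<^sup>2 else 0)"
      using bI[OF ij(1)] by (simp add: x_def power2_eq_square)
    finally show ?thesis .
  qed
  have "0 \<le> (\<Sum>i\<in>?I. \<Sum>j\<in>?I. x i * ?M i j * x j)"
    using psd unfolding psd_on_def by blast
  also have "\<dots> = (\<Sum>i\<in>?I. \<Sum>j\<in>?I. (?b i * ?b j - ?b i * birth p (add_unit n i) j) * (d i * d j) +
      (1 - \<delta>) * (if i = j then ?b i * (d i)\<^sup>2 else 0))"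
    by (intro sum.cong refl entry)
  also have "\<dots> = (\<Sum>i\<in>?I. \<Sum>j\<in>?I. (?b i * ?b j - ?b i * birth p (add_unit n i) j) * (d i * d j)) +
      (1 - \<delta>) * (\<Sum>i\<in>?I. \<Sum>j\<in>?I. if i = j then ?b i * (d i)\<^sup>2 else 0)"
    by (simp only: sum.distrib sum_distrib_left)
  also have "(\<Sum>i\<in>?I. \<Sum>j\<in>?I. if i = j then ?b i * (d i)\<^sup>2 else 0) = (\<Sum>i\<in>?I. ?b i * (d i)\<^sup>2)"
    using fin by (intro sum.cong refl) (simp add: sum.delta')
  also have "(\<Sum>i\<in>?I. ?b i * (d i)\<^sup>2) = (\<Sum>i\<in>J. ?b i * (d i)\<^sup>2)"
    using fin by (intro sum.mono_neutral_left) (auto simp: birth_eq_0)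
  \<comment> \<open>Enlarging the range of j requires \<open>birth_swap\<close>: the product of
    successive rates shows the vanishing factor \<open>?b j\<close> only after its two steps are
    exchanged.\<close>
  also have "(\<Sum>i\<in>?I. \<Sum>j\<in>?I. (?b i * ?b j - ?b i * birth p (add_unit n i) j) * (d i * d j)) =
     (\<Sum>i\<in>?I. \<Sum>j\<in>J. (?b i * ?b j - ?b i * birth p (add_unit n i) j) * (d i * d j))"
  proof (rule sum.cong[OF refl])
    fix i assume i: "i \<in> ?I"
    show "(\<Sum>j\<in>?I. (?b i * ?b j - ?b i * birth p (add_unit n i) j) * (d i * d j)) =
       (\<Sum>j\<in>J. (?b i * ?b j - ?b i * birth p (add_unit n i) j) * (d i * d j))"
    proof (rule sum.mono_neutral_left)
      show "\<forall>j\<in>J - ?I. (?b i * ?b j - ?b i * birth p (add_unit n i) j) * (d i * d j) = 0"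
      proof
        fix j assume j: "j \<in> J - ?I"
        have "?b i * birth p (add_unit n i) j = ?b j * birth p (add_unit n j) i"
          using i j by (intro birth_swap(2)[OF fin _ _ n dc]) auto
        moreover have "?b j = 0" using j by (auto simp: birth_eq_0)
        ultimately show "(?b i * ?b j - ?b i * birth p (add_unit n i) j) * (d i * d j) = 0" by simp
      qed
    qed (use fin in auto)
  qed
  also have "\<dots> = (\<Sum>i\<in>J. \<Sum>j\<in>J. (?b i * ?b j - ?b i * birth p (add_unit n i) j) * (d i * d j))"
    using fin by (intro sum.mono_neutral_left) (auto simp: birth_eq_0)
  finally show ?thesis .
qed

text \<open>A Bochner-type identity for the birth-death chain whose deaths have rate \<open>n i\<close>: the square of its
  generator is the energy plus a nonnegative sum of second differences plus the quadratic form of the ULC condition.\<close>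

lemma ULC_bochner:
  assumes ulc: "ULC \<delta> J p" and fin: "finite (set_pmf p)"
  shows "\<delta> * energy J p f f \<le> (\<Sum>n\<in>set_pmf p. pmf p n * (death_op J f n - birth_op J p f n)\<^sup>2)"
proof -
  let ?S = "set_pmf p"
  let ?D = "death_op J f" and ?B = "birth_op J p f"
  let ?f = "\<lambda>n i. f (add_unit n i)" and ?b = "birth p"
  let ?c = "\<lambda>n i j. birth p n i * birth p (add_unit n i) j"
  let ?ff = "\<lambda>n i j. f (add_unit (add_unit n i) j)"
  have finJ: "finite J" and dc: "downward_closed ?S" using ULC_D[OF ulc] by auto
  have DD: "(\<Sum>n\<in>?S. pmf p n * (?D n * ?D n)) = energy J p f f +
     (\<Sum>n\<in>?S. pmf p n * (\<Sum>i\<in>J. \<Sum>j\<in>J. ?c n i j * ((?ff n i j - ?f n i) * (?ff n i j - ?f n j))))"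
  proof -
    \<comment> \<open>At n + e_j the death rate in coordinate j is \<open>n j + 1\<close>; the extra
      unit splits off, and it is the source of the energy term in the identity.\<close>
    have Dadd: "?D (add_unit n j) = (?f n j - f n) + (\<Sum>i\<in>J. real (n i) * (?f n j - f (add_unit (sub_unit n i) j)))"
      if "j \<in> J" for n j
    proof -
      have "real (add_unit n j i) * (?f n j - f (sub_unit (add_unit n j) i)) =
         (if i = j then ?f n j - f n else 0) + real (n i) * (?f n j - f (add_unit (sub_unit n i) j))" for i
      proof (cases "i = j")
        case True
        then show ?thesis
          by (cases "n j = 0") (auto simp: add_sub_unit, simp_all add: add_unit_def algebra_simps)
      next
        case False
        then show ?thesis by (simp add: sub_add_unit_commute) (simp add: add_unit_def)
      qed
      then show ?thesis using that finJ by (simp add: death_op_def sum.distrib sum.delta)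
    qed
    have "(\<Sum>n\<in>?S. pmf p n * (?D n * ?D n)) =
       (\<Sum>n\<in>?S. pmf p n * (\<Sum>j\<in>J. real (n j) * ((f n - f (sub_unit n j)) * ?D n)))"
      unfolding death_op_def[of J f] sum_distrib_right by (simp only: mult.assoc)
    also have "\<dots> = (\<Sum>n\<in>?S. pmf p n * (\<Sum>j\<in>J. ?b n j * ((?f n j - f n) * ?D (add_unit n j))))"
      by (subst birth_shift[OF fin dc]) simp
    also have "\<dots> = (\<Sum>n\<in>?S. pmf p n * (\<Sum>j\<in>J. ?b n j * ((?f n j - f n) * (?f n j - f n)) +
        (\<Sum>i\<in>J. real (n i) * (?b n j * ((?f n j - f n) * (?f n j - f (add_unit (sub_unit n i) j)))))))"
    proof (intro sum.cong refl arg_cong2[where f = "(*)"])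
      fix n j assume "j \<in> J"
      then show "?b n j * ((?f n j - f n) * ?D (add_unit n j)) = ?b n j * ((?f n j - f n) * (?f n j - f n)) +
        (\<Sum>i\<in>J. real (n i) * (?b n j * ((?f n j - f n) * (?f n j - f (add_unit (sub_unit n i) j)))))"
        by (simp only: Dadd distrib_left sum_distrib_left mult_ac)
    qed
    also have "\<dots> = energy J p f f + (\<Sum>n\<in>?S. pmf p n * (\<Sum>j\<in>J. \<Sum>i\<in>J. real (n i) *
       (?b n j * ((?f n j - f n) * (?f n j - f (add_unit (sub_unit n i) j))))))"
      by (simp only: energy_def sum.distrib distrib_left)
    also have "(\<Sum>n\<in>?S. pmf p n * (\<Sum>j\<in>J. \<Sum>i\<in>J. real (n i) *
       (?b n j * ((?f n j - f n) * (?f n j - f (add_unit (sub_unit n i) j)))))) =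
       (\<Sum>n\<in>?S. pmf p n * (\<Sum>i\<in>J. real (n i) * (\<Sum>j\<in>J.
       (?b n j * ((?f n j - f n) * (?f n j - f (add_unit (sub_unit n i) j)))))))"
      unfolding sum_distrib_left[of "real _"] by (intro sum.cong refl arg_cong2[where f = "(*)"] sum.swap)
    also have "\<dots> = (\<Sum>n\<in>?S. pmf p n * (\<Sum>i\<in>J. ?b n i * (\<Sum>j\<in>J.
       (?b (add_unit n i) j * ((?ff n i j - ?f n i) * (?ff n i j - ?f n j))))))"
      by (subst birth_shift[OF fin dc]) simp
    also have "\<dots> = (\<Sum>n\<in>?S. pmf p n * (\<Sum>i\<in>J. \<Sum>j\<in>J. ?c n i j * ((?ff n i j - ?f n i) * (?ff n i j - ?f n j))))"
      unfolding sum_distrib_left[of "birth _ _ _"] by (simp only: mult.assoc)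
    finally show ?thesis .
  qed
  have BD: "(\<Sum>n\<in>?S. pmf p n * (?B n * ?D n)) =
     (\<Sum>n\<in>?S. pmf p n * (\<Sum>i\<in>J. \<Sum>j\<in>J. ?c n i j * ((?f n i - f n) * (?ff n i j - ?f n i))))"
  proof -
    have "(\<Sum>n\<in>?S. pmf p n * (?B n * ?D n)) =
       (\<Sum>n\<in>?S. pmf p n * (\<Sum>i\<in>J. real (n i) * ((f n - f (sub_unit n i)) * ?B n)))"
      unfolding death_op_def[of J f] sum_distrib_left[of "birth_op _ _ _ _"] by (simp only: mult_ac)
    also have "\<dots> = (\<Sum>n\<in>?S. pmf p n * (\<Sum>i\<in>J. ?b n i * ((?f n i - f n) * ?B (add_unit n i))))"
      by (subst birth_shift[OF fin dc]) simp
    also have "\<dots> = (\<Sum>n\<in>?S. pmf p n * (\<Sum>i\<in>J. \<Sum>j\<in>J. ?c n i j * ((?f n i - f n) * (?ff n i j - ?f n i))))"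
      unfolding birth_op_def[of J p f "add_unit _ _"] sum_distrib_left[of "birth _ _ _"] sum_distrib_left[of "_ - _"]
      by (simp only: mult_ac)
    finally show ?thesis .
  qed
  \<comment> \<open>The cross term with i and j exchanged. Subtracting one copy of each version is
    what lets the square of the mixed second difference be completed.\<close>
  have BD': "(\<Sum>n\<in>?S. pmf p n * (?B n * ?D n)) =
     (\<Sum>n\<in>?S. pmf p n * (\<Sum>i\<in>J. \<Sum>j\<in>J. ?c n i j * ((?f n j - f n) * (?ff n i j - ?f n j))))"
  proof -
    have "(\<Sum>i\<in>J. \<Sum>j\<in>J. ?c n i j * ((?f n i - f n) * (?ff n i j - ?f n i))) =
       (\<Sum>i\<in>J. \<Sum>j\<in>J. ?c n i j * ((?f n j - f n) * (?ff n i j - ?f n j)))" if "n \<in> ?S" for n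
    proof -
      have "(\<Sum>i\<in>J. \<Sum>j\<in>J. ?c n i j * ((?f n i - f n) * (?ff n i j - ?f n i))) =
         (\<Sum>j\<in>J. \<Sum>i\<in>J. ?c n i j * ((?f n i - f n) * (?ff n i j - ?f n i)))"
        by (rule sum.swap)
      also have "\<dots> = (\<Sum>i\<in>J. \<Sum>j\<in>J. ?c n i j * ((?f n j - f n) * (?ff n i j - ?f n j)))"
      proof (intro sum.cong refl)
        fix i j assume "i \<in> J" "j \<in> J"
        then show "?c n j i * ((?f n j - f n) * (?ff n j i - ?f n j)) = ?c n i j * ((?f n j - f n) * (?ff n i j - ?f n j))"
          using birth_swap(2)[OF finJ _ _ that dc, of j i] by (simp add: add_unit_commute)
      qed
      finally show ?thesis .
    qed
    then show ?thesis unfolding BD by (intro sum.cong) auto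
  qed
  have BB: "(\<Sum>n\<in>?S. pmf p n * (?B n * ?B n)) =
     (\<Sum>n\<in>?S. pmf p n * (\<Sum>i\<in>J. \<Sum>j\<in>J. ?b n i * ?b n j * ((?f n i - f n) * (?f n j - f n))))"
    unfolding birth_op_def sum_product by (simp only: mult_ac)
  have "(\<Sum>n\<in>?S. pmf p n * (?D n - ?B n)\<^sup>2) =
     (\<Sum>n\<in>?S. pmf p n * (?D n * ?D n)) - (\<Sum>n\<in>?S. pmf p n * (?B n * ?D n)) - (\<Sum>n\<in>?S. pmf p n * (?B n * ?D n))
       + (\<Sum>n\<in>?S. pmf p n * (?B n * ?B n))"
    unfolding sum_subtractf[symmetric] sum.distrib[symmetric]
    by (intro sum.cong refl) (simp add: power2_eq_square algebra_simps)
  also have "\<dots> = energy J p f f + (\<Sum>n\<in>?S. pmf p n * (\<Sum>i\<in>J. \<Sum>j\<in>J.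
      (?b n i * ?b n j - ?c n i j) * ((?f n i - f n) * (?f n j - f n)) + ?c n i j * (?ff n i j - ?f n i - ?f n j + f n)\<^sup>2))"
  proof -
    \<comment> \<open>With X = f_ij - f_i, Y = f_ij - f_j, P = f_i - f and R = f_j - f, where X - R
      = Y - P is the second difference, this is X Y - P X - R Y = (X - R)^2 - P R.\<close>
    have "(\<Sum>n\<in>?S. pmf p n * (\<Sum>i\<in>J. \<Sum>j\<in>J. ?c n i j * ((?ff n i j - ?f n i) * (?ff n i j - ?f n j))))
      - (\<Sum>n\<in>?S. pmf p n * (\<Sum>i\<in>J. \<Sum>j\<in>J. ?c n i j * ((?f n i - f n) * (?ff n i j - ?f n i))))
      - (\<Sum>n\<in>?S. pmf p n * (\<Sum>i\<in>J. \<Sum>j\<in>J. ?c n i j * ((?f n j - f n) * (?ff n i j - ?f n j))))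
      + (\<Sum>n\<in>?S. pmf p n * (\<Sum>i\<in>J. \<Sum>j\<in>J. ?b n i * ?b n j * ((?f n i - f n) * (?f n j - f n))))
      = (\<Sum>n\<in>?S. pmf p n * (\<Sum>i\<in>J. \<Sum>j\<in>J.
      (?b n i * ?b n j - ?c n i j) * ((?f n i - f n) * (?f n j - f n)) + ?c n i j * (?ff n i j - ?f n i - ?f n j + f n)\<^sup>2))"
      unfolding sum_subtractf[symmetric] sum.distrib[symmetric] right_diff_distrib[of "pmf _ _", symmetric]
        distrib_left[of "pmf _ _", symmetric]
      by (intro sum.cong refl arg_cong2[where f = "(*)"]) (simp add: power2_eq_square algebra_simps)
    then show ?thesis using DD BD BD' BB by linarith
  qed
  also have "\<dots> \<ge> energy J p f f + (\<Sum>n\<in>?S. pmf p n * (- (1 - \<delta>) * (\<Sum>i\<in>J. ?b n i * (?f n i - f n)\<^sup>2)))"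
  proof (intro add_left_mono sum_mono mult_left_mono)
    fix n assume n: "n \<in> ?S"
    have "- (1 - \<delta>) * (\<Sum>i\<in>J. ?b n i * (?f n i - f n)\<^sup>2) \<le>
       (\<Sum>i\<in>J. \<Sum>j\<in>J. (?b n i * ?b n j - ?c n i j) * ((?f n i - f n) * (?f n j - f n)))"
      using ULC_quadratic[OF ulc n, of "\<lambda>i. ?f n i - f n"] unfolding mult_minus_left by linarith
    also have "\<dots> \<le> (\<Sum>i\<in>J. \<Sum>j\<in>J. (?b n i * ?b n j - ?c n i j) * ((?f n i - f n) * (?f n j - f n)) +
        ?c n i j * (?ff n i j - ?f n i - ?f n j + f n)\<^sup>2)"
      by (intro sum_mono) (simp add: birth_nonneg)
    finally show "- (1 - \<delta>) * (\<Sum>i\<in>J. ?b n i * (?f n i - f n)\<^sup>2) \<le> \<dots>" .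
  qed auto
  also have "energy J p f f + (\<Sum>n\<in>?S. pmf p n * (- (1 - \<delta>) * (\<Sum>i\<in>J. ?b n i * (?f n i - f n)\<^sup>2))) =
     energy J p f f + - (1 - \<delta>) * energy J p f f"
  proof -
    define X where "X n = (\<Sum>i\<in>J. ?b n i * (?f n i - f n)\<^sup>2)" for n
    have "energy J p f f = (\<Sum>n\<in>?S. pmf p n * X n)"
      by (simp only: energy_def X_def power2_eq_square)
    then show ?thesis
      unfolding X_def[symmetric] by (simp only: sum_distrib_left mult.left_commute)
  qed
  also have "\<dots> = \<delta> * energy J p f f" by (simp add: algebra_simps)
  finally show ?thesis .
qed

section \<open>The Poincare inequality for ULC measures\<close>

lemma energy_sym: "energy J p f g = energy J p g f"
  unfolding energy_def by (simp only: mult.commute)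

lemma energy_term_nonneg: "0 \<le> birth p n i * (d * d)"
  by (simp add: birth_nonneg)

lemma energy_nonneg: "0 \<le> energy J p f f"
  unfolding energy_def by (intro sum_nonneg mult_nonneg_nonneg[OF pmf_nonneg] energy_term_nonneg)

lemma energy_cong:
  assumes "\<And>n. n \<in> set_pmf p \<Longrightarrow> f n = f' n" "\<And>n. n \<in> set_pmf p \<Longrightarrow> g n = g' n"
  shows "energy J p f g = energy J p f' g'"
proof -
  have "birth p n i * ((f (add_unit n i) - f n) * (g (add_unit n i) - g n)) =
        birth p n i * ((f' (add_unit n i) - f' n) * (g' (add_unit n i) - g' n))" if "n \<in> set_pmf p" for n i
    using assms that by (cases "add_unit n i \<in> set_pmf p") (simp_all add: birth_eq_0)
  then show ?thesis
    unfolding energy_def by (intro sum.cong refl arg_cong[where f = "(*) (pmf p x)" for x]) auto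
qed

text \<open>The chain is connected: by downward closure every point of the support descends to the
  zero index one unit at a time inside the support, and vanishing energy forbids any change along
  such a step.\<close>

lemma energy_0_imp_const:
  assumes finJ: "finite J" and fin: "finite (set_pmf p)" and sub: "set_pmf p \<subseteq> multi_indices J"
    and dc: "downward_closed (set_pmf p)" and 0: "energy J p f f = 0" and n: "n \<in> set_pmf p"
  shows "f n = f (\<lambda>_. 0)"
  using n
proof (induction "\<Sum>i\<in>J. n i" arbitrary: n)
  case 0
  then have "n = (\<lambda>_. 0)" using finJ sub by (auto simp: multi_indices_def)
  then show ?case by simp
next
  case (Suc k)
  obtain i where i: "i \<in> J" "0 < n i"
  proof -
    have "\<exists>i\<in>J. 0 < n i"
    proof (rule ccontr)
      assume "\<not> ?thesis"
      then have "(\<Sum>i\<in>J. n i) = 0" by (intro sum.neutral) auto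
      with Suc show False by simp
    qed
    then show thesis using that by blast
  qed
  let ?m = "sub_unit n i"
  have m: "?m \<in> set_pmf p" using dc Suc.prems sub_unit_le[of n i] unfolding downward_closed_def by blast
  have n: "add_unit ?m i = n" using i by (simp add: add_sub_unit)
  have "(\<Sum>j\<in>J. n j) = (\<Sum>j\<in>J. ?m j) + 1"
    using finJ i by (simp add: sum.remove[of J i] sub_unit_def)
  then have IH: "f ?m = f (\<lambda>_. 0)" using Suc m by auto
  have "pmf p ?m * (\<Sum>i\<in>J. birth p ?m i * ((f (add_unit ?m i) - f ?m) * (f (add_unit ?m i) - f ?m))) = 0"
    using 0 m fin unfolding energy_def
    by (subst (asm) sum_nonneg_eq_0_iff)
       (auto intro!: sum_nonneg mult_nonneg_nonneg[OF pmf_nonneg] energy_term_nonneg)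
  then have "(\<Sum>i\<in>J. birth p ?m i * ((f (add_unit ?m i) - f ?m) * (f (add_unit ?m i) - f ?m))) = 0"
    using m by (simp add: set_pmf_iff)
  then have "birth p ?m i * ((f (add_unit ?m i) - f ?m) * (f (add_unit ?m i) - f ?m)) = 0"
    using i finJ by (subst (asm) sum_nonneg_eq_0_iff) (auto intro!: energy_term_nonneg)
  moreover have "birth p ?m i \<noteq> 0"
    using m Suc.prems n by (auto simp: birth_def set_pmf_iff)
  ultimately show ?case using n IH by simp
qed

text \<open>The gap is read off from a minimiser \<open>g\<close> of \<open>energy f f + \<delta> (mean f)\<^sup>2\<close>, which is an eigenfunction of the
  generator if its mean vanishes.\<close>

lemma ULC_poincare:
  assumes ulc: "ULC \<delta> J p" and fin: "finite (set_pmf p)" and mean: "(\<Sum>n\<in>set_pmf p. pmf p n * f n) = 0"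
  shows "\<delta> * (\<Sum>n\<in>set_pmf p. pmf p n * (f n)\<^sup>2) \<le> energy J p f f"
proof -
  let ?S = "set_pmf p"
  let ?A = "\<lambda>f n. death_op J f n - birth_op J p f n"
  have d0: "0 < \<delta>" and finJ: "finite J" and sub: "?S \<subseteq> multi_indices J" and dc: "downward_closed ?S"
    using ULC_D[OF ulc] by auto
  define m where "m = (\<lambda>f. \<Sum>n\<in>?S. pmf p n * f n)"
  define Q where "Q = (\<lambda>f g. energy J p f g + \<delta> * (m f * m g))"
  have sym: "Q f g = Q g f" for f g
    unfolding Q_def energy_sym[of J p f g] by simp
  have add: "Q (\<lambda>x. f x + g x) h = Q f h + Q g h" for f g h
  proof -
    have "energy J p (\<lambda>x. f x + g x) h = energy J p f h + energy J p g h"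
      unfolding energy_def sum.distrib[symmetric] distrib_left[symmetric]
      by (intro sum.cong refl arg_cong2[where f = "(*)"]) (simp add: algebra_simps)
    moreover have "m (\<lambda>x. f x + g x) = m f + m g"
      by (simp add: m_def distrib_left sum.distrib)
    ultimately show ?thesis by (simp add: Q_def algebra_simps)
  qed
  have scale: "Q (\<lambda>x. c * f x) h = c * Q f h" for c f h
  proof -
    have "energy J p (\<lambda>x. c * f x) h = c * energy J p f h"
      unfolding energy_def sum_distrib_left by (intro sum.cong refl) (simp add: algebra_simps)
    moreover have "m (\<lambda>x. c * f x) = c * m f"
      unfolding m_def sum_distrib_left by (simp only: mult.left_commute)
    ultimately show ?thesis by (simp add: Q_def algebra_simps)
  qed
  have cont: "continuous_on UNIV (\<lambda>f. Q f f)"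
    unfolding Q_def energy_def m_def by (intro continuous_intros) auto
  have mu: "0 < pmf p n" if "n \<in> ?S" for n using that by (simp add: pmf_positive)
  obtain g lam where g: "\<And>n. n \<notin> ?S \<Longrightarrow> g n = 0" "\<exists>n\<in>?S. g n \<noteq> 0"
    "\<And>h. (\<And>n. n \<notin> ?S \<Longrightarrow> h n = 0) \<Longrightarrow> Q g h = lam * (\<Sum>n\<in>?S. pmf p n * (g n * h n))"
    "\<And>f. (\<And>n. n \<notin> ?S \<Longrightarrow> f n = 0) \<Longrightarrow> lam * (\<Sum>n\<in>?S. pmf p n * (f n)\<^sup>2) \<le> Q f f"
  proof (rule rayleigh_minimizer[of ?S "pmf p" Q, OF fin set_pmf_not_empty mu sym add scale cont], assumption)
    fix g lam
    assume "\<And>n. n \<notin> ?S \<Longrightarrow> g n = 0" "\<exists>n\<in>?S. g n \<noteq> 0"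
      "\<And>h. (\<And>n. n \<notin> ?S \<Longrightarrow> h n = 0) \<Longrightarrow> Q g h = lam * (\<Sum>n\<in>?S. pmf p n * (g n * h n))"
      "\<And>f. (\<And>n. n \<notin> ?S \<Longrightarrow> f n = 0) \<Longrightarrow> lam * (\<Sum>n\<in>?S. pmf p n * (f n)\<^sup>2) \<le> Q f f"
    from that[OF this] show thesis .
  qed
  have "\<delta> \<le> lam"
  proof (cases "m g = 0")
    case False
    \<comment> \<open>Constants have no energy, so testing against 1 leaves \<delta> times the mean
      on one side and \<open>lam\<close> times the mean on the other: the penalty places constants
      exactly at level \<delta>.\<close>
    let ?h = "\<lambda>n. if n \<in> ?S then 1 else 0 :: real"
    have m1: "m ?h = 1" using sum_pmf_eq_1[OF fin] by (simp add: m_def)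
    have "energy J p g ?h = energy J p g (\<lambda>_. 1)" by (intro energy_cong) auto
    then have "energy J p g ?h = 0" by (simp add: energy_def)
    moreover have "(\<Sum>n\<in>?S. pmf p n * (g n * ?h n)) = m g" by (simp add: m_def)
    ultimately have "\<delta> * m g = lam * m g" using g(3)[of ?h] m1 by (simp add: Q_def)
    with False show ?thesis by simp
  next
    case True
    let ?N = "\<Sum>n\<in>?S. pmf p n * (g n)\<^sup>2"
    define h where "h n = (if n \<in> ?S then ?A g n - lam * g n else 0)" for n
    have N: "0 < ?N"
    proof -
      obtain n where "n \<in> ?S" "g n \<noteq> 0" using g(2) by blast
      then show ?thesis using fin mu by (intro sum_pos2[of _ n]) (auto intro!: mult_nonneg_nonneg)
    qed
    have "energy J p g h = energy J p h g" by (rule energy_sym)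
    also have "\<dots> = (\<Sum>n\<in>?S. pmf p n * (h n * ?A g n))"
      by (rule energy_by_parts[OF fin dc, symmetric])
    finally have hA: "(\<Sum>n\<in>?S. pmf p n * (h n * ?A g n)) = lam * (\<Sum>n\<in>?S. pmf p n * (g n * h n))"
      using g(3)[of h] True by (simp add: Q_def h_def)
    have "(\<Sum>n\<in>?S. pmf p n * (h n)\<^sup>2) = 0"
    proof -
      have "(\<Sum>n\<in>?S. pmf p n * (h n)\<^sup>2) = (\<Sum>n\<in>?S. pmf p n * (h n * ?A g n) - lam * (pmf p n * (g n * h n)))"
        by (intro sum.cong refl) (simp add: h_def power2_eq_square algebra_simps)
      then show ?thesis
        using hA by (simp add: sum_subtractf sum_distrib_left)
    qed
    then have "\<forall>n\<in>?S. pmf p n * (h n)\<^sup>2 = 0"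
      using fin by (subst sum_nonneg_eq_0_iff[symmetric]) (auto intro: mult_nonneg_nonneg)
    then have Ag: "?A g n = lam * g n" if "n \<in> ?S" for n
      using that mu[OF that] by (auto simp: h_def set_pmf_iff)
    have "energy J p g g = lam * ?N"
      using g(3)[of g] g(1) True by (simp add: Q_def power2_eq_square)
    moreover have "(\<Sum>n\<in>?S. pmf p n * (?A g n)\<^sup>2) = lam\<^sup>2 * ?N"
      unfolding sum_distrib_left by (intro sum.cong refl) (simp add: Ag power_mult_distrib)
    \<comment> \<open>For an eigenfunction the Bochner inequality reads \<delta> lam \<le> lam^2, up
      to the norm; it yields the gap once \<open>lam\<close> is known to be positive.\<close>
    ultimately have ineq: "\<delta> * lam * ?N \<le> lam\<^sup>2 * ?N" and nn: "0 \<le> lam * ?N"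
      using ULC_bochner[OF ulc fin, of g] energy_nonneg[of J p g] by (simp_all add: mult.assoc)
    \<comment> \<open>At level 0 the minimiser would be constant by connectivity and then zero
      because its mean vanishes.\<close>
    have "lam \<noteq> 0"
    proof
      assume "lam = 0"
      then have "energy J p g g = 0" using \<open>energy J p g g = lam * ?N\<close> by simp
      then have c: "g n = g (\<lambda>_. 0)" if "n \<in> ?S" for n
        using energy_0_imp_const[OF finJ fin sub dc _ that] by blast
      have "m g = (\<Sum>n\<in>?S. pmf p n) * g (\<lambda>_. 0)"
        unfolding m_def sum_distrib_right by (intro sum.cong refl) (simp add: c)
      then have "g (\<lambda>_. 0) = 0" using True sum_pmf_eq_1[OF fin] by simp
      with c g(2) show False by auto
    qed
    then have "0 < lam" using nn N by (simp add: zero_le_mult_iff)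
    with ineq N show ?thesis by (simp add: power2_eq_square)
  qed
  let ?f = "\<lambda>n. if n \<in> ?S then f n else 0"
  have "\<delta> * (\<Sum>n\<in>?S. pmf p n * (f n)\<^sup>2) \<le> lam * (\<Sum>n\<in>?S. pmf p n * (f n)\<^sup>2)"
    using \<open>\<delta> \<le> lam\<close> by (intro mult_right_mono sum_nonneg) auto
  also have "\<dots> \<le> Q ?f ?f" using g(4)[of ?f] by simp
  also have "\<dots> = energy J p ?f ?f" using mean by (simp add: Q_def m_def)
  also have "\<dots> = energy J p f f" by (intro energy_cong) auto
  finally show ?thesis .
qed

section \<open>The embedded Potts measure is ULC\<close>

locale potts_model =
  fixes q :: nat and V :: "'v set" and E :: "'v set set" and B :: real
  assumes finV: "finite V" and edges: "E \<subseteq> {e. e \<subseteq> V \<and> card e = 2}" and q2: "2 \<le> q" and B0: "0 < B" and B1: "B < 1"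
begin

abbreviation p :: "('v \<Rightarrow> nat) pmf" where "p \<equiv> potts q V E B"
abbreviation \<Omega> :: "('v \<Rightarrow> nat) set" where "\<Omega> \<equiv> configs q V"
abbreviation deg :: "('v \<Rightarrow> nat) \<Rightarrow> 'v \<Rightarrow> nat \<Rightarrow> nat" where "deg \<equiv> colour_degree V E"

lemma q1: "1 \<le> q" using q2 by simp

lemma loopless: "{v} \<notin> E" using edges by auto

lemma pmf_pos: "\<sigma> \<in> \<Omega> \<Longrightarrow> 0 < pmf p \<sigma>"
  using finite_configs[OF finV, of q] configs_nonempty[OF q1, of V] B0
  by (auto simp: pmf_potts[OF finV q1 B0] intro!: divide_pos_pos sum_pos)

lemma set_pmf_potts: "set_pmf p = \<Omega>"
proof
  show "set_pmf p \<subseteq> \<Omega>" by (auto simp: set_pmf_iff pmf_potts[OF finV q1 B0] split: if_splits)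
  show "\<Omega> \<subseteq> set_pmf p" using pmf_pos by (force simp: set_pmf_iff)
qed

lemma configs_range: "\<sigma> \<in> \<Omega> \<Longrightarrow> v \<in> V \<Longrightarrow> \<sigma> v \<in> {1..q}"
  by (auto simp: configs_def PiE_iff)

text \<open>Recolouring v changes only the edges at v, so the ratio of the two probabilities is a
  power of B; it is stated without division.\<close>

lemma update_ratio:
  assumes \<sigma>: "\<sigma> \<in> \<Omega>" and v: "v \<in> V" and c: "c \<in> {1..q}" "c' \<in> {1..q}"
  shows "pmf p (\<sigma>(v := c)) * B ^ deg \<sigma> v c' = pmf p (\<sigma>(v := c')) * B ^ deg \<sigma> v c"
proof -
  have R: "{{u, w} | u w. {u, w} \<in> E \<and> (\<sigma>(v := c)) u = (\<sigma>(v := c)) w \<and> v \<noteq> u \<and> v \<noteq> w} =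
      {{u, w} | u w. {u, w} \<in> E \<and> \<sigma> u = \<sigma> w \<and> v \<noteq> u \<and> v \<noteq> w}" for c
    by auto
  have split: "mono_edges E (\<sigma>(v := c)) =
      card {{u, w} | u w. {u, w} \<in> E \<and> \<sigma> u = \<sigma> w \<and> v \<noteq> u \<and> v \<noteq> w} + deg \<sigma> v c" for c
    unfolding mono_edges_split[OF finV edges, of "\<sigma>(v := c)" v] R colour_degree_upd[OF loopless] by simp
  show ?thesis
    using configs_upd[OF \<sigma> v c(1)] configs_upd[OF \<sigma> v c(2)]
    by (simp add: pmf_potts[OF finV q1 B0] split power_add)
qed

text \<open>The contribution of w is added on both sides to avoid truncated subtraction.\<close>

lemma deg_upd_other:
  assumes "w \<in> V" "v \<noteq> w"
  shows "deg (\<sigma>(w := l)) v c + of_bool ({v, w} \<in> E \<and> \<sigma> w = c) = deg \<sigma> v c + of_bool ({v, w} \<in> E \<and> l = c)"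
proof -
  have *: "deg \<tau> v c = card {u \<in> V - {w}. {v, u} \<in> E \<and> \<tau> u = c} + of_bool ({v, w} \<in> E \<and> \<tau> w = c)" for \<tau> :: "'v \<Rightarrow> nat"
  proof -
    have "{u \<in> V. {v, u} \<in> E \<and> \<tau> u = c} = {u \<in> V - {w}. {v, u} \<in> E \<and> \<tau> u = c} \<union>
        (if {v, w} \<in> E \<and> \<tau> w = c then {w} else {})" using assms by auto
    then show ?thesis using finV by (auto simp: colour_degree_def)
  qed
  have "{u \<in> V - {w}. {v, u} \<in> E \<and> (\<sigma>(w := l)) u = c} = {u \<in> V - {w}. {v, u} \<in> E \<and> \<sigma> u = c}" by auto
  then show ?thesis by (simp add: *)
qed

text \<open>In this cross ratio every edge cancels except v w. That edge is monochromatic before the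
  updates, after both of them only if k = l, and after exactly one of them never; hence the exponent
  1 or 2.\<close>

lemma two_updates:
  assumes \<sigma>: "\<sigma> \<in> \<Omega>" and v: "v \<in> V" "w \<in> V" "v \<noteq> w" and sq: "\<sigma> v = q" "\<sigma> w = q"
    and k: "k \<in> {1..q - 1}" "l \<in> {1..q - 1}"
  shows "pmf p \<sigma> * pmf p (\<sigma>(v := k, w := l)) =
    B ^ (if {v, w} \<in> E then (if k = l then 2 else 1) else 0) * (pmf p (\<sigma>(v := k)) * pmf p (\<sigma>(w := l)))"
proof -
  let ?\<tau> = "\<sigma>(w := l)"
  have rng: "k \<in> {1..q}" "l \<in> {1..q}" "q \<in> {1..q}" using k q1 by auto
  have kq: "k \<noteq> q" "l \<noteq> q" using k q1 by auto
  have \<tau>: "?\<tau> \<in> \<Omega>" using configs_upd[OF \<sigma> v(2) rng(2)] .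
  have sv: "\<sigma>(v := q) = \<sigma>" "?\<tau>(v := q) = ?\<tau>" using sq v by auto
  have tw: "\<sigma>(v := k, w := l) = ?\<tau>(v := k)" using v by (simp add: fun_upd_twist)
  have r1: "pmf p (\<sigma>(v := k)) * B ^ deg \<sigma> v q = pmf p \<sigma> * B ^ deg \<sigma> v k"
    using update_ratio[OF \<sigma> v(1) rng(1,3)] by (simp add: sv)
  have r2: "pmf p (?\<tau>(v := k)) * B ^ deg ?\<tau> v q = pmf p ?\<tau> * B ^ deg ?\<tau> v k"
    using update_ratio[OF \<tau> v(1) rng(1,3)] unfolding sv .
  have dq: "deg \<sigma> v q = deg ?\<tau> v q + of_bool ({v, w} \<in> E)"
    using deg_upd_other[OF v(2,3), of \<sigma> l q] sq kq by simp
  have dk: "deg ?\<tau> v k = deg \<sigma> v k + of_bool ({v, w} \<in> E \<and> l = k)"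
    using deg_upd_other[OF v(2,3), of \<sigma> l k] sq kq by simp
  have pw: "B ^ of_bool ({v, w} \<in> E) * B ^ of_bool ({v, w} \<in> E \<and> l = k) =
      B ^ (if {v, w} \<in> E then (if k = l then 2 else 1) else 0)"
    by (auto simp: power2_eq_square)
  have "pmf p \<sigma> * pmf p (?\<tau>(v := k)) * (B ^ deg ?\<tau> v q * B ^ deg \<sigma> v k) =
     (pmf p \<sigma> * B ^ deg \<sigma> v k) * (pmf p (?\<tau>(v := k)) * B ^ deg ?\<tau> v q)" by (simp only: mult_ac)
  also have "\<dots> = (pmf p (\<sigma>(v := k)) * B ^ deg \<sigma> v q) * (pmf p ?\<tau> * B ^ deg ?\<tau> v k)"
    unfolding r1 r2 ..
  also have "\<dots> = (B ^ of_bool ({v, w} \<in> E) * B ^ of_bool ({v, w} \<in> E \<and> l = k)) *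
      (pmf p (\<sigma>(v := k)) * pmf p ?\<tau>) * (B ^ deg ?\<tau> v q * B ^ deg \<sigma> v k)"
    unfolding dq dk power_add by (simp only: mult_ac)
  finally show ?thesis unfolding pw tw using B0 by simp
qed

section \<open>The embedding and its support\<close>

abbreviation em :: "('v \<Rightarrow> nat) \<Rightarrow> 'v \<times> nat \<Rightarrow> nat" where "em \<equiv> embed_config q V"
abbreviation J :: "('v \<times> nat) set" where "J \<equiv> V \<times> {1..q - 1}"
abbreviation ep :: "('v \<times> nat \<Rightarrow> nat) pmf" where "ep \<equiv> embedded_potts q V E B"

lemma em_apply: "em \<sigma> (v, k) = of_bool (v \<in> V \<and> k \<in> {1..q - 1} \<and> \<sigma> v = k)"
  by (simp add: embed_config_def)

lemma em_le_1: "em \<sigma> i \<le> 1"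
  by (cases i) (simp add: em_apply)

lemma inj_em: "inj_on em \<Omega>"
proof (rule inj_onI)
  fix \<sigma> \<tau> assume s: "\<sigma> \<in> \<Omega>" "\<tau> \<in> \<Omega>" and eq: "em \<sigma> = em \<tau>"
  have "\<sigma> v = \<tau> v" for v
  proof (cases "v \<in> V")
    case True
    have *: "(k \<in> {1..q - 1} \<and> \<sigma> v = k) = (k \<in> {1..q - 1} \<and> \<tau> v = k)" for k
      using fun_cong[OF eq, of "(v, k)"] True unfolding em_apply of_bool_eq_iff by blast
    have "\<sigma> v \<in> {1..q}" "\<tau> v \<in> {1..q}" using configs_range s True by auto
    then show ?thesis using *[of "\<sigma> v"] *[of "\<tau> v"] by auto
  next
    case False
    with s show ?thesis by (simp add: configs_def PiE_iff extensional_def)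
  qed
  then show "\<sigma> = \<tau>" by auto
qed

lemma set_pmf_ep: "set_pmf ep = em ` \<Omega>"
  by (simp add: embedded_potts_def set_pmf_potts)

lemma finite_set_pmf_ep: "finite (set_pmf ep)"
  unfolding set_pmf_ep by (intro finite_imageI finite_configs finV)

lemma pmf_ep: "\<sigma> \<in> \<Omega> \<Longrightarrow> pmf ep (em \<sigma>) = pmf p \<sigma>"
  unfolding embedded_potts_def using inj_em by (intro pmf_map_inj) (auto simp: set_pmf_potts)

lemma add_unit_em:
  assumes v: "v \<in> V" and k: "k \<in> {1..q - 1}" and "\<sigma> v = q"
  shows "add_unit (em \<sigma>) (v, k) = em (\<sigma>(v := k))"
proof
  fix i :: "'v \<times> nat"
  obtain w l where i: "i = (w, l)" by (cases i) auto
  have "q \<notin> {1..q - 1}" "k \<noteq> q" using k q1 by auto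
  then show "add_unit (em \<sigma>) (v, k) i = em (\<sigma>(v := k)) i"
    using assms unfolding i add_unit_def by (auto simp: em_apply)
qed

text \<open>A vertex with one of the first q - 1 colours already uses its single unit, so only
  vertices of colour q admit a birth.\<close>

lemma add_unit_em_iff:
  assumes \<sigma>: "\<sigma> \<in> \<Omega>" and v: "v \<in> V" and k: "k \<in> {1..q - 1}"
  shows "add_unit (em \<sigma>) (v, k) \<in> set_pmf ep \<longleftrightarrow> \<sigma> v = q"
proof
  assume "\<sigma> v = q"
  moreover have "\<sigma>(v := k) \<in> \<Omega>" using configs_upd[OF \<sigma> v, of k] k by auto
  ultimately show "add_unit (em \<sigma>) (v, k) \<in> set_pmf ep"
    using add_unit_em[of v k \<sigma>, OF v k] by (auto simp: set_pmf_ep)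
next
  assume "add_unit (em \<sigma>) (v, k) \<in> set_pmf ep"
  then obtain \<tau> where \<tau>: "add_unit (em \<sigma>) (v, k) = em \<tau>" by (auto simp: set_pmf_ep)
  have "1 \<le> em \<tau> (v, k)" using fun_cong[OF \<tau>, of "(v, k)"] by (simp add: add_unit_def)
  then have tk: "\<tau> v = k" by (auto simp: em_apply of_bool_def split: if_splits)
  show "\<sigma> v = q"
  proof (rule ccontr)
    assume "\<sigma> v \<noteq> q"
    with configs_range[OF \<sigma> v] have s: "\<sigma> v \<in> {1..q - 1}" by auto
    then have one: "em \<sigma> (v, \<sigma> v) = 1" using v by (simp add: em_apply)
    have "1 \<le> em \<tau> (v, \<sigma> v)"
      using fun_cong[OF \<tau>, of "(v, \<sigma> v)"] one by (simp add: add_unit_def split: if_splits)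
    then have "\<sigma> v = k" using tk by (auto simp: em_apply of_bool_def split: if_splits)
    then have "em \<tau> (v, k) = 2" using fun_cong[OF \<tau>, of "(v, k)"] one by (simp add: add_unit_def)
    then show False using em_le_1[of \<tau> "(v, k)"] by simp
  qed
qed

text \<open>Lowering a multi-index amounts to recolouring some vertices with the unrecorded colour
  q.\<close>

lemma downward_closed_ep: "downward_closed (set_pmf ep)"
  unfolding downward_closed_def
proof (intro ballI allI impI)
  fix n m assume "n \<in> set_pmf ep" and mn: "m \<le> n"
  then obtain \<sigma> where \<sigma>: "\<sigma> \<in> \<Omega>" "n = em \<sigma>" by (auto simp: set_pmf_ep)
  define \<tau> where "\<tau> v = (if v \<in> V \<and> (\<exists>k. m (v, k) \<noteq> 0) then \<sigma> v else if v \<in> V then q else undefined)" for v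
  have \<tau>: "\<tau> \<in> \<Omega>" using \<sigma>(1) q1 by (auto simp: \<tau>_def configs_def PiE_iff extensional_def)
  have le: "m (v, k) \<le> em \<sigma> (v, k)" for v k using mn \<sigma>(2) by (simp add: le_fun_def)
  have supp: "v \<in> V \<and> k \<in> {1..q - 1} \<and> \<sigma> v = k \<and> m (v, k) = 1" if "m (v, k) \<noteq> 0" for v k
    using le[of v k] that unfolding em_apply by (auto simp: of_bool_def split: if_splits)
  have "m i = em \<tau> i" for i
  proof -
    obtain v k where i: "i = (v, k)" by (cases i) auto
    show ?thesis
    proof (cases "m (v, k) = 0")
      case False
      have "\<exists>k. m (v, k) \<noteq> 0" using False by blast
      with supp[OF False] show ?thesis unfolding i em_apply \<tau>_def by simp
    next
      case True
      have "\<not> (v \<in> V \<and> k \<in> {1..q - 1} \<and> \<tau> v = k)"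
      proof
        assume A: "v \<in> V \<and> k \<in> {1..q - 1} \<and> \<tau> v = k"
        then have "k \<noteq> q" using q1 by auto
        with A obtain k' where k': "m (v, k') \<noteq> 0" and "\<sigma> v = k" by (auto simp: \<tau>_def split: if_splits)
        with supp[OF k'] True show False by auto
      qed
      then show ?thesis unfolding i em_apply using True by simp
    qed
  qed
  then have "m = em \<tau>" by auto
  with \<tau> show "m \<in> set_pmf ep" by (auto simp: set_pmf_ep)
qed

lemma ulc_weight_em: "\<sigma> \<in> \<Omega> \<Longrightarrow> ulc_weight J ep (em \<sigma>) = pmf p \<sigma>"
proof -
  assume \<sigma>: "\<sigma> \<in> \<Omega>"
  have "fact (em \<sigma> i) = (1 :: real)" for i
    using em_le_1[of \<sigma> i] by (cases "em \<sigma> i = 0") (auto simp: le_Suc_eq)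
  then show ?thesis using pmf_ep[OF \<sigma>] by (simp add: ulc_weight_def)
qed

lemma add_two_units_same_vertex:
  assumes "\<sigma> \<in> \<Omega>" "v \<in> V" "k \<in> {1..q - 1}" "l \<in> {1..q - 1}" "\<sigma> v = q"
  shows "ulc_weight J ep (add_unit (add_unit (em \<sigma>) (v, k)) (v, l)) = 0"
proof -
  have "\<sigma>(v := k) \<in> \<Omega>" using configs_upd[OF assms(1,2), of k] assms by auto
  then have "add_unit (em (\<sigma>(v := k))) (v, l) \<notin> set_pmf ep"
    using add_unit_em_iff[of "\<sigma>(v := k)" v l] assms q1 by auto
  then show ?thesis using add_unit_em[of v k \<sigma>] assms by (simp add: ulc_weight_def pmf_eq_0_set_pmf)
qed

end

text \<open>The quadratic form of \<alpha> \<otimes> J + \<beta> \<otimes> I: the first part sees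
  only the colour sums at each vertex, the second acts on every colour separately.\<close>

lemma sum_vertex_colour_split:
  fixes x :: "'a \<times> 'b \<Rightarrow> real"
  assumes U: "finite U" and K: "finite K"
  shows "(\<Sum>i\<in>U \<times> K. \<Sum>j\<in>U \<times> K. x i * (\<alpha> (fst i) (fst j) + \<beta> (fst i) (fst j) * (if snd i = snd j then 1 else 0)) * x j)
    = (\<Sum>v\<in>U. \<Sum>w\<in>U. \<alpha> v w * ((\<Sum>k\<in>K. x (v, k)) * (\<Sum>k\<in>K. x (w, k)))) +
      (\<Sum>k\<in>K. \<Sum>v\<in>U. \<Sum>w\<in>U. \<beta> v w * (x (v, k) * x (w, k)))"
proof -
  have inner: "(\<Sum>k\<in>K. \<Sum>l\<in>K. x (v, k) * (\<alpha> v w + \<beta> v w * (if k = l then 1 else 0)) * x (w, l)) =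
     \<alpha> v w * ((\<Sum>k\<in>K. x (v, k)) * (\<Sum>k\<in>K. x (w, k))) + (\<Sum>k\<in>K. \<beta> v w * (x (v, k) * x (w, k)))" for v w
  proof -
    have "(\<Sum>k\<in>K. \<Sum>l\<in>K. x (v, k) * (\<alpha> v w + \<beta> v w * (if k = l then 1 else 0)) * x (w, l)) =
      (\<Sum>k\<in>K. \<Sum>l\<in>K. \<alpha> v w * (x (v, k) * x (w, l)) + (if k = l then \<beta> v w * (x (v, k) * x (w, k)) else 0))"
      by (intro sum.cong refl) (auto simp: algebra_simps)
    also have "\<dots> = (\<Sum>k\<in>K. \<Sum>l\<in>K. \<alpha> v w * (x (v, k) * x (w, l))) + (\<Sum>k\<in>K. \<beta> v w * (x (v, k) * x (w, k)))"
      using K by (simp only: sum.distrib) (simp add: sum.delta')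
    also have "(\<Sum>k\<in>K. \<Sum>l\<in>K. \<alpha> v w * (x (v, k) * x (w, l))) = \<alpha> v w * ((\<Sum>k\<in>K. x (v, k)) * (\<Sum>k\<in>K. x (w, k)))"
      unfolding sum_product unfolding sum_distrib_left ..
    finally show ?thesis .
  qed
  have "(\<Sum>i\<in>U \<times> K. \<Sum>j\<in>U \<times> K. x i * (\<alpha> (fst i) (fst j) + \<beta> (fst i) (fst j) * (if snd i = snd j then 1 else 0)) * x j)
     = (\<Sum>v\<in>U. \<Sum>k\<in>K. \<Sum>w\<in>U. \<Sum>l\<in>K. x (v, k) * (\<alpha> v w + \<beta> v w * (if k = l then 1 else 0)) * x (w, l))"
    unfolding sum.cartesian_product' by (simp only: fst_conv snd_conv)
  also have "\<dots> = (\<Sum>v\<in>U. \<Sum>w\<in>U. \<Sum>k\<in>K. \<Sum>l\<in>K. x (v, k) * (\<alpha> v w + \<beta> v w * (if k = l then 1 else 0)) * x (w, l))"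
    by (intro sum.cong refl sum.swap)
  also have "\<dots> = (\<Sum>v\<in>U. \<Sum>w\<in>U. \<alpha> v w * ((\<Sum>k\<in>K. x (v, k)) * (\<Sum>k\<in>K. x (w, k)))) +
      (\<Sum>v\<in>U. \<Sum>w\<in>U. \<Sum>k\<in>K. \<beta> v w * (x (v, k) * x (w, k)))"
    by (simp only: inner sum.distrib)
  also have "(\<Sum>v\<in>U. \<Sum>w\<in>U. \<Sum>k\<in>K. \<beta> v w * (x (v, k) * x (w, k))) = (\<Sum>v\<in>U. \<Sum>k\<in>K. \<Sum>w\<in>U. \<beta> v w * (x (v, k) * x (w, k)))"
    by (intro sum.cong refl sum.swap)
  also have "\<dots> = (\<Sum>k\<in>K. \<Sum>v\<in>U. \<Sum>w\<in>U. \<beta> v w * (x (v, k) * x (w, k)))"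
    by (rule sum.swap)
  finally show ?thesis .
qed

context potts_model begin

text \<open>The formula for \<delta> is tuned so that (1 - \<delta>) B^\<Delta> = lam (1 - B) B. The
  diagonal then exactly compensates the worst case of B (1 - B) times the adjacency form acting on
  each colour, and what remains is (1 - (1 - B) lam) times the squares of the colour sums.\<close>

theorem embedded_potts_ULC:
  fixes lam :: real and \<Delta> :: nat
  assumes lam: "\<And>x. - lam * (\<Sum>v\<in>V. (x v)\<^sup>2) \<le> (\<Sum>v\<in>V. \<Sum>w\<in>V. x v * x w * adj E v w)"
    and lam0: "0 \<le> lam" and deg: "\<And>\<sigma> v c. v \<in> V \<Longrightarrow> deg \<sigma> v c \<le> \<Delta>"
    and \<Delta>: "1 \<le> \<Delta>" and \<delta>: "\<delta> = 1 - lam * (1 - B) * B powi (1 - int \<Delta>)" and \<delta>0: "0 < \<delta>"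
  shows "ULC \<delta> J ep"
  unfolding ULC_def Let_def
proof (intro conjI ballI)
  show "0 < \<delta>" by (rule \<delta>0)
  show "finite J" using finV by simp
  show "set_pmf ep \<subseteq> multi_indices J"
    by (auto simp: set_pmf_ep multi_indices_def em_apply)
  show "downward_closed (set_pmf ep)" by (rule downward_closed_ep)
  fix n assume "n \<in> set_pmf ep"
  then obtain \<sigma> where \<sigma>: "\<sigma> \<in> \<Omega>" and n: "n = em \<sigma>" by (auto simp: set_pmf_ep)
  define U where "U = {v \<in> V. \<sigma> v = q}"
  let ?K = "{1..q - 1}"
  let ?a = "ulc_weight J ep"
  let ?M = "\<lambda>i j. (1 - ?a n * ?a (add_unit (add_unit n i) j) / (?a (add_unit n i) * ?a (add_unit n j)))
                    + (1 - \<delta>) * (if i = j then ?a n / ?a (add_unit n i) else 0)"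
  have I: "{i \<in> J. add_unit n i \<in> set_pmf ep} = U \<times> ?K"
    using add_unit_em_iff[OF \<sigma>] by (auto simp: U_def n)
  have UV: "U \<subseteq> V" "finite U" using finV by (auto simp: U_def)
  have B1': "B powi (1 - int \<Delta>) * B ^ \<Delta> = B"
    using B0 by (simp add: power_int_diff)
  have c1: "1 - \<delta> = lam * (1 - B) * B powi (1 - int \<Delta>)" by (simp add: \<delta>)
  have c0: "0 \<le> 1 - \<delta>" using lam0 B0 B1 by (simp add: c1)
  define r where "r i = ?a n / ?a (add_unit n i)" for i
  have r: "B ^ \<Delta> \<le> r (v, k)" if "v \<in> U" "k \<in> ?K" for v k
  proof -
    have v: "v \<in> V" "\<sigma> v = q" using that by (auto simp: U_def)
    have k: "k \<in> {1..q}" "q \<in> {1..q}" using that q1 by auto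
    have s: "\<sigma>(v := k) \<in> \<Omega>" using configs_upd[OF \<sigma> v(1) k(1)] .
    have rv: "r (v, k) = pmf p \<sigma> / pmf p (\<sigma>(v := k))"
      unfolding r_def n add_unit_em[of v k \<sigma>, OF v(1) that(2) v(2)] ulc_weight_em[OF \<sigma>] ulc_weight_em[OF s] ..
    have "\<sigma>(v := q) = \<sigma>" using v by auto
    with update_ratio[OF \<sigma> v(1) k] have ur: "pmf p (\<sigma>(v := k)) * B ^ deg \<sigma> v q = pmf p \<sigma> * B ^ deg \<sigma> v k" by simp
    have "pmf p (\<sigma>(v := k)) * B ^ \<Delta> \<le> pmf p (\<sigma>(v := k)) * B ^ deg \<sigma> v q"
      using deg[OF v(1)] B0 B1 by (intro mult_left_mono power_decreasing) auto
    also have "\<dots> \<le> pmf p \<sigma> * 1"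
      unfolding ur using B0 B1 by (intro mult_left_mono power_le_one) auto
    finally show ?thesis
      unfolding rv using pmf_pos[OF s] by (simp add: le_divide_eq mult.commute)
  qed
  have entry: "?M (v, k) (w, l) = (of_bool (v = w) + (1 - B) * adj E v w) + B * (1 - B) * adj E v w * (if k = l then 1 else 0)
      + (1 - \<delta>) * (if (v, k) = (w, l) then r (v, k) else 0)"
    if "v \<in> U" "k \<in> ?K" "w \<in> U" "l \<in> ?K" for v k w l
  proof -
    have v: "v \<in> V" "\<sigma> v = q" and w: "w \<in> V" "\<sigma> w = q" using that by (auto simp: U_def)
    have kl: "k \<in> {1..q}" "l \<in> {1..q}" using that by auto
    have sk: "\<sigma>(v := k) \<in> \<Omega>" and sl: "\<sigma>(w := l) \<in> \<Omega>"
      using configs_upd[OF \<sigma> v(1) kl(1)] configs_upd[OF \<sigma> w(1) kl(2)] by auto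
    have ak: "add_unit n (v, k) = em (\<sigma>(v := k))" "add_unit n (w, l) = em (\<sigma>(w := l))"
      unfolding n using add_unit_em[of v k \<sigma>, OF v(1) that(2) v(2)] add_unit_em[of w l \<sigma>, OF w(1) that(4) w(2)] by auto
    have "?a n * ?a (add_unit (add_unit n (v, k)) (w, l)) / (?a (add_unit n (v, k)) * ?a (add_unit n (w, l))) =
       (if v = w then 0 else B ^ (if {v, w} \<in> E then (if k = l then 2 else 1) else 0))"
    proof (cases "v = w")
      case True
      then show ?thesis using add_two_units_same_vertex[OF \<sigma> v(1) that(2,4) v(2)] by (simp add: n del: One_nat_def)
    next
      case False
      have kl': "\<sigma>(v := k, w := l) \<in> \<Omega>" using configs_upd[OF sk w(1) kl(2)] .
      have "add_unit (add_unit n (v, k)) (w, l) = em (\<sigma>(v := k, w := l))"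
        unfolding ak using add_unit_em[of w l "\<sigma>(v := k)", OF w(1) that(4)] w False by simp
      then have "?a n * ?a (add_unit (add_unit n (v, k)) (w, l)) / (?a (add_unit n (v, k)) * ?a (add_unit n (w, l))) =
         pmf p \<sigma> * pmf p (\<sigma>(v := k, w := l)) / (pmf p (\<sigma>(v := k)) * pmf p (\<sigma>(w := l)))"
        unfolding ak by (simp only: n ulc_weight_em \<sigma> sk sl kl')
      also have "\<dots> = B ^ (if {v, w} \<in> E then (if k = l then 2 else 1) else 0)"
        unfolding two_updates[OF \<sigma> v(1) w(1) False v(2) w(2) that(2,4)]
        using pmf_pos[OF sk] pmf_pos[OF sl] by simp
      finally show ?thesis using False by simp
    qed
    \<comment> \<open>On an edge, 1 - B^2 = (1 - B) + B (1 - B): the second summand occurs for equal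
      colours only and gives the part that is diagonal in the colour.\<close>
    moreover have "1 - (if v = w then 0 else B ^ (if {v, w} \<in> E then (if k = l then 2 else 1) else 0)) =
       (of_bool (v = w) + (1 - B) * adj E v w) + B * (1 - B) * adj E v w * (if k = l then 1 else 0)"
      using loopless[of v] by (auto simp: adj_def power2_eq_square algebra_simps)
    ultimately show ?thesis by (simp only: r_def)
  qed
  show "psd_on {i \<in> J. add_unit n i \<in> set_pmf ep} ?M"
    unfolding I psd_on_def
  proof (intro conjI ballI allI)
    fix i j assume ij: "i \<in> U \<times> ?K" "j \<in> U \<times> ?K"
    show "?M i j = ?M j i"
      by (cases "i = j") (simp_all add: add_unit_commute[of n i j] mult.commute)
  next
    fix x :: "'v \<times> nat \<Rightarrow> real"
    let ?I = "U \<times> ?K"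
    define s where "s v = (\<Sum>k\<in>?K. x (v, k))" for v
    let ?X = "\<Sum>k\<in>?K. \<Sum>v\<in>U. (x (v, k))\<^sup>2"
    \<comment> \<open>Extending by zero passes the bound to the principal submatrix on
      \<open>U\<close>.\<close>
    have lamU: "- lam * (\<Sum>v\<in>U. (y v)\<^sup>2) \<le> (\<Sum>v\<in>U. \<Sum>w\<in>U. y v * y w * adj E v w)" for y :: "'v \<Rightarrow> real"
    proof -
      let ?y = "\<lambda>v. if v \<in> U then y v else 0"
      have "(\<Sum>v\<in>V. (?y v)\<^sup>2) = (\<Sum>v\<in>U. (y v)\<^sup>2)"
        using UV finV by (intro sum.mono_neutral_cong_right) auto
      moreover have "(\<Sum>v\<in>V. \<Sum>w\<in>V. ?y v * ?y w * adj E v w) = (\<Sum>v\<in>U. \<Sum>w\<in>V. ?y v * ?y w * adj E v w)"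
        using UV finV by (intro sum.mono_neutral_right) auto
      moreover have "\<dots> = (\<Sum>v\<in>U. \<Sum>w\<in>U. y v * y w * adj E v w)"
        using UV finV by (intro sum.cong[OF refl] sum.mono_neutral_cong_right) auto
      ultimately show ?thesis using lam[of ?y] by simp
    qed
    have "(\<Sum>i\<in>?I. \<Sum>j\<in>?I. x i * ?M i j * x j) = (\<Sum>i\<in>?I. \<Sum>j\<in>?I.
        x i * ((of_bool (fst i = fst j) + (1 - B) * adj E (fst i) (fst j)) + (B * (1 - B) * adj E (fst i) (fst j)) * (if snd i = snd j then 1 else 0)) * x j
        + (if i = j then (1 - \<delta>) * r i * (x i)\<^sup>2 else 0))"
    proof (intro sum.cong refl)
      fix i j assume ij: "i \<in> ?I" "j \<in> ?I"
      then obtain v k w l where "i = (v, k)" "j = (w, l)" "v \<in> U" "k \<in> ?K" "w \<in> U" "l \<in> ?K" by blast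
      then show "x i * ?M i j * x j =
        x i * ((of_bool (fst i = fst j) + (1 - B) * adj E (fst i) (fst j)) + (B * (1 - B) * adj E (fst i) (fst j)) * (if snd i = snd j then 1 else 0)) * x j
        + (if i = j then (1 - \<delta>) * r i * (x i)\<^sup>2 else 0)"
        using entry[of v k w l] by (simp only: fst_conv snd_conv) (simp add: algebra_simps power2_eq_square)
    qed
    also have "\<dots> = (\<Sum>v\<in>U. \<Sum>w\<in>U. (of_bool (v = w) + (1 - B) * adj E v w) * (s v * s w)) +
        (\<Sum>k\<in>?K. \<Sum>v\<in>U. \<Sum>w\<in>U. (B * (1 - B) * adj E v w) * (x (v, k) * x (w, k))) + (\<Sum>i\<in>?I. (1 - \<delta>) * r i * (x i)\<^sup>2)"
    proof -
      have "(\<Sum>i\<in>?I. \<Sum>j\<in>?I. if i = j then (1 - \<delta>) * r i * (x i)\<^sup>2 else 0) = (\<Sum>i\<in>?I. (1 - \<delta>) * r i * (x i)\<^sup>2)"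
        using UV by (intro sum.cong refl) (simp add: sum.delta)
      then show ?thesis
        unfolding sum.distrib s_def
        using sum_vertex_colour_split[OF UV(2), of ?K x "\<lambda>v w. of_bool (v = w) + (1 - B) * adj E v w" "\<lambda>v w. B * (1 - B) * adj E v w"]
        by simp
    qed
    also have "\<dots> \<ge> (1 - (1 - B) * lam) * (\<Sum>v\<in>U. (s v)\<^sup>2) + B * (1 - B) * (- lam * ?X) + lam * (1 - B) * B * ?X"
    proof (intro add_mono)
      have "(\<Sum>v\<in>U. \<Sum>w\<in>U. (of_bool (v = w) + (1 - B) * adj E v w) * (s v * s w)) =
         (\<Sum>v\<in>U. (s v)\<^sup>2) + (1 - B) * (\<Sum>v\<in>U. \<Sum>w\<in>U. s v * s w * adj E v w)"
      proof -
        have "(\<Sum>v\<in>U. \<Sum>w\<in>U. of_bool (v = w) * (s v * s w)) = (\<Sum>v\<in>U. (s v)\<^sup>2)"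
          using UV by (intro sum.cong refl) (simp add: power2_eq_square)
        then show ?thesis
          by (simp only: distrib_right sum.distrib) (simp only: sum_distrib_left mult_ac)
      qed
      also have "\<dots> \<ge> (\<Sum>v\<in>U. (s v)\<^sup>2) + (1 - B) * (- lam * (\<Sum>v\<in>U. (s v)\<^sup>2))"
        using B1 by (intro add_left_mono mult_left_mono lamU) auto
      finally show "(1 - (1 - B) * lam) * (\<Sum>v\<in>U. (s v)\<^sup>2) \<le>
         (\<Sum>v\<in>U. \<Sum>w\<in>U. (of_bool (v = w) + (1 - B) * adj E v w) * (s v * s w))"
        by (simp add: algebra_simps)
      have "B * (1 - B) * (- lam * ?X) = (\<Sum>k\<in>?K. B * (1 - B) * (- lam * (\<Sum>v\<in>U. (x (v, k))\<^sup>2)))"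
        by (simp only: sum_distrib_left)
      also have "\<dots> \<le> (\<Sum>k\<in>?K. B * (1 - B) * (\<Sum>v\<in>U. \<Sum>w\<in>U. x (v, k) * x (w, k) * adj E v w))"
        using B0 B1 by (intro sum_mono mult_left_mono lamU) auto
      also have "\<dots> = (\<Sum>k\<in>?K. \<Sum>v\<in>U. \<Sum>w\<in>U. (B * (1 - B) * adj E v w) * (x (v, k) * x (w, k)))"
        by (simp only: sum_distrib_left mult_ac)
      finally show "B * (1 - B) * (- lam * ?X) \<le> \<dots>" .
      have "lam * (1 - B) * B * ?X = (1 - \<delta>) * B ^ \<Delta> * ?X"
        unfolding c1 using B1' by (simp add: mult.assoc)
      also have "\<dots> = (\<Sum>k\<in>?K. \<Sum>v\<in>U. (1 - \<delta>) * B ^ \<Delta> * (x (v, k))\<^sup>2)"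
        by (simp only: sum_distrib_left)
      also have "\<dots> \<le> (\<Sum>k\<in>?K. \<Sum>v\<in>U. (1 - \<delta>) * r (v, k) * (x (v, k))\<^sup>2)"
        using c0 r by (intro sum_mono mult_right_mono mult_left_mono) auto
      also have "\<dots> = (\<Sum>i\<in>?I. (1 - \<delta>) * r i * (x i)\<^sup>2)"
        unfolding sum.cartesian_product' by (rule sum.swap)
      finally show "lam * (1 - B) * B * ?X \<le> \<dots>" .
    qed
    also have "(1 - (1 - B) * lam) * (\<Sum>v\<in>U. (s v)\<^sup>2) + B * (1 - B) * (- lam * ?X) + lam * (1 - B) * B * ?X =
        (1 - (1 - B) * lam) * (\<Sum>v\<in>U. (s v)\<^sup>2)" by (simp add: algebra_simps)
    finally have main: "(1 - (1 - B) * lam) * (\<Sum>v\<in>U. (s v)\<^sup>2) \<le> (\<Sum>i\<in>?I. \<Sum>j\<in>?I. x i * ?M i j * x j)" .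
    show "0 \<le> (\<Sum>i\<in>?I. \<Sum>j\<in>?I. x i * ?M i j * x j)"
    proof -
      \<comment> \<open>Since B^(1 - \<Delta>) is at least 1, lam (1 - B) is at most 1 - \<delta>
        and so below 1; the remaining coefficient is therefore nonnegative.\<close>
      have "1 \<le> inverse B ^ (\<Delta> - 1)" using B0 B1 by (intro one_le_power) (simp add: one_le_inverse)
      also have "inverse B ^ (\<Delta> - 1) = B powi (1 - int \<Delta>)"
        using \<Delta> B0 by (simp add: power_int_def nat_diff_distrib power_inverse)
      finally have "lam * (1 - B) * 1 \<le> lam * (1 - B) * B powi (1 - int \<Delta>)"
        using lam0 B1 by (intro mult_left_mono) auto
      also have "\<dots> \<le> 1" using \<delta>0 c1 by simp
      finally have "0 \<le> 1 - (1 - B) * lam" by (simp add: mult.commute)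
      then have "0 \<le> (1 - (1 - B) * lam) * (\<Sum>v\<in>U. (s v)\<^sup>2)" by (intro mult_nonneg_nonneg sum_nonneg) auto
      with main show ?thesis by linarith
    qed
  qed
qed

end

section \<open>Glauber dynamics\<close>

context potts_model begin

definition wt :: "('v \<Rightarrow> nat) \<Rightarrow> 'v \<Rightarrow> nat \<Rightarrow> real" where
  "wt \<sigma> v c = B ^ deg \<sigma> v c / (\<Sum>a\<in>{1..q}. B ^ deg \<sigma> v a)"

text \<open>On configurations this is the conditional expectation of \<open>f\<close> given the
  colours away from \<open>v\<close>.\<close>

definition site_avg :: "'v \<Rightarrow> (('v \<Rightarrow> nat) \<Rightarrow> real) \<Rightarrow> ('v \<Rightarrow> nat) \<Rightarrow> real" where
  "site_avg v f \<sigma> = (\<Sum>c\<in>{1..q}. wt \<sigma> v c * f (\<sigma>(v := c)))"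

definition glauber_op :: "(('v \<Rightarrow> nat) \<Rightarrow> real) \<Rightarrow> ('v \<Rightarrow> nat) \<Rightarrow> real" where
  "glauber_op f \<sigma> = (\<Sum>v\<in>V. site_avg v f \<sigma>) / card V"

lemma finO: "finite \<Omega>" by (rule finite_configs[OF finV])

lemma denom_pos: "0 < (\<Sum>a\<in>{1..q}. B ^ deg \<sigma> v a)"
  using B0 q1 by (intro sum_pos) auto

lemma sum_wt: "(\<Sum>c\<in>{1..q}. wt \<sigma> v c) = 1"
  unfolding wt_def sum_divide_distrib[symmetric] using denom_pos[of \<sigma> v] by simp

lemma wt_upd [simp]: "wt (\<sigma>(v := c)) v d = wt \<sigma> v d"
  by (simp add: wt_def colour_degree_upd[OF loopless])

lemma site_avg_upd [simp]: "site_avg v f (\<sigma>(v := c)) = site_avg v f \<sigma>"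
  by (simp add: site_avg_def)

text \<open>Configurations are grouped by their restriction off \<open>v\<close>; the member with
  colour q at \<open>v\<close> represents its group.\<close>

lemma sum_fibres:
  assumes v: "v \<in> V"
  shows "(\<Sum>\<sigma>\<in>\<Omega>. g \<sigma>) = (\<Sum>\<sigma>\<in>{\<sigma> \<in> \<Omega>. \<sigma> v = q}. \<Sum>c\<in>{1..q}. g (\<sigma>(v := c)))"
proof -
  have "(\<Sum>\<sigma>\<in>\<Omega>. g \<sigma>) = (\<Sum>(\<sigma>, c)\<in>{\<sigma> \<in> \<Omega>. \<sigma> v = q} \<times> {1..q}. g (\<sigma>(v := c)))"
  proof (rule sum.reindex_bij_witness[of _ "\<lambda>(\<sigma>, c). \<sigma>(v := c)" "\<lambda>\<sigma>. (\<sigma>(v := q), \<sigma> v)"])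
    fix \<sigma> assume \<sigma>: "\<sigma> \<in> \<Omega>"
    show "(\<sigma>(v := q), \<sigma> v) \<in> {\<sigma> \<in> \<Omega>. \<sigma> v = q} \<times> {1..q}"
      using configs_upd[OF \<sigma> v, of q] configs_range[OF \<sigma> v] q1 by auto
  next
    fix b assume "b \<in> {\<sigma> \<in> \<Omega>. \<sigma> v = q} \<times> {1..q}"
    then obtain \<sigma> c where b: "b = (\<sigma>, c)" "\<sigma> \<in> \<Omega>" "\<sigma> v = q" "c \<in> {1..q}" by blast
    then show "(\<lambda>(\<sigma>, c). \<sigma>(v := c)) b \<in> \<Omega>" using configs_upd[OF b(2) v b(4)] by simp
    have "\<sigma>(v := q) = \<sigma>" using b(3) by auto
    then show "(\<lambda>\<sigma>. (\<sigma>(v := q), \<sigma> v)) ((\<lambda>(\<sigma>, c). \<sigma>(v := c)) b) = b" using b(1) by simp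
  qed auto
  then show ?thesis by (simp add: sum.cartesian_product)
qed

lemma fibre_weights:
  assumes \<sigma>: "\<sigma> \<in> \<Omega>" and v: "v \<in> V" and c: "c \<in> {1..q}"
  shows "pmf p (\<sigma>(v := c)) = (\<Sum>a\<in>{1..q}. pmf p (\<sigma>(v := a))) * wt \<sigma> v c"
proof -
  have "pmf p (\<sigma>(v := c)) * (\<Sum>a\<in>{1..q}. B ^ deg \<sigma> v a) = (\<Sum>a\<in>{1..q}. pmf p (\<sigma>(v := a))) * B ^ deg \<sigma> v c"
    unfolding sum_distrib_left sum_distrib_right by (intro sum.cong refl update_ratio[OF \<sigma> v c])
  then show ?thesis using denom_pos[of \<sigma> v] by (simp add: wt_def field_simps)
qed

lemma fibre_avg:
  assumes \<sigma>: "\<sigma> \<in> \<Omega>" and v: "v \<in> V"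
  shows "(\<Sum>c\<in>{1..q}. pmf p (\<sigma>(v := c)) * f (\<sigma>(v := c))) = (\<Sum>c\<in>{1..q}. pmf p (\<sigma>(v := c))) * site_avg v f \<sigma>"
  unfolding site_avg_def sum_distrib_left
  by (intro sum.cong refl) (simp add: fibre_weights[OF \<sigma> v] mult.assoc del: atLeastAtMost_iff)

text \<open>Pythagoras in each fibre: resampling at v is an orthogonal projection in L2 of the Potts
  measure.\<close>

lemma site_avg_variance:
  assumes v: "v \<in> V"
  shows "(\<Sum>\<sigma>\<in>\<Omega>. pmf p \<sigma> * (f \<sigma> - site_avg v f \<sigma>)\<^sup>2) =
    (\<Sum>\<sigma>\<in>\<Omega>. pmf p \<sigma> * (f \<sigma>)\<^sup>2) - (\<Sum>\<sigma>\<in>\<Omega>. pmf p \<sigma> * (site_avg v f \<sigma>)\<^sup>2)"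
proof -
  let ?A = "site_avg v f"
  have eq: "(\<Sum>c\<in>{1..q}. pmf p (\<sigma>(v := c)) * (f (\<sigma>(v := c)) - ?A (\<sigma>(v := c)))\<^sup>2) =
     (\<Sum>c\<in>{1..q}. pmf p (\<sigma>(v := c)) * (f (\<sigma>(v := c)))\<^sup>2) - (\<Sum>c\<in>{1..q}. pmf p (\<sigma>(v := c)) * (?A (\<sigma>(v := c)))\<^sup>2)"
    if \<sigma>: "\<sigma> \<in> {\<sigma> \<in> \<Omega>. \<sigma> v = q}" for \<sigma>
  proof -
    let ?w = "\<lambda>c. pmf p (\<sigma>(v := c))" and ?g = "\<lambda>c. f (\<sigma>(v := c))"
    have s: "\<sigma> \<in> \<Omega>" using \<sigma> by simp
    have "(\<Sum>c\<in>{1..q}. ?w c * (?g c - ?A \<sigma>)\<^sup>2) =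
       (\<Sum>c\<in>{1..q}. ?w c * (?g c)\<^sup>2 - 2 * ?A \<sigma> * (?w c * ?g c) + ?w c * (?A \<sigma>)\<^sup>2)"
      by (intro sum.cong refl) (simp add: power2_eq_square algebra_simps)
    also have "\<dots> = (\<Sum>c\<in>{1..q}. ?w c * (?g c)\<^sup>2) - 2 * ?A \<sigma> * (\<Sum>c\<in>{1..q}. ?w c * ?g c) + (\<Sum>c\<in>{1..q}. ?w c) * (?A \<sigma>)\<^sup>2"
      by (simp only: sum.distrib sum_subtractf sum_distrib_left sum_distrib_right)
    also have "\<dots> = (\<Sum>c\<in>{1..q}. ?w c * (?g c)\<^sup>2) - (\<Sum>c\<in>{1..q}. ?w c) * (?A \<sigma>)\<^sup>2"
      unfolding fibre_avg[OF s v] by (simp add: power2_eq_square)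
    finally show ?thesis by (simp add: sum_distrib_right)
  qed
  show ?thesis
    unfolding sum_fibres[OF v] using sum.cong[OF refl eq] by (simp only: sum_subtractf)
qed

text \<open>The embedded chain joins every colour k at v only to q. Each difference is routed
  through an arbitrary centre \<open>a\<close>; the part at q is charged to the weight of q, because
  B^\<Delta> times the weight of k is at most that of q, and it recurs q - 1 times.\<close>

lemma fibre_energy_le:
  assumes \<sigma>: "\<sigma> \<in> \<Omega>" "\<sigma> v = q" and v: "v \<in> V" and deg: "\<And>\<sigma> v c. v \<in> V \<Longrightarrow> deg \<sigma> v c \<le> \<Delta>"
  shows "B ^ \<Delta> * (\<Sum>k\<in>{1..q - 1}. pmf p (\<sigma>(v := k)) * (f (\<sigma>(v := k)) - f \<sigma>)\<^sup>2) \<le>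
     2 * real q * (\<Sum>c\<in>{1..q}. pmf p (\<sigma>(v := c)) * (f (\<sigma>(v := c)) - a)\<^sup>2)"
proof -
  let ?w = "\<lambda>c. pmf p (\<sigma>(v := c))" and ?g = "\<lambda>c. f (\<sigma>(v := c))"
  have sq: "\<sigma>(v := q) = \<sigma>" using \<sigma> by auto
  have w: "B ^ \<Delta> * ?w k \<le> ?w q" if "k \<in> {1..q - 1}" for k
  proof -
    have k: "k \<in> {1..q}" "q \<in> {1..q}" using that q1 by auto
    have "?w k * B ^ \<Delta> \<le> ?w k * B ^ deg \<sigma> v q"
      using deg[OF v] B0 B1 by (intro mult_left_mono power_decreasing) auto
    also have "\<dots> = ?w q * B ^ deg \<sigma> v k" by (rule update_ratio[OF \<sigma>(1) v k])
    also have "\<dots> \<le> ?w q * 1" using B0 B1 by (intro mult_left_mono power_le_one) auto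
    finally show ?thesis by (simp add: mult.commute)
  qed
  have split: "{1..q} = insert q {1..q - 1}" "q \<notin> {1..q - 1}" using q1 by auto
  have B: "0 \<le> B ^ \<Delta>" "B ^ \<Delta> \<le> 1" using B0 B1 by (auto intro: power_le_one)
  let ?X = "\<Sum>k\<in>{1..q - 1}. ?w k * (?g k - a)\<^sup>2"
  have "B ^ \<Delta> * (\<Sum>k\<in>{1..q - 1}. ?w k * (?g k - ?g q)\<^sup>2) = (\<Sum>k\<in>{1..q - 1}. (B ^ \<Delta> * ?w k) * (?g k - ?g q)\<^sup>2)"
    by (simp only: sum_distrib_left mult.assoc)
  also have "\<dots> \<le> (\<Sum>k\<in>{1..q - 1}. 2 * (?w k * (?g k - a)\<^sup>2) + 2 * (?w q * (?g q - a)\<^sup>2))"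
  proof (intro sum_mono)
    fix k assume k: "k \<in> {1..q - 1}"
    have "0 \<le> ((?g k - a) + (?g q - a))\<^sup>2" by simp
    then have "(?g k - ?g q)\<^sup>2 \<le> 2 * (?g k - a)\<^sup>2 + 2 * (?g q - a)\<^sup>2"
      by (simp add: power2_eq_square algebra_simps)
    then have "(B ^ \<Delta> * ?w k) * (?g k - ?g q)\<^sup>2 \<le> (B ^ \<Delta> * ?w k) * (2 * (?g k - a)\<^sup>2 + 2 * (?g q - a)\<^sup>2)"
      using B by (intro mult_left_mono) auto
    also have "\<dots> = (B ^ \<Delta> * ?w k) * (2 * (?g k - a)\<^sup>2) + (B ^ \<Delta> * ?w k) * (2 * (?g q - a)\<^sup>2)"
      by (simp only: distrib_left)
    also have "\<dots> \<le> (1 * ?w k) * (2 * (?g k - a)\<^sup>2) + ?w q * (2 * (?g q - a)\<^sup>2)"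
      using w[OF k] B by (intro add_mono mult_right_mono) auto
    finally show "(B ^ \<Delta> * ?w k) * (?g k - ?g q)\<^sup>2 \<le> 2 * (?w k * (?g k - a)\<^sup>2) + 2 * (?w q * (?g q - a)\<^sup>2)"
      by (simp add: mult_ac)
  qed
  also have "\<dots> = 2 * ?X + 2 * real (q - 1) * (?w q * (?g q - a)\<^sup>2)"
    by (simp add: sum.distrib sum_distrib_left)
  also have "\<dots> \<le> 2 * real q * ?X + 2 * real q * (?w q * (?g q - a)\<^sup>2)"
    using q1 by (intro add_mono mult_right_mono sum_nonneg mult_nonneg_nonneg) auto
  also have "\<dots> = 2 * real q * (\<Sum>c\<in>{1..q}. ?w c * (?g c - a)\<^sup>2)"
    unfolding split(1) using split(2) by (subst sum.insert) (auto simp: distrib_left)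
  finally show ?thesis unfolding sq .
qed

text \<open>Births happen only at vertices of colour q, and the birth rate times the weight of the
  starting point is the weight of the recoloured configuration.\<close>

lemma energy_embedded:
  assumes F: "\<And>\<sigma>. \<sigma> \<in> \<Omega> \<Longrightarrow> F (em \<sigma>) = f \<sigma>"
  shows "energy J ep F F =
    (\<Sum>v\<in>V. \<Sum>\<sigma>\<in>{\<sigma> \<in> \<Omega>. \<sigma> v = q}. \<Sum>k\<in>{1..q - 1}. pmf p (\<sigma>(v := k)) * (f (\<sigma>(v := k)) - f \<sigma>)\<^sup>2)"
proof -
  have "energy J ep F F = (\<Sum>\<sigma>\<in>\<Omega>. pmf ep (em \<sigma>) * (\<Sum>i\<in>J. birth ep (em \<sigma>) i *
      ((F (add_unit (em \<sigma>) i) - F (em \<sigma>)) * (F (add_unit (em \<sigma>) i) - F (em \<sigma>)))))"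
    unfolding energy_def set_pmf_ep by (subst sum.reindex[OF inj_em]) simp
  also have "\<dots> = (\<Sum>\<sigma>\<in>\<Omega>. \<Sum>v\<in>V. \<Sum>k\<in>{1..q - 1}. pmf ep (em \<sigma>) * (birth ep (em \<sigma>) (v, k) *
      ((F (add_unit (em \<sigma>) (v, k)) - F (em \<sigma>)) * (F (add_unit (em \<sigma>) (v, k)) - F (em \<sigma>)))))"
    unfolding sum.cartesian_product' sum_distrib_left ..
  also have "\<dots> = (\<Sum>\<sigma>\<in>\<Omega>. \<Sum>v\<in>V. if \<sigma> v = q then \<Sum>k\<in>{1..q - 1}. pmf p (\<sigma>(v := k)) * (f (\<sigma>(v := k)) - f \<sigma>)\<^sup>2 else 0)"
  proof (intro sum.cong refl)
    fix \<sigma> v assume \<sigma>: "\<sigma> \<in> \<Omega>" and v: "v \<in> V"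
    show "(\<Sum>k\<in>{1..q - 1}. pmf ep (em \<sigma>) * (birth ep (em \<sigma>) (v, k) *
      ((F (add_unit (em \<sigma>) (v, k)) - F (em \<sigma>)) * (F (add_unit (em \<sigma>) (v, k)) - F (em \<sigma>))))) =
      (if \<sigma> v = q then \<Sum>k\<in>{1..q - 1}. pmf p (\<sigma>(v := k)) * (f (\<sigma>(v := k)) - f \<sigma>)\<^sup>2 else 0)"
    proof (cases "\<sigma> v = q")
      case False
      then have "birth ep (em \<sigma>) (v, k) = 0" if "k \<in> {1..q - 1}" for k
        using add_unit_em_iff[OF \<sigma> v that] by (simp add: birth_eq_0)
      then show ?thesis using False by simp
    next
      case True
      have "pmf ep (em \<sigma>) * (birth ep (em \<sigma>) (v, k) *
        ((F (add_unit (em \<sigma>) (v, k)) - F (em \<sigma>)) * (F (add_unit (em \<sigma>) (v, k)) - F (em \<sigma>)))) =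
        pmf p (\<sigma>(v := k)) * (f (\<sigma>(v := k)) - f \<sigma>)\<^sup>2" if k: "k \<in> {1..q - 1}" for k
      proof -
        have s: "\<sigma>(v := k) \<in> \<Omega>" using configs_upd[OF \<sigma> v, of k] k by auto
        have a: "add_unit (em \<sigma>) (v, k) = em (\<sigma>(v := k))" by (rule add_unit_em[of v k \<sigma>, OF v k True])
        have "k \<noteq> q" using k q1 by auto
        then have z: "em \<sigma> (v, k) = 0" using True by (simp add: em_apply)
        have "birth ep (em \<sigma>) (v, k) = pmf p (\<sigma>(v := k)) / pmf p \<sigma>"
          unfolding birth_def a z pmf_ep[OF \<sigma>] pmf_ep[OF s] by simp
        then show ?thesis
          unfolding a pmf_ep[OF \<sigma>] F[OF \<sigma>] F[OF s] using pmf_pos[OF \<sigma>] by (simp add: power2_eq_square)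
      qed
      then show ?thesis using True by (simp del: One_nat_def atLeastAtMost_iff)
    qed
  qed
  also have "\<dots> = (\<Sum>v\<in>V. \<Sum>\<sigma>\<in>\<Omega>. if \<sigma> v = q then \<Sum>k\<in>{1..q - 1}. pmf p (\<sigma>(v := k)) * (f (\<sigma>(v := k)) - f \<sigma>)\<^sup>2 else 0)"
    by (rule sum.swap)
  also have "\<dots> = (\<Sum>v\<in>V. \<Sum>\<sigma>\<in>{\<sigma> \<in> \<Omega>. \<sigma> v = q}. \<Sum>k\<in>{1..q - 1}. pmf p (\<sigma>(v := k)) * (f (\<sigma>(v := k)) - f \<sigma>)\<^sup>2)"
    using finO by (intro sum.cong refl sum.inter_filter[symmetric])
  finally show ?thesis .
qed

lemma energy_le_site_variances:
  assumes F: "\<And>\<sigma>. \<sigma> \<in> \<Omega> \<Longrightarrow> F (em \<sigma>) = f \<sigma>" and deg: "\<And>\<sigma> v c. v \<in> V \<Longrightarrow> deg \<sigma> v c \<le> \<Delta>"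
  shows "B ^ \<Delta> * energy J ep F F \<le> 2 * real q * (\<Sum>v\<in>V. \<Sum>\<sigma>\<in>\<Omega>. pmf p \<sigma> * (f \<sigma> - site_avg v f \<sigma>)\<^sup>2)"
proof -
  have "B ^ \<Delta> * energy J ep F F = (\<Sum>v\<in>V. \<Sum>\<sigma>\<in>{\<sigma> \<in> \<Omega>. \<sigma> v = q}.
      B ^ \<Delta> * (\<Sum>k\<in>{1..q - 1}. pmf p (\<sigma>(v := k)) * (f (\<sigma>(v := k)) - f \<sigma>)\<^sup>2))"
  proof -
    have e: "energy J ep F F = (\<Sum>v\<in>V. \<Sum>\<sigma>\<in>{\<sigma> \<in> \<Omega>. \<sigma> v = q}.
        \<Sum>k\<in>{1..q - 1}. pmf p (\<sigma>(v := k)) * (f (\<sigma>(v := k)) - f \<sigma>)\<^sup>2)"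
      by (rule energy_embedded) (rule F)
    show ?thesis unfolding e by (simp only: sum_distrib_left)
  qed
  also have "\<dots> \<le> (\<Sum>v\<in>V. \<Sum>\<sigma>\<in>{\<sigma> \<in> \<Omega>. \<sigma> v = q}.
      2 * real q * (\<Sum>c\<in>{1..q}. pmf p (\<sigma>(v := c)) * (f (\<sigma>(v := c)) - site_avg v f \<sigma>)\<^sup>2))"
    by (intro sum_mono fibre_energy_le[OF _ _ _ deg]) auto
  also have "\<dots> = (\<Sum>v\<in>V. 2 * real q * (\<Sum>\<sigma>\<in>\<Omega>. pmf p \<sigma> * (f \<sigma> - site_avg v f \<sigma>)\<^sup>2))"
    by (intro sum.cong refl) (simp add: sum_fibres[of _ "\<lambda>\<sigma>. pmf p \<sigma> * (f \<sigma> - site_avg _ f \<sigma>)\<^sup>2"] sum_distrib_left)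
  finally show ?thesis by (simp only: sum_distrib_left)
qed

text \<open>Convexity over the vertices bounds the squared norm of the updated function by the
  average of the squared projections. The Poincare inequality thus yields contraction directly,
  without discussing negative eigenvalues of the Glauber kernel.\<close>

lemma glauber_op_contraction:
  assumes ulc: "ULC \<delta> J ep" and deg: "\<And>\<sigma> v c. v \<in> V \<Longrightarrow> deg \<sigma> v c \<le> \<Delta>" and V: "V \<noteq> {}"
    and mean: "(\<Sum>\<sigma>\<in>\<Omega>. pmf p \<sigma> * f \<sigma>) = 0"
  shows "(\<Sum>\<sigma>\<in>\<Omega>. pmf p \<sigma> * (glauber_op f \<sigma>)\<^sup>2) \<le>
    (1 - \<delta> * B ^ \<Delta> / (2 * real q * card V)) * (\<Sum>\<sigma>\<in>\<Omega>. pmf p \<sigma> * (f \<sigma>)\<^sup>2)"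
proof -
  let ?N = "\<lambda>g. \<Sum>\<sigma>\<in>\<Omega>. pmf p \<sigma> * (g \<sigma>)\<^sup>2"
  define F where "F n = f (inv_into \<Omega> em n)" for n
  have F: "F (em \<sigma>) = f \<sigma>" if "\<sigma> \<in> \<Omega>" for \<sigma> using that by (simp add: F_def inv_into_f_f[OF inj_em])
  have tr: "(\<Sum>n\<in>set_pmf ep. pmf ep n * G (F n)) = (\<Sum>\<sigma>\<in>\<Omega>. pmf p \<sigma> * G (f \<sigma>))" for G :: "real \<Rightarrow> real"
    unfolding set_pmf_ep by (subst sum.reindex[OF inj_em]) (auto intro!: sum.cong simp: pmf_ep F)
  have cV: "0 < real (card V)" using V finV by (simp add: card_gt_0_iff)
  have q0: "0 < real q" using q1 by simp
  have "\<delta> * ?N f \<le> energy J ep F F"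
    using ULC_poincare[OF ulc finite_set_pmf_ep, of F] tr[of "\<lambda>x. x"] tr[of "\<lambda>x. x\<^sup>2"] mean by simp
  then have "B ^ \<Delta> * (\<delta> * ?N f) \<le> B ^ \<Delta> * energy J ep F F" using B0 by (intro mult_left_mono) auto
  also have "\<dots> \<le> 2 * real q * (\<Sum>v\<in>V. \<Sum>\<sigma>\<in>\<Omega>. pmf p \<sigma> * (f \<sigma> - site_avg v f \<sigma>)\<^sup>2)"
    by (rule energy_le_site_variances[of F f, OF F deg])
  also have "(\<Sum>v\<in>V. \<Sum>\<sigma>\<in>\<Omega>. pmf p \<sigma> * (f \<sigma> - site_avg v f \<sigma>)\<^sup>2) = (\<Sum>v\<in>V. ?N f - ?N (site_avg v f))"
    by (intro sum.cong refl site_avg_variance)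
  also have "\<dots> = card V * ?N f - (\<Sum>v\<in>V. ?N (site_avg v f))" by (simp add: sum_subtractf)
  also have "\<dots> \<le> card V * ?N f - card V * ?N (glauber_op f)"
  proof -
    have "card V * (glauber_op f \<sigma>)\<^sup>2 \<le> (\<Sum>v\<in>V. (site_avg v f \<sigma>)\<^sup>2)" for \<sigma>
    proof -
      have "card V * (glauber_op f \<sigma>)\<^sup>2 = (\<Sum>v\<in>V. site_avg v f \<sigma>)\<^sup>2 / card V"
        using cV by (simp add: glauber_op_def power2_eq_square)
      also have "\<dots> \<le> (\<Sum>v\<in>V. (site_avg v f \<sigma>)\<^sup>2) * card V / card V"
        using sum_squared_le_sum_of_squares[of "\<lambda>v. site_avg v f \<sigma>" V]
        by (intro divide_right_mono) (auto simp: mult.commute)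
      finally show ?thesis using cV by simp
    qed
    then have "(\<Sum>\<sigma>\<in>\<Omega>. pmf p \<sigma> * (card V * (glauber_op f \<sigma>)\<^sup>2)) \<le> (\<Sum>\<sigma>\<in>\<Omega>. pmf p \<sigma> * (\<Sum>v\<in>V. (site_avg v f \<sigma>)\<^sup>2))"
      by (intro sum_mono mult_left_mono) auto
    also have "\<dots> = (\<Sum>v\<in>V. ?N (site_avg v f))"
      unfolding sum_distrib_left by (rule sum.swap)
    finally show ?thesis by (simp add: sum_distrib_left mult.left_commute)
  qed
  finally have "B ^ \<Delta> * (\<delta> * ?N f) \<le> 2 * real q * (card V * ?N f - card V * ?N (glauber_op f))"
    using q0 by simp
  then show ?thesis using cV q0 by (simp add: field_simps)
qed

section \<open>From L2 contraction to the mixing time\<close>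

lemma glauber_op_diff_const: "V \<noteq> {} \<Longrightarrow> glauber_op (\<lambda>\<sigma>. f \<sigma> - a) \<sigma> = glauber_op f \<sigma> - a"
proof -
  assume V: "V \<noteq> {}"
  have "site_avg v (\<lambda>\<sigma>. f \<sigma> - a) \<sigma> = site_avg v f \<sigma> - a" for v
    by (simp add: site_avg_def right_diff_distrib sum_subtractf sum_distrib_right[symmetric] sum_wt del: One_nat_def)
  then show ?thesis using V finV by (simp add: glauber_op_def sum_subtractf diff_divide_distrib card_gt_0_iff)
qed

lemma set_pmf_update: "\<sigma> \<in> \<Omega> \<Longrightarrow> v \<in> V \<Longrightarrow> set_pmf (glauber_update q V E B v \<sigma>) \<subseteq> \<Omega>"
proof
  fix \<tau> assume \<sigma>: "\<sigma> \<in> \<Omega>" and v: "v \<in> V" and "\<tau> \<in> set_pmf (glauber_update q V E B v \<sigma>)"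
  then have "\<tau> = \<sigma>(v := \<tau> v)" "\<tau> v \<in> {1..q}"
    by (auto simp: set_pmf_iff pmf_glauber_update[OF q1 B0] split: if_splits)
  then show "\<tau> \<in> \<Omega>" using configs_upd[OF \<sigma> v, of "\<tau> v"] by simp
qed

lemma set_pmf_glauber: "V \<noteq> {} \<Longrightarrow> \<sigma> \<in> \<Omega> \<Longrightarrow> set_pmf (glauber q V E B \<sigma>) \<subseteq> \<Omega>"
  using finV set_pmf_update unfolding glauber_def by (force simp: set_bind_pmf)

lemma set_pmf_kernel_pow: "V \<noteq> {} \<Longrightarrow> x \<in> \<Omega> \<Longrightarrow> set_pmf (kernel_pow (glauber q V E B) t x) \<subseteq> \<Omega>"
  using set_pmf_glauber by (induction t) (force simp: set_bind_pmf)+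

lemma update_expectation:
  assumes \<tau>: "\<tau> \<in> \<Omega>" and v: "v \<in> V"
  shows "(\<Sum>\<sigma>\<in>\<Omega>. h \<sigma> * pmf (glauber_update q V E B v \<tau>) \<sigma>) = site_avg v h \<tau>"
proof -
  let ?u = "glauber_update q V E B v \<tau>"
  let ?I = "(\<lambda>c. \<tau>(v := c)) ` {1..q}"
  have inj: "inj_on (\<lambda>c. \<tau>(v := c)) {1..q}" by (auto simp: inj_on_def fun_upd_eqD)
  have "(\<Sum>\<sigma>\<in>\<Omega>. h \<sigma> * pmf ?u \<sigma>) = (\<Sum>\<sigma>\<in>?I. h \<sigma> * pmf ?u \<sigma>)"
  proof (rule sum.mono_neutral_right[OF finO])
    show "?I \<subseteq> \<Omega>" using configs_upd[OF \<tau> v] by blast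
    show "\<forall>\<sigma>\<in>\<Omega> - ?I. h \<sigma> * pmf ?u \<sigma> = 0"
      unfolding pmf_glauber_update[OF q1 B0] by (auto simp del: One_nat_def atLeastAtMost_iff)
  qed
  also have "\<dots> = (\<Sum>c\<in>{1..q}. h (\<tau>(v := c)) * pmf ?u (\<tau>(v := c)))"
    using inj by (simp add: sum.reindex)
  also have "\<dots> = site_avg v h \<tau>"
    unfolding site_avg_def pmf_glauber_update[OF q1 B0] wt_def
    by (intro sum.cong refl) (simp del: One_nat_def)
  finally show ?thesis .
qed

text \<open>By detailed balance, the density with respect to the Potts measure evolves under the
  Glauber operator itself, so the contraction applies to it.\<close>

lemma density_step:
  assumes V: "V \<noteq> {}" and K: "set_pmf K \<subseteq> \<Omega>" and \<tau>: "\<tau> \<in> \<Omega>"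
  shows "pmf (bind_pmf K (glauber q V E B)) \<tau> / pmf p \<tau> = glauber_op (\<lambda>\<sigma>. pmf K \<sigma> / pmf p \<sigma>) \<tau>"
proof -
  let ?u = "glauber_update q V E B"
  have "pmf (bind_pmf K (glauber q V E B)) \<tau> = (\<Sum>\<sigma>\<in>\<Omega>. pmf K \<sigma> * pmf (glauber q V E B \<sigma>) \<tau>)"
    unfolding pmf_bind using K finO by (subst integral_measure_pmf[of \<Omega>]) auto
  also have "\<dots> = (\<Sum>\<sigma>\<in>\<Omega>. pmf K \<sigma> * ((\<Sum>v\<in>V. pmf (?u v \<sigma>) \<tau>) / card V))"
    unfolding glauber_def pmf_bind integral_pmf_of_set[OF V finV] ..
  finally have "pmf (bind_pmf K (glauber q V E B)) \<tau> / pmf p \<tau> =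
     (\<Sum>\<sigma>\<in>\<Omega>. \<Sum>v\<in>V. pmf K \<sigma> * pmf (?u v \<sigma>) \<tau> / pmf p \<tau>) / card V"
    by (simp add: sum_divide_distrib sum_distrib_left field_simps)
  also have "(\<Sum>\<sigma>\<in>\<Omega>. \<Sum>v\<in>V. pmf K \<sigma> * pmf (?u v \<sigma>) \<tau> / pmf p \<tau>) =
      (\<Sum>\<sigma>\<in>\<Omega>. \<Sum>v\<in>V. pmf K \<sigma> / pmf p \<sigma> * pmf (?u v \<tau>) \<sigma>)"
  proof (intro sum.cong refl)
    fix \<sigma> v assume s: "\<sigma> \<in> \<Omega>" and v: "v \<in> V"
    have "pmf (?u v \<sigma>) \<tau> / pmf p \<tau> = pmf (?u v \<tau>) \<sigma> / pmf p \<sigma>"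
      using potts_detailed_balance[OF finV edges q1 B0 v s \<tau>] pmf_pos[OF s] pmf_pos[OF \<tau>]
      by (simp add: field_simps)
    then show "pmf K \<sigma> * pmf (?u v \<sigma>) \<tau> / pmf p \<tau> = pmf K \<sigma> / pmf p \<sigma> * pmf (?u v \<tau>) \<sigma>"
      by (metis times_divide_eq_right times_divide_eq_left)
  qed
  also have "\<dots> = (\<Sum>v\<in>V. \<Sum>\<sigma>\<in>\<Omega>. pmf K \<sigma> / pmf p \<sigma> * pmf (?u v \<tau>) \<sigma>)" by (rule sum.swap)
  also have "\<dots> = (\<Sum>v\<in>V. site_avg v (\<lambda>\<sigma>. pmf K \<sigma> / pmf p \<sigma>) \<tau>)"
    by (intro sum.cong refl update_expectation[OF \<tau>])
  finally show ?thesis by (simp add: glauber_op_def)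
qed

lemma chi_square_decay:
  assumes ulc: "ULC \<delta> J ep" and deg: "\<And>\<sigma> v c. v \<in> V \<Longrightarrow> deg \<sigma> v c \<le> \<Delta>" and V: "V \<noteq> {}" and x: "x \<in> \<Omega>"
    and c: "0 \<le> 1 - \<delta> * B ^ \<Delta> / (2 * real q * card V)"
  shows "(\<Sum>\<sigma>\<in>\<Omega>. pmf p \<sigma> * (pmf (kernel_pow (glauber q V E B) t x) \<sigma> / pmf p \<sigma> - 1)\<^sup>2) \<le>
     (1 - \<delta> * B ^ \<Delta> / (2 * real q * card V)) ^ t / pmf p x"
proof (induction t)
  case 0
  \<comment> \<open>At time 0 the chi-square distance is 1 / \<open>pmf p x\<close> - 1.\<close>
  have "(\<Sum>\<sigma>\<in>\<Omega>. pmf p \<sigma> * (of_bool (\<sigma> = x) / pmf p \<sigma> - 1)\<^sup>2) =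
     (\<Sum>\<sigma>\<in>\<Omega>. (if \<sigma> = x then 1 / pmf p x - 2 else 0) + pmf p \<sigma>)"
    using pmf_pos[OF x] by (intro sum.cong refl) (auto simp: field_simps power2_eq_square)
  also have "\<dots> = 1 / pmf p x - 1"
    using x finO sum_pmf_eq_1[OF finO, of p] by (simp add: sum.distrib set_pmf_potts)
  finally have "(\<Sum>\<sigma>\<in>\<Omega>. pmf p \<sigma> * (of_bool (\<sigma> = x) / pmf p \<sigma> - 1)\<^sup>2) \<le> 1 / pmf p x" by simp
  moreover have "pmf (return_pmf x) \<sigma> = of_bool (\<sigma> = x)" for \<sigma> by (auto simp: pmf_return)
  ultimately show ?case by simp
next
  case (Suc t)
  let ?K = "kernel_pow (glauber q V E B) t x"
  let ?h = "\<lambda>\<sigma>. pmf ?K \<sigma> / pmf p \<sigma>"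
  have K: "set_pmf ?K \<subseteq> \<Omega>" by (rule set_pmf_kernel_pow[OF V x])
  have "(\<Sum>\<sigma>\<in>\<Omega>. pmf p \<sigma> * (?h \<sigma> - 1)) = (\<Sum>\<sigma>\<in>\<Omega>. pmf ?K \<sigma> - pmf p \<sigma>)"
  proof (intro sum.cong refl)
    fix \<sigma> assume "\<sigma> \<in> \<Omega>"
    then show "pmf p \<sigma> * (?h \<sigma> - 1) = pmf ?K \<sigma> - pmf p \<sigma>"
      using pmf_pos[of \<sigma>] by (simp add: right_diff_distrib)
  qed
  also have "\<dots> = 0"
    using sum_pmf_eq_1[OF finO K] sum_pmf_eq_1[OF finO, of p] by (simp add: sum_subtractf set_pmf_potts)
  finally have mean: "(\<Sum>\<sigma>\<in>\<Omega>. pmf p \<sigma> * (?h \<sigma> - 1)) = 0" .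
  have "(\<Sum>\<sigma>\<in>\<Omega>. pmf p \<sigma> * (pmf (kernel_pow (glauber q V E B) (Suc t) x) \<sigma> / pmf p \<sigma> - 1)\<^sup>2) =
     (\<Sum>\<sigma>\<in>\<Omega>. pmf p \<sigma> * (glauber_op (\<lambda>\<sigma>. ?h \<sigma> - 1) \<sigma>)\<^sup>2)"
    by (intro sum.cong refl) (simp add: density_step[OF V K] glauber_op_diff_const[OF V])
  also have "\<dots> \<le> (1 - \<delta> * B ^ \<Delta> / (2 * real q * card V)) * (\<Sum>\<sigma>\<in>\<Omega>. pmf p \<sigma> * (?h \<sigma> - 1)\<^sup>2)"
    by (rule glauber_op_contraction[OF ulc deg V mean])
  also have "\<dots> \<le> (1 - \<delta> * B ^ \<Delta> / (2 * real q * card V)) * ((1 - \<delta> * B ^ \<Delta> / (2 * real q * card V)) ^ t / pmf p x)"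
    by (intro mult_left_mono Suc.IH c)
  finally show ?case by simp
qed

text \<open>For any event the difference of probabilities is at most the L1 distance, and
  Cauchy-Schwarz against the total mass 1 bounds that by the chi-square distance.\<close>

lemma total_variation_le_chi_square:
  assumes K: "set_pmf K \<subseteq> \<Omega>"
  shows "total_variation K p \<le> sqrt (\<Sum>\<sigma>\<in>\<Omega>. pmf p \<sigma> * (pmf K \<sigma> / pmf p \<sigma> - 1)\<^sup>2)"
  unfolding total_variation_def
proof (rule cSUP_least)
  fix A :: "('v \<Rightarrow> nat) set"
  have prob: "measure_pmf.prob M A = (\<Sum>\<sigma>\<in>\<Omega> \<inter> A. pmf M \<sigma>)" if "set_pmf M \<subseteq> \<Omega>" for M
  proof -
    have "measure_pmf.prob M A = measure_pmf.prob M (\<Omega> \<inter> A)"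
      using that by (intro measure_pmf.finite_measure_eq_AE) (auto simp: AE_measure_pmf_iff)
    then show ?thesis using finO by (simp add: measure_measure_pmf_finite)
  qed
  have "\<bar>measure_pmf.prob K A - measure_pmf.prob p A\<bar> = \<bar>\<Sum>\<sigma>\<in>\<Omega> \<inter> A. pmf K \<sigma> - pmf p \<sigma>\<bar>"
    using prob[OF K] prob[of p] by (simp add: set_pmf_potts sum_subtractf)
  also have "\<dots> \<le> (\<Sum>\<sigma>\<in>\<Omega> \<inter> A. \<bar>pmf K \<sigma> - pmf p \<sigma>\<bar>)" by (rule sum_abs)
  also have "\<dots> \<le> (\<Sum>\<sigma>\<in>\<Omega>. \<bar>pmf K \<sigma> - pmf p \<sigma>\<bar>)"
    using finO by (intro sum_mono2) auto
  also have "\<dots> = (\<Sum>\<sigma>\<in>\<Omega>. sqrt (pmf p \<sigma>) * (sqrt (pmf p \<sigma>) * \<bar>pmf K \<sigma> / pmf p \<sigma> - 1\<bar>))"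
  proof (intro sum.cong refl)
    fix \<sigma> assume "\<sigma> \<in> \<Omega>"
    then have "0 < pmf p \<sigma>" by (rule pmf_pos)
    moreover have "\<bar>pmf p \<sigma> * (pmf K \<sigma> / pmf p \<sigma> - 1)\<bar> = pmf p \<sigma> * \<bar>pmf K \<sigma> / pmf p \<sigma> - 1\<bar>"
      by (simp add: abs_mult)
    ultimately show "\<bar>pmf K \<sigma> - pmf p \<sigma>\<bar> = sqrt (pmf p \<sigma>) * (sqrt (pmf p \<sigma>) * \<bar>pmf K \<sigma> / pmf p \<sigma> - 1\<bar>)"
      by (simp add: right_diff_distrib flip: mult.assoc)
  qed
  also have "\<dots> \<le> sqrt (\<Sum>\<sigma>\<in>\<Omega>. pmf p \<sigma> * (pmf K \<sigma> / pmf p \<sigma> - 1)\<^sup>2)"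
  proof (rule real_le_rsqrt)
    have "(\<Sum>\<sigma>\<in>\<Omega>. sqrt (pmf p \<sigma>) * (sqrt (pmf p \<sigma>) * \<bar>pmf K \<sigma> / pmf p \<sigma> - 1\<bar>))\<^sup>2 \<le>
       (\<Sum>\<sigma>\<in>\<Omega>. (sqrt (pmf p \<sigma>))\<^sup>2) * (\<Sum>\<sigma>\<in>\<Omega>. (sqrt (pmf p \<sigma>) * \<bar>pmf K \<sigma> / pmf p \<sigma> - 1\<bar>)\<^sup>2)"
      by (rule Cauchy_Schwarz_ineq_sum)
    also have "\<dots> = (\<Sum>\<sigma>\<in>\<Omega>. pmf p \<sigma> * (pmf K \<sigma> / pmf p \<sigma> - 1)\<^sup>2)"
      using sum_pmf_eq_1[OF finO, of p] by (simp add: set_pmf_potts power_mult_distrib)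
    finally show "(\<Sum>\<sigma>\<in>\<Omega>. sqrt (pmf p \<sigma>) * (sqrt (pmf p \<sigma>) * \<bar>pmf K \<sigma> / pmf p \<sigma> - 1\<bar>))\<^sup>2 \<le>
       (\<Sum>\<sigma>\<in>\<Omega>. pmf p \<sigma> * (pmf K \<sigma> / pmf p \<sigma> - 1)\<^sup>2)" .
  qed
  finally show "\<bar>measure_pmf.prob K A - measure_pmf.prob p A\<bar> \<le> \<dots>" .
qed auto

text \<open>As B < 1, every weight is at most 1, so the partition function is at most the number of
  configurations.\<close>

lemma pmf_lower_bound:
  assumes x: "x \<in> \<Omega>" and m: "card E \<le> m"
  shows "B ^ m / real q ^ card V \<le> pmf p x"
proof -
  have fE: "finite E" using edges finV by (auto intro: finite_subset[of E "Pow V"])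
  have "mono_edges E x \<le> card E" unfolding mono_edges_def by (rule card_mono[OF fE]) auto
  then have num: "B ^ m \<le> B ^ mono_edges E x" using m B0 B1 by (intro power_decreasing) auto
  have "(\<Sum>\<tau>\<in>\<Omega>. B ^ mono_edges E \<tau>) \<le> (\<Sum>\<tau>\<in>\<Omega>. 1)"
    using B0 B1 by (intro sum_mono power_le_one) auto
  also have "\<dots> = real q ^ card V" by (simp add: configs_def card_funcsetE[OF finV])
  finally have den: "(\<Sum>\<tau>\<in>\<Omega>. B ^ mono_edges E \<tau>) \<le> real q ^ card V" .
  have "0 < (\<Sum>\<tau>\<in>\<Omega>. B ^ mono_edges E \<tau>)" using x finO B0 by (intro sum_pos) auto
  with num den show ?thesis
    unfolding pmf_potts[OF finV q1 B0] using x B0 by (simp add: frac_le)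
qed

text \<open>With \<gamma> the contraction rate, (1 - \<gamma>)^t \<le> exp (-\<gamma> t), and
  \<open>t\<close> is just large enough for this to be at most \<epsilon>^2 times the lower bound on
  \<open>pmf p x\<close>. That accounts for the three summands of the last factor.\<close>

theorem mixing_time_le:
  assumes ulc: "ULC \<delta> J ep" and deg: "\<And>\<sigma> v c. v \<in> V \<Longrightarrow> deg \<sigma> v c \<le> \<Delta>" and V: "V \<noteq> {}"
    and \<delta>: "\<delta> \<le> 1" and m: "card E \<le> m" and \<epsilon>: "0 < \<epsilon>"
    and t: "2 * real q * card V / (\<delta> * B ^ \<Delta>) * (card V * ln q + m * ln (1 / B) + 2 * ln (1 / \<epsilon>)) \<le> real t"
  shows "mixing_time \<Omega> (glauber q V E B) p \<epsilon> \<le> enat t"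
proof -
  define \<gamma> where "\<gamma> = \<delta> * B ^ \<Delta> / (2 * real q * card V)"
  have \<delta>0: "0 < \<delta>" using ULC_D[OF ulc] by simp
  have cV: "1 \<le> real (card V)" using V finV by (simp add: card_gt_0_iff Suc_le_eq)
  have q0: "1 \<le> real q" using q1 by simp
  have \<gamma>0: "0 < \<gamma>" using \<delta>0 B0 cV q0 by (simp add: \<gamma>_def)
  have "\<delta> * B ^ \<Delta> \<le> 1 * 1" using \<delta> \<delta>0 B0 B1 by (intro mult_mono power_le_one) auto
  also have "\<dots> \<le> 2 * real q * card V" using mult_mono[OF q0 cV] q0 by simp
  finally have \<gamma>1: "\<gamma> \<le> 1" using q0 cV by (simp add: \<gamma>_def)
  have "total_variation (kernel_pow (glauber q V E B) t x) p \<le> \<epsilon>" if x: "x \<in> \<Omega>" for x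
  proof -
    let ?K = "kernel_pow (glauber q V E B) t x"
    have px: "0 < pmf p x" by (rule pmf_pos[OF x])
    let ?L = "card V * ln q + m * ln (1 / B) + 2 * ln (1 / \<epsilon>)"
    have "?L = \<gamma> * (2 * real q * card V / (\<delta> * B ^ \<Delta>) * ?L)"
      using \<delta>0 B0 cV q0 by (simp add: \<gamma>_def)
    also have "\<dots> \<le> \<gamma> * t" using t \<gamma>0 by (intro mult_left_mono) auto
    finally have Lt: "?L \<le> \<gamma> * t" .
    have "(1 - \<gamma>) ^ t \<le> exp (- \<gamma>) ^ t"
      using \<gamma>1 exp_ge_add_one_self[of "- \<gamma>"] by (intro power_mono) auto
    also have "\<dots> = exp (- (\<gamma> * t))" by (simp flip: exp_of_nat_mult add: mult.commute)
    also have "\<dots> \<le> exp (- ?L)" using Lt by simp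
    also have "- ?L = m * ln B - card V * ln q + 2 * ln \<epsilon>"
      using B0 \<epsilon> by (simp add: ln_div)
    also have "exp \<dots> = B ^ m / real q ^ card V * \<epsilon>\<^sup>2"
    proof -
      have "exp (2 * ln \<epsilon>) = \<epsilon>\<^sup>2" using \<epsilon> by (simp add: exp_double)
      then show ?thesis using B0 q0 by (simp add: exp_add exp_diff exp_of_nat_mult)
    qed
    also have "\<dots> \<le> pmf p x * \<epsilon>\<^sup>2" by (intro mult_right_mono pmf_lower_bound x m) auto
    finally have dec: "(1 - \<gamma>) ^ t / pmf p x \<le> \<epsilon>\<^sup>2" using px by (simp add: divide_le_eq mult.commute)
    have "total_variation ?K p \<le> sqrt (\<Sum>\<sigma>\<in>\<Omega>. pmf p \<sigma> * (pmf ?K \<sigma> / pmf p \<sigma> - 1)\<^sup>2)"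
      by (rule total_variation_le_chi_square[OF set_pmf_kernel_pow[OF V x]])
    also have "\<dots> \<le> sqrt (\<epsilon>\<^sup>2)"
    proof (rule real_sqrt_le_mono)
      have "(\<Sum>\<sigma>\<in>\<Omega>. pmf p \<sigma> * (pmf ?K \<sigma> / pmf p \<sigma> - 1)\<^sup>2) \<le> (1 - \<gamma>) ^ t / pmf p x"
        unfolding \<gamma>_def by (rule chi_square_decay[OF ulc deg V x]) (use \<gamma>1 in \<open>auto simp: \<gamma>_def\<close>)
      with dec show "(\<Sum>\<sigma>\<in>\<Omega>. pmf p \<sigma> * (pmf ?K \<sigma> / pmf p \<sigma> - 1)\<^sup>2) \<le> \<epsilon>\<^sup>2" by linarith
    qed
    also have "\<dots> = \<epsilon>" using \<epsilon> by simp
    finally show ?thesis .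
  qed
  then have "(INF t\<in>{t. total_variation (kernel_pow (glauber q V E B) t x) p \<le> \<epsilon>}. enat t) \<le> enat t" if "x \<in> \<Omega>" for x
    using that by (intro INF_lower) auto
  then show ?thesis
    unfolding mixing_time_def using finO configs_nonempty[OF q1, of V] by (subst Max_le_iff) auto
qed

end

section \<open>Random regular graphs of large degree\<close>

text \<open>The three requirements on the degree: B stays above 1 - \<zeta>/2; the logarithm from
  the smallest probability is absorbed; and the bound on the least eigenvalue, times 1 - B and
  B^(-\<Delta>), stays small enough for \<delta> \<ge> 1/2.\<close>

definition large_degree :: "real \<Rightarrow> real \<Rightarrow> bool" where
  "large_degree \<zeta> x \<longleftrightarrow> ln x / x \<le> \<zeta> \<and> ln x * x powr (- \<zeta> / 2) \<le> 1 \<and>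
    (480 * sqrt x * (log 2 x + 2) + 8) * (ln x / x) * x powr (1 / 2 - \<zeta> / 2) \<le> 1"

lemma eventually_large_degree:
  assumes "0 < \<zeta>"
  shows "eventually (large_degree \<zeta>) at_top"
proof -
  have le: "eventually (\<lambda>x. f x \<le> c) at_top" if "(f \<longlongrightarrow> 0) at_top" "0 < c" for f :: "real \<Rightarrow> real" and c
    using order_tendstoD(2)[OF that] by (auto elim: eventually_mono)
  have "((\<lambda>x::real. ln x / x) \<longlongrightarrow> 0) at_top" by real_asymp
  moreover have "((\<lambda>x::real. ln x * x powr (- \<zeta> / 2)) \<longlongrightarrow> 0) at_top" using assms by real_asymp
  moreover have "((\<lambda>x::real. (480 * sqrt x * (log 2 x + 2) + 8) * (ln x / x) * x powr (1 / 2 - \<zeta> / 2)) \<longlongrightarrow> 0) at_top"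
    using assms by real_asymp
  ultimately show ?thesis
    unfolding large_degree_def by (intro eventually_conj le) (use assms in auto)
qed

text \<open>The cutoff \<gamma> is log2 \<Delta> rounded up, which shrinks the contribution of
  distant levels to at most 8.\<close>

lemma pseudorandom_lambda_min_ge_log:
  assumes E: "E \<in> regular_graphs \<Delta> n" and P: "pseudorandom \<Delta> n E" and n: "0 < n" and \<Delta>: "1 \<le> \<Delta>"
  shows "- lambda_min (adjacency_matrix n E) \<le> 480 * sqrt \<Delta> * (log 2 \<Delta> + 2) + 8"
proof -
  define \<gamma> where "\<gamma> = nat \<lceil>log 2 \<Delta>\<rceil>"
  have l0: "0 \<le> log 2 \<Delta>" using \<Delta> by simp
  then have g: "log 2 \<Delta> \<le> real \<gamma>" "real \<gamma> \<le> log 2 \<Delta> + 1" unfolding \<gamma>_def by linarith+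
  have "real \<Delta> = 2 powr log 2 \<Delta>" using \<Delta> by simp
  also have "\<dots> \<le> 2 powr real \<gamma>" using g by simp
  also have "\<dots> = 2 ^ \<gamma>" by (simp add: powr_realpow)
  finally have "real \<Delta> * (1/2) ^ \<gamma> \<le> 1" by (simp add: power_one_over field_simps)
  moreover have "480 * sqrt \<Delta> * (real \<gamma> + 1) \<le> 480 * sqrt \<Delta> * (log 2 \<Delta> + 2)"
    using g by (intro mult_left_mono) auto
  ultimately show ?thesis using pseudorandom_lambda_min_ge[OF E P n, of \<gamma>] by simp
qed

text \<open>From ln (1/B) \<le> (1 - B)/B. Dividing by B is paid for by raising the coefficient 1/2
  - \<zeta> to 1/2 - \<zeta>/2, which still leaves a gain over sqrt \<Delta>.\<close>

lemma inverse_power_bound: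
  fixes B \<zeta> :: real and \<Delta> :: nat
  assumes \<zeta>: "0 < \<zeta>" "\<zeta> < 1/2" and \<Delta>: "1 \<le> \<Delta>" and B: "0 < B" "B < 1"
    and b: "1 - B \<le> (1/2 - \<zeta>) * (ln \<Delta> / \<Delta>)" and l: "ln \<Delta> / \<Delta> \<le> \<zeta>"
  shows "\<Delta> * ln (1 / B) \<le> (1 / 2 - \<zeta> / 2) * ln \<Delta>" "1 / B ^ \<Delta> \<le> \<Delta> powr (1 / 2 - \<zeta> / 2)"
proof -
  have d0: "0 < real \<Delta>" and ln0: "0 \<le> ln (real \<Delta>)" using \<Delta> by auto
  have "(1/2 - \<zeta>) * (ln \<Delta> / \<Delta>) \<le> (1/2) * \<zeta>"
    using \<zeta> l ln0 by (intro mult_mono) auto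
  with b have "1 - B \<le> (1/2) * \<zeta>" by linarith
  then have B2: "1 - \<zeta> / 2 \<le> B" by simp
  have c: "1/2 - \<zeta> \<le> (1 / 2 - \<zeta> / 2) * B"
  proof -
    \<comment> \<open>The right side is 1/2 - 3 \<zeta>/4 + \<zeta>^2/4.\<close>
    have "1/2 - \<zeta> \<le> (1 / 2 - \<zeta> / 2) * (1 - \<zeta> / 2)"
      using \<zeta> by (simp add: algebra_simps)
    also have "\<dots> \<le> (1 / 2 - \<zeta> / 2) * B" using B2 \<zeta> by (intro mult_left_mono) auto
    finally show ?thesis .
  qed
  have "ln (1 / B) \<le> 1 / B - 1" using B by (intro ln_le_minus_one) auto
  also have "\<dots> = (1 - B) / B" using B by (simp add: field_simps)
  finally have "\<Delta> * ln (1 / B) \<le> \<Delta> * ((1 - B) / B)" using d0 by (intro mult_left_mono) auto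
  also have "\<dots> = (\<Delta> * (1 - B)) / B" by simp
  also have "\<dots> \<le> ((1/2 - \<zeta>) * ln \<Delta>) / B"
  proof (rule divide_right_mono)
    have "\<Delta> * (1 - B) \<le> \<Delta> * ((1/2 - \<zeta>) * (ln \<Delta> / \<Delta>))" using b d0 by (intro mult_left_mono) auto
    then show "\<Delta> * (1 - B) \<le> (1/2 - \<zeta>) * ln \<Delta>" using d0 by simp
  qed (use B in auto)
  also have "\<dots> \<le> (((1 / 2 - \<zeta> / 2) * B) * ln \<Delta>) / B"
    using c ln0 B by (intro divide_right_mono mult_right_mono) auto
  also have "\<dots> = (1 / 2 - \<zeta> / 2) * ln \<Delta>" using B by simp
  finally show 1: "\<Delta> * ln (1 / B) \<le> (1 / 2 - \<zeta> / 2) * ln \<Delta>" .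
  have "1 / B ^ \<Delta> = (1 / B) ^ \<Delta>" by (simp add: power_one_over)
  also have "\<dots> = exp (\<Delta> * ln (1 / B))" using B by (subst exp_of_nat_mult) (simp add: exp_ln)
  also have "\<dots> \<le> exp ((1 / 2 - \<zeta> / 2) * ln \<Delta>)" using 1 by simp
  also have "\<dots> = \<Delta> powr (1 / 2 - \<zeta> / 2)" using d0 by (simp add: powr_def)
  finally show "1 / B ^ \<Delta> \<le> \<Delta> powr (1 / 2 - \<zeta> / 2)" .
qed

lemma regular_graph_degree_bounds:
  assumes E: "E \<in> regular_graphs \<Delta> n"
  shows "v < n \<Longrightarrow> colour_degree {..<n} E \<sigma> v c \<le> \<Delta>" "card E \<le> n * \<Delta>"
proof -
  note R = regular_graphsD[OF E]
  show "colour_degree {..<n} E \<sigma> v c \<le> \<Delta>" if "v < n"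
  proof -
    have "real (card {w \<in> {..<n}. {v, w} \<in> E \<and> \<sigma> w = c}) \<le> real (card {w \<in> {..<n}. {v, w} \<in> E})"
      by (intro of_nat_mono card_mono) auto
    also have "\<dots> = (\<Sum>w<n. adj E v w)" by (simp add: adj_def Int_def)
    finally show ?thesis using sum_adj[OF E that] by (simp add: colour_degree_def)
  qed
  have "E \<subseteq> (\<Union>v\<in>{..<n}. {e \<in> E. v \<in> e})"
  proof
    fix e assume e: "e \<in> E"
    then have "e \<noteq> {}" "e \<subseteq> {..<n}" using R(2)[OF e] R(3)[OF e] by auto
    with e show "e \<in> (\<Union>v\<in>{..<n}. {e \<in> E. v \<in> e})" by blast
  qed
  then have "card E \<le> card (\<Union>v\<in>{..<n}. {e \<in> E. v \<in> e})" using R(1) by (intro card_mono) auto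
  also have "\<dots> \<le> (\<Sum>v<n. card {e \<in> E. v \<in> e})" by (intro card_UN_le) auto
  also have "\<dots> = n * \<Delta>" using R(4) by simp
  finally show "card E \<le> n * \<Delta>" .
qed

definition ulc_and_mixing :: "nat \<Rightarrow> real \<Rightarrow> nat \<Rightarrow> real \<Rightarrow> nat \<Rightarrow> nat set set \<Rightarrow> bool" where
  "ulc_and_mixing q C \<Delta> B n E \<longleftrightarrow>
    (let V = {..<n};
         lstar = - lambda_min (adjacency_matrix n E);
         \<delta> = 1 - lstar * (1 - B) * B powi (1 - int \<Delta>)
     in ULC \<delta> (V \<times> {1..q - 1}) (embedded_potts q V E B) \<and>
        \<delta> \<ge> 1/2 \<and>
        (\<forall>\<epsilon>::real. 0 < \<epsilon> \<and> \<epsilon> < 1/2 \<longrightarrow>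
           ereal_of_enat (mixing_time (configs q V) (glauber q V E B) (potts q V E B) \<epsilon>)
             \<le> ereal (C * (sqrt (real \<Delta>) * (real n)\<^sup>2 * ln (1 / \<epsilon>)))))"

text \<open>In the constant, 4 q is the comparison factor 2 q times 1/\<delta> \<le> 2, the bracket
  collects n ln q, n and 2 ln (1/\<epsilon>), and the final 2 pays for rounding.\<close>

lemma pseudorandom_ulc_and_mixing:
  fixes q n \<Delta> :: nat and B \<zeta> :: real
  assumes q: "3 \<le> q" and \<zeta>: "0 < \<zeta>" "\<zeta> < 1/2" and \<Delta>: "1 \<le> \<Delta>" "large_degree \<zeta> \<Delta>"
    and B: "0 < B" "B < 1" and b: "1 - B \<le> (1/2 - \<zeta>) * (ln \<Delta> / \<Delta>)"
    and E: "E \<in> regular_graphs \<Delta> n" and P: "pseudorandom \<Delta> n E" and n: "0 < n"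
  shows "ulc_and_mixing q (4 * q * (2 * ln q + 4) + 2) \<Delta> B n E"
proof -
  define \<delta> where "\<delta> = 1 - - lambda_min (adjacency_matrix n E) * (1 - B) * B powi (1 - int \<Delta>)"
  note \<delta> = \<delta>_def
  have l: "ln \<Delta> / \<Delta> \<le> \<zeta>" "ln \<Delta> * \<Delta> powr (- \<zeta> / 2) \<le> 1"
      "(480 * sqrt \<Delta> * (log 2 \<Delta> + 2) + 8) * (ln \<Delta> / \<Delta>) * \<Delta> powr (1 / 2 - \<zeta> / 2) \<le> 1"
    using \<Delta>(2) by (auto simp: large_degree_def)
  note R = regular_graphsD[OF E]
  interpret potts_model q "{..<n}" E B
    using E q B by unfold_locales (auto simp: regular_graphs_def)
  let ?lam = "- lambda_min (adjacency_matrix n E)"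
  let ?r = "1 / 2 - \<zeta> / 2"
  have d0: "1 \<le> real \<Delta>" and ln0: "0 \<le> ln (real \<Delta>)" using \<Delta> by auto
  have lam0: "0 \<le> ?lam" using lambda_min_nonpos[OF n R(5)[of 0]] by simp
  have powi: "B powi (1 - int \<Delta>) = B * (1 / B ^ \<Delta>)" using B by (simp add: power_int_diff)
  note inv = inverse_power_bound[OF \<zeta> \<Delta>(1) B b l(1)]
  \<comment> \<open>The bounds on the eigenvalue, on 1 - B and on B^(-\<Delta>) are multiplied.
    Weakening 1/2 - \<zeta> to 1/2 and using the last clause of \<open>large_degree\<close> leaves
    1/2.\<close>
  have "?lam * (1 - B) * (B * (1 / B ^ \<Delta>)) \<le>
      (480 * sqrt \<Delta> * (log 2 \<Delta> + 2) + 8) * ((1/2) * (ln \<Delta> / \<Delta>)) * (1 * \<Delta> powr ?r)"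
  proof (intro mult_mono inv pseudorandom_lambda_min_ge_log[OF E P n \<Delta>(1)])
    have "(1/2 - \<zeta>) * (ln \<Delta> / \<Delta>) \<le> (1/2) * (ln \<Delta> / \<Delta>)" using \<zeta> ln0 by (intro mult_right_mono) auto
    with b show "1 - B \<le> (1/2) * (ln \<Delta> / \<Delta>)" by linarith
  qed (use B lam0 ln0 d0 in \<open>auto intro!: mult_nonneg_nonneg add_nonneg_nonneg\<close>)
  then have half: "?lam * (1 - B) * (B powi (1 - int \<Delta>)) \<le> 1/2"
    using l(3) by (simp add: powi)
  then have \<delta>2: "1/2 \<le> \<delta>" by (simp add: \<delta>)
  have deg: "colour_degree {..<n} E \<sigma> v c \<le> \<Delta>" if "v \<in> {..<n}" for \<sigma> v c
    using regular_graph_degree_bounds(1)[OF E] that by simp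
  have ulc: "ULC \<delta> ({..<n} \<times> {1..q - 1}) (embedded_potts q {..<n} E B)"
  proof (rule embedded_potts_ULC[OF _ lam0 deg \<Delta>(1) \<delta>])
    show "- ?lam * (\<Sum>v<n. (x v)\<^sup>2) \<le> (\<Sum>v<n. \<Sum>w<n. x v * x w * adj E v w)" for x
      using lambda_min_le_quadratic_form[OF n, of E x] by simp
    show "0 < \<delta>" using \<delta>2 by simp
  qed
  have "0 \<le> ?lam * (1 - B) * B powi (1 - int \<Delta>)"
    using lam0 B by (intro mult_nonneg_nonneg) auto
  then have \<delta>1: "\<delta> \<le> 1" by (simp add: \<delta>)
  let ?C = "4 * q * (2 * ln q + 4) + 2"
  let ?tmix = "\<lambda>\<epsilon>. mixing_time (configs q {..<n}) (glauber q {..<n} E B) (potts q {..<n} E B) \<epsilon>"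
  have "ereal_of_enat (?tmix \<epsilon>) \<le> ereal (?C * (sqrt \<Delta> * (real n)\<^sup>2 * ln (1 / \<epsilon>)))" if \<epsilon>: "0 < \<epsilon>" "\<epsilon> < 1/2" for \<epsilon>
  proof -
    define x where "x = ln (1 / \<epsilon>)"
    have "1/2 \<le> ln (2::real)" by (rule order_trans[OF _ ln2_ge_two_thirds]) simp
    also have "\<dots> \<le> x" unfolding x_def using \<epsilon> by (subst ln_le_cancel_iff) (auto simp: field_simps)
    finally have x2: "1 \<le> 2 * x" by simp
    let ?T = "2 * real q * card {..<n} / (\<delta> * B ^ \<Delta>) * (card {..<n} * ln q + (n * \<Delta>) * ln (1 / B) + 2 * ln (1 / \<epsilon>))"
    define t where "t = nat \<lceil>?T\<rceil>"
    have n1: "1 \<le> real n" using n by simp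
    have lnq: "0 \<le> ln (real q)" using q by simp
    have A0: "0 \<le> n * ln q + n * ln \<Delta> + 2 * x"
      using lnq ln0 x2 by (intro add_nonneg_nonneg mult_nonneg_nonneg) auto
    have "?T = 2 * real q * n * (1 / \<delta> * (1 / B ^ \<Delta>)) * (n * ln q + n * (\<Delta> * ln (1 / B)) + 2 * x)"
      by (simp add: x_def mult.assoc)
    also have "\<dots> \<le> 2 * real q * n * (2 * \<Delta> powr ?r) * (n * ln q + n * ln \<Delta> + 2 * x)"
    proof (intro mult_mono add_mono order_refl mult_left_mono)
      have "1 / \<delta> \<le> 1 / (1/2)" using \<delta>2 by (intro divide_left_mono) auto
      then show "1 / \<delta> \<le> 2" by simp
      show "1 / B ^ \<Delta> \<le> \<Delta> powr ?r" by (rule inv)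
      have "\<Delta> * ln (1 / B) \<le> ?r * ln \<Delta>" by (rule inv)
      also have "\<dots> \<le> 1 * ln \<Delta>" using \<zeta> ln0 by (intro mult_right_mono) auto
      finally show "\<Delta> * ln (1 / B) \<le> ln \<Delta>" by simp
      have "0 \<le> ln (1 / B)" using B by simp
      then show "0 \<le> n * ln q + n * (\<Delta> * ln (1 / B)) + 2 * x"
        using lnq x2 by (intro add_nonneg_nonneg mult_nonneg_nonneg) auto
    qed (use B \<delta>2 lnq x2 in auto)
    also have "\<dots> = 4 * real q * n * sqrt \<Delta> * (\<Delta> powr (- \<zeta> / 2) * (n * ln q + n * ln \<Delta> + 2 * x))"
    proof -
      have "\<Delta> powr ?r = \<Delta> powr (1/2) * \<Delta> powr (- \<zeta> / 2)" by (simp flip: powr_add)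
      then show ?thesis using d0 by (simp add: powr_half_sqrt mult_ac)
    qed
    \<comment> \<open>The surplus factor \<Delta>^(-\<zeta>/2) cancels ln \<Delta>, so no logarithm
      of the degree survives next to sqrt \<Delta>.\<close>
    also have "\<dots> \<le> 4 * real q * n * sqrt \<Delta> * (n * ln q + n + 2 * x)"
    proof (intro mult_left_mono)
      have p1: "\<Delta> powr (- \<zeta> / 2) \<le> 1" using powr_mono[of "- \<zeta> / 2" 0 "real \<Delta>"] d0 \<zeta> by simp
      have "\<Delta> powr (- \<zeta> / 2) * (n * ln q + n * ln \<Delta> + 2 * x) =
        \<Delta> powr (- \<zeta> / 2) * (n * ln q) + n * (ln \<Delta> * \<Delta> powr (- \<zeta> / 2)) + \<Delta> powr (- \<zeta> / 2) * (2 * x)"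
        by (simp add: algebra_simps)
      also have "\<dots> \<le> 1 * (n * ln q) + real n * 1 + 1 * (2 * x)"
      proof (intro add_mono)
        show "\<Delta> powr (- \<zeta> / 2) * (n * ln q) \<le> 1 * (n * ln q)" using p1 lnq by (intro mult_right_mono) auto
        show "n * (ln \<Delta> * \<Delta> powr (- \<zeta> / 2)) \<le> real n * 1" by (intro mult_left_mono l(2)) auto
        show "\<Delta> powr (- \<zeta> / 2) * (2 * x) \<le> 1 * (2 * x)" using p1 x2 by (intro mult_right_mono) auto
      qed
      finally show "\<Delta> powr (- \<zeta> / 2) * (n * ln q + n * ln \<Delta> + 2 * x) \<le> n * ln q + n + 2 * x" by simp
    qed auto
    also have "\<dots> \<le> 4 * real q * n * sqrt \<Delta> * (n * ((2 * ln q + 4) * x))"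
    proof (intro mult_left_mono)
      have "n * ln q * 1 \<le> n * ln q * (2 * x)" "real n * 1 \<le> n * (2 * x)" "1 * (2 * x) \<le> n * (2 * x)"
        using x2 n1 lnq by (intro mult_left_mono mult_right_mono; simp)+
      then show "n * ln q + n + 2 * x \<le> n * ((2 * ln q + 4) * x)" by (simp add: algebra_simps)
    qed auto
    also have "\<dots> = 4 * q * (2 * ln q + 4) * (sqrt \<Delta> * (real n)\<^sup>2 * x)"
      by (simp add: power2_eq_square)
    finally have T: "?T \<le> 4 * q * (2 * ln q + 4) * (sqrt \<Delta> * (real n)\<^sup>2 * x)" .
    have T0: "0 \<le> ?T"
      using \<delta>2 B lnq x2 by (intro mult_nonneg_nonneg add_nonneg_nonneg divide_nonneg_nonneg) (auto simp: x_def)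
    have "1 * 1 * 1 \<le> sqrt \<Delta> * (real n)\<^sup>2 * (2 * x)"
      using d0 n1 x2 by (intro mult_mono) (auto simp: one_le_power)
    then have one: "1 \<le> 2 * (sqrt \<Delta> * (real n)\<^sup>2 * x)" by simp
    \<comment> \<open>Rounding up costs at most 1, which \<open>one\<close> absorbs because
      \<epsilon> < 1/2 keeps ln (1/\<epsilon>) above 1/2.\<close>
    have "real t \<le> ?T + 1" unfolding t_def using T0 by linarith
    also have "\<dots> \<le> 4 * q * (2 * ln q + 4) * (sqrt \<Delta> * (real n)\<^sup>2 * x) + 2 * (sqrt \<Delta> * (real n)\<^sup>2 * x)"
      using T one by (rule add_mono)
    finally have tb: "real t \<le> ?C * (sqrt \<Delta> * (real n)\<^sup>2 * x)"
      by (simp only: distrib_right)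
    have "?tmix \<epsilon> \<le> enat t"
    proof (rule mixing_time_le[OF ulc deg _ \<delta>1 regular_graph_degree_bounds(2)[OF E] \<epsilon>(1)])
      show "{..<n} \<noteq> {}" using n by auto
      show "?T \<le> real t" unfolding t_def by linarith
    qed
    then have "ereal_of_enat (?tmix \<epsilon>) \<le> ereal_of_enat (enat t)" by (simp only: ereal_of_enat_le_iff)
    also have "\<dots> \<le> ereal (?C * (sqrt \<Delta> * (real n)\<^sup>2 * x))" using tb by simp
    finally show ?thesis by (simp only: x_def)
  qed
  with \<delta>2 ulc show ?thesis unfolding ulc_and_mixing_def Let_def \<delta>[symmetric] by blast
qed

text \<open>Quantifying \<open>C\<close> before \<zeta> expresses dependence on q alone.
  \<open>B\<close> may vary with n, since the good event is defined by the graph only. The filter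
  lets n tend to infinity among those with n \<Delta> even, where regular graphs eventually exist
  and the failure probability is at most 2/n^2.\<close>

theorem corollary6p8:
  fixes q :: nat
  assumes "q \<ge> 3"
  shows "\<exists>C::real. C > 0 \<and> (\<forall>\<zeta>::real. 0 < \<zeta> \<and> \<zeta> < 1/2 \<longrightarrow>
    (\<exists>\<Delta>\<^sub>0::nat. \<forall>\<Delta>\<ge>\<Delta>\<^sub>0. \<forall>B :: nat \<Rightarrow> real.
      (\<forall>n. 0 < B n \<and> B n < 1 \<and> 1 - B n \<le> (1/2 - \<zeta>) * (ln (real \<Delta>) / real \<Delta>)) \<longrightarrow>
      ((\<lambda>n. measure_pmf.prob (random_regular_graph \<Delta> n)
          {E. let V = {..<n};
                  lstar = - lambda_min (adjacency_matrix n E);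
                  \<delta> = 1 - lstar * (1 - B n) * B n powi (1 - int \<Delta>)
              in ULC \<delta> (V \<times> {1..q - 1}) (embedded_potts q V E (B n)) \<and>
                 \<delta> \<ge> 1/2 \<and>
                 (\<forall>\<epsilon>::real. 0 < \<epsilon> \<and> \<epsilon> < 1/2 \<longrightarrow>
                    ereal_of_enat (mixing_time (configs q V) (glauber q V E (B n)) (potts q V E (B n)) \<epsilon>)
                      \<le> ereal (C * (sqrt (real \<Delta>) * (real n)\<^sup>2 * ln (1 / \<epsilon>))))})
        \<longlongrightarrow> 1) (inf sequentially (principal {n. even (n * \<Delta>)}))))"
  unfolding ulc_and_mixing_def[symmetric]
proof (intro exI[of _ "4 * q * (2 * ln q + 4) + 2"] conjI allI impI)
  let ?C = "4 * q * (2 * ln q + 4) + 2"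
  show "0 < ?C"
    using assms by (intro add_nonneg_pos mult_nonneg_nonneg add_nonneg_nonneg) auto
  fix \<zeta> :: real assume "0 < \<zeta> \<and> \<zeta> < 1/2"
  then have \<zeta>: "0 < \<zeta>" "\<zeta> < 1/2" by auto
  obtain D :: nat where D: "\<And>\<Delta>. D \<le> \<Delta> \<Longrightarrow> large_degree \<zeta> (real \<Delta>)"
    using eventually_compose_filterlim[OF eventually_large_degree[OF \<zeta>(1)] filterlim_real_sequentially]
    unfolding eventually_sequentially by blast
  show "\<exists>\<Delta>\<^sub>0::nat. \<forall>\<Delta>\<ge>\<Delta>\<^sub>0. \<forall>B :: nat \<Rightarrow> real.
      (\<forall>n. 0 < B n \<and> B n < 1 \<and> 1 - B n \<le> (1/2 - \<zeta>) * (ln (real \<Delta>) / real \<Delta>)) \<longrightarrow>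
      ((\<lambda>n. measure_pmf.prob (random_regular_graph \<Delta> n) {E. ulc_and_mixing q ?C \<Delta> (B n) n E})
        \<longlongrightarrow> 1) (inf sequentially (principal {n. even (n * \<Delta>)}))"
  proof (intro exI[of _ "max 1 D"] allI impI)
    fix \<Delta> :: nat and B :: "nat \<Rightarrow> real"
    assume \<Delta>: "max 1 D \<le> \<Delta>"
      and B: "\<forall>n. 0 < B n \<and> B n < 1 \<and> 1 - B n \<le> (1/2 - \<zeta>) * (ln (real \<Delta>) / real \<Delta>)"
    then have \<Delta>1: "1 \<le> \<Delta>" "large_degree \<zeta> \<Delta>" using D[of \<Delta>] by auto
    let ?F = "inf sequentially (principal {n. even (n * \<Delta>)})"
    let ?P = "\<lambda>n. measure_pmf.prob (random_regular_graph \<Delta> n)"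
    let ?good = "\<lambda>n. {E. ulc_and_mixing q ?C \<Delta> (B n) n E}"
    have good: "{E \<in> regular_graphs \<Delta> n. pseudorandom \<Delta> n E} \<subseteq> ?good n" if "0 < n" for n
      using pseudorandom_ulc_and_mixing[OF assms \<zeta> \<Delta>1, of "B n"] B that by blast
    have lower: "eventually (\<lambda>n. 1 - 2 / (real n)\<^sup>2 \<le> ?P n (?good n)) ?F"
      unfolding eventually_inf_principal
      using eventually_ge_at_top[of "4 * \<Delta> * (\<Delta> + 1)"] eventually_gt_at_top[of "2 * \<Delta>"]
    proof eventually_elim
      case (elim n)
      show ?case
      proof
        assume "n \<in> {n. even (n * \<Delta>)}"
        then have "regular_graphs \<Delta> n \<noteq> {}" using elim by (intro circulant_regular) auto
        then have "1 - 2 / (real n)\<^sup>2 \<le> ?P n {E \<in> regular_graphs \<Delta> n. pseudorandom \<Delta> n E}"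
          using elim \<Delta>1 by (intro pseudorandom_prob) auto
        also have "\<dots> \<le> ?P n (?good n)"
          using elim by (intro measure_pmf.finite_measure_mono good) auto
        finally show "1 - 2 / (real n)\<^sup>2 \<le> ?P n (?good n)" .
      qed
    qed
    have lim: "((\<lambda>n::nat. 1 - 2 / (real n)\<^sup>2) \<longlongrightarrow> 1) sequentially" by real_asymp
    show "((\<lambda>n. ?P n (?good n)) \<longlongrightarrow> 1) ?F"
    proof (rule tendsto_sandwich[OF lower _ tendsto_mono[OF inf_le1 lim] tendsto_const])
      show "eventually (\<lambda>n. ?P n (?good n) \<le> 1) ?F"
        by (intro always_eventually allI) simp
    qed
  qed
qed

end
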